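(* If $n\ge 3$, then $\mathrm{SL}(n,\mathbb{Z})$ fixes a point whenever it acts by semisimple isometries on a complete $\mathrm{CAT}(0)$ space.
   Context: An isometry $\gamma$ of a metric space $X$ is semisimple if there is $x_0\in X$ with $d(\gamma x_0,x_0)=\inf\{d(\gamma y,y)\mid y\in X\}$. An action by isometries is a homomorphism to $\mathrm{Isom}(X)$; it is by semisimple isometries if every group element acts as a semisimple isometry. $\mathrm{CAT}(0)$ spaces are non-empty and not assumed locally compact. *)

theory Defs
  imports
    "HOL-Analysis.Analysis"
    "HOL-Algebra.Bij"
    "Jordan_Normal_Form.Determinant"
begin

section \<open>CAT(0) spaces\<close>

text \<open>A metric space is a carrier set \<open>M\<close> with a distance \<open>d\<close>, as in the library locale
  \<open>Metric_space\<close>. A geodesic segment joining \<open>x\<close> to \<open>y\<close> is the image of an isometric embedding of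
  an interval. There may be several such segments.\<close>

definition geodesic_segment :: "'a set \<Rightarrow> ('a \<Rightarrow> 'a \<Rightarrow> real) \<Rightarrow> 'a \<Rightarrow> 'a \<Rightarrow> 'a set \<Rightarrow> bool" where
  "geodesic_segment M d x y S \<longleftrightarrow>
     (\<exists>c l. 0 \<le> l \<and> c \<in> {0..l} \<rightarrow> M \<and> c 0 = x \<and> c l = y \<and>
        (\<forall>s\<in>{0..l}. \<forall>t\<in>{0..l}. d (c s) (c t) = \<bar>s - t\<bar>) \<and> S = c ` {0..l})"

definition geodesic_space :: "'a set \<Rightarrow> ('a \<Rightarrow> 'a \<Rightarrow> real) \<Rightarrow> bool" where
  "geodesic_space M d \<longleftrightarrow> (\<forall>x\<in>M. \<forall>y\<in>M. \<exists>S. geodesic_segment M d x y S)"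

definition comparison_triangle ::
  "('a \<Rightarrow> 'a \<Rightarrow> real) \<Rightarrow> 'a \<Rightarrow> 'a \<Rightarrow> 'a \<Rightarrow> real^2 \<Rightarrow> real^2 \<Rightarrow> real^2 \<Rightarrow> bool" where
  "comparison_triangle d p q r p' q' r' \<longleftrightarrow>
     dist p' q' = d p q \<and> dist q' r' = d q r \<and> dist r' p' = d r p"

text \<open>\<open>x'\<close> is the comparison point on \<open>[p', q']\<close> of the point \<open>x\<close> of the side \<open>S\<close> joining \<open>p\<close> to
  \<open>q\<close>.\<close>

definition comparison_point ::
  "('a \<Rightarrow> 'a \<Rightarrow> real) \<Rightarrow> 'a \<Rightarrow> 'a set \<Rightarrow> 'a \<Rightarrow> real^2 \<Rightarrow> real^2 \<Rightarrow> real^2 \<Rightarrow> bool" where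
  "comparison_point d p S x p' q' x' \<longleftrightarrow>
     x \<in> S \<and> x' \<in> closed_segment p' q' \<and> dist p' x' = d p x"

text \<open>The CAT(0) inequality for the geodesic triangle with vertices \<open>p, q, r\<close> and sides
  \<open>A = [p, q]\<close>, \<open>B = [q, r]\<close>, \<open>C = [r, p]\<close>. A vertex lies on two sides and has the same
  comparison point with respect to both. Quantifying over all comparison triangles is harmless:
  one always exists, and it is unique up to an isometry of the plane.\<close>

definition CAT0_inequality ::
  "('a \<Rightarrow> 'a \<Rightarrow> real) \<Rightarrow> 'a \<Rightarrow> 'a \<Rightarrow> 'a \<Rightarrow> 'a set \<Rightarrow> 'a set \<Rightarrow> 'a set \<Rightarrow> bool" where
  "CAT0_inequality d p q r A B C \<longleftrightarrow>
     (\<forall>p' q' r'. comparison_triangle d p q r p' q' r' \<longrightarrow>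
       (let cmp = (\<lambda>x x'. comparison_point d p A x p' q' x' \<or>
                          comparison_point d q B x q' r' x' \<or>
                          comparison_point d r C x r' p' x')
        in \<forall>x y x' y'. cmp x x' \<and> cmp y y' \<longrightarrow> d x y \<le> dist x' y'))"

definition CAT0_space :: "'a set \<Rightarrow> ('a \<Rightarrow> 'a \<Rightarrow> real) \<Rightarrow> bool" where
  "CAT0_space M d \<longleftrightarrow>
     Metric_space M d \<and> M \<noteq> {} \<and> geodesic_space M d \<and>
     (\<forall>p\<in>M. \<forall>q\<in>M. \<forall>r\<in>M. \<forall>A B C.
        geodesic_segment M d p q A \<and> geodesic_segment M d q r B \<and> geodesic_segment M d r p C
        \<longrightarrow> CAT0_inequality d p q r A B C)"

section \<open>Isometries\<close>

definition Isom :: "'a set \<Rightarrow> ('a \<Rightarrow> 'a \<Rightarrow> real) \<Rightarrow> ('a \<Rightarrow> 'a) monoid" where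
  "Isom M d = (BijGroup M)
     \<lparr>carrier := {f \<in> Bij M. \<forall>x\<in>M. \<forall>y\<in>M. d (f x) (f y) = d x y}\<rparr>"

definition semisimple :: "'a set \<Rightarrow> ('a \<Rightarrow> 'a \<Rightarrow> real) \<Rightarrow> ('a \<Rightarrow> 'a) \<Rightarrow> bool" where
  "semisimple M d f \<longleftrightarrow>
     f \<in> carrier (Isom M d) \<and> (\<exists>x0\<in>M. d (f x0) x0 = (INF y\<in>M. d (f y) y))"

lemma group_Isom: "group (Isom M d)"
proof -
  interpret B: group "BijGroup M" by (rule group_BijGroup)
  have "subgroup {f \<in> Bij M. \<forall>x\<in>M. \<forall>y\<in>M. d (f x) (f y) = d x y} (BijGroup M)"
  proof (rule B.subgroupI)
    show "{f \<in> Bij M. \<forall>x\<in>M. \<forall>y\<in>M. d (f x) (f y) = d x y} \<noteq> {}"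
      using id_Bij[of M] by fastforce
  next
    fix f assume f: "f \<in> {f \<in> Bij M. \<forall>x\<in>M. \<forall>y\<in>M. d (f x) (f y) = d x y}"
    then have inv: "inv\<^bsub>BijGroup M\<^esub> f = restrict (inv_into M f) M" by (simp add: inv_BijGroup)
    have bij: "bij_betw f M M" using f by (simp add: Bij_def)
    have "d (inv_into M f x) (inv_into M f y) = d x y" if xy: "x \<in> M" "y \<in> M" for x y
    proof -
      have "inv_into M f x \<in> M" "inv_into M f y \<in> M"
        using xy bij_betw_apply[OF bij_betw_inv_into[OF bij]] by blast+
      then have "d (f (inv_into M f x)) (f (inv_into M f y)) = d (inv_into M f x) (inv_into M f y)"
        using f by blast
      then show ?thesis by (simp add: bij_betw_inv_into_right[OF bij] xy)
    qed
    with f show "inv\<^bsub>BijGroup M\<^esub> f \<in> {f \<in> Bij M. \<forall>x\<in>M. \<forall>y\<in>M. d (f x) (f y) = d x y}"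
      by (simp add: inv restrict_inv_into_Bij)
  qed (auto simp: BijGroup_def compose_Bij compose_eq Bij_imp_funcset[THEN funcset_mem])
  from B.subgroup_imp_group[OF this] show ?thesis by (simp add: Isom_def)
qed

section \<open>The group SL(n, Z)\<close>

definition SL_int :: "nat \<Rightarrow> int mat monoid" where
  "SL_int n = \<lparr>carrier = {A \<in> carrier_mat n n. Determinant.det A = 1}, mult = (*), one = 1\<^sub>m n\<rparr>"

lemma group_SL_int: "group (SL_int n)"
proof (rule groupI)
  fix A assume "A \<in> carrier (SL_int n)"
  then have A: "A \<in> carrier_mat n n" and d: "Determinant.det A = 1" by (auto simp: SL_int_def)
  have "Determinant.det (adj_mat A) * Determinant.det A = Determinant.det (adj_mat A * A)"
    using Determinant.det_mult[OF adj_mat(1)[OF A] A] by simp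
  also have "adj_mat A * A = 1\<^sub>m n"
    unfolding adj_mat(3)[OF A] d by (rule eq_matI) auto
  finally have "Determinant.det (adj_mat A) = 1" using d by simp
  then show "\<exists>B\<in>carrier (SL_int n). B \<otimes>\<^bsub>SL_int n\<^esub> A = \<one>\<^bsub>SL_int n\<^esub>"
    using adj_mat(1)[OF A] \<open>adj_mat A * A = 1\<^sub>m n\<close> by (auto simp: SL_int_def)
qed (auto simp: SL_int_def Determinant.det_mult)

end

theory Submission
  imports Defs "HOL-Number_Theory.Number_Theory"
begin

text \<open>The group \<open>SL(n, Z)\<close> with \<open>n \<ge> 3\<close> is boundedly generated by elementary matrices, and in an action by
semisimple isometries every elementary matrix has a fixed point. These two facts make every orbit
bounded, and a bounded orbit in a complete CAT(0) space has a circumcentre, which the group fixes.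

\<^bold>\<open>Elementary matrices are elliptic.\<close> An elementary matrix \<open>E\<^sub>i\<^sub>j(m\<^sup>2)\<close> is the commutator of
\<open>E\<^sub>i\<^sub>l(m)\<close> and \<open>E\<^sub>l\<^sub>j(m)\<close>, so \<open>E\<^sub>i\<^sub>j(1)\<close> to the power \<open>m\<^sup>2\<close> moves a base point by at most a constant times
\<open>m\<close>. In a CAT(0) space the least displacement of an isometry at least doubles when the isometry is
squared (join the midpoints of \<open>[y, f y]\<close> and \<open>[f y, f f y]\<close>). The two estimates are compatible only
if the infimum of the displacement of \<open>E\<^sub>i\<^sub>j(1)\<close> is \<open>0\<close>, and semisimplicity turns this into a fixed point
(\<open>distorted_semisimple_fixes_point\<close>, \<open>addrow_mat_fixes_point\<close>). So the length \<open>d (\<rho> g x) x\<close> is bounded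
on the set of all elementary matrices.

\<^bold>\<open>A length that is bounded on elementary matrices is bounded.\<close> This is the theorem of Carter and
Keller, stated for lengths instead of words. Boundedly many elementary operations carry a matrix of
\<open>SL(n, Z)\<close> into the corner \<open>SL(2, Z)\<close> (\<open>reduce_to_block_2\<close>). Up to a bounded error, the length of
\<open>[[a, b], [c, d]]\<close> in the corner depends only on the row \<open>(a, b)\<close>, and it does not change when a multiple
of one entry of the row is added to the other. The presence of a third coordinate makes it behave like a Mennicke
symbol, multiplicative in \<open>b\<close> up to a bounded error (\<open>mennicke\<close>). Consequently the \<open>m\<close>-th power of the
matrix has the same length, up to an error that is independent of \<open>m\<close>, as a matrix with first row
\<open>(\<alpha>, b)\<close>, where \<open>\<alpha>\<close> is congruent to \<open>a\<^sup>m\<close> modulo \<open>b\<close> (\<open>pow_len_row\<close>). In particular the \<open>m\<close>-th power has bounded length when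
\<open>a\<^sup>m\<close> is \<open>1\<close> or \<open>-1\<close> modulo \<open>b\<close>. Replacing \<open>b\<close> by a number congruent to it modulo \<open>a\<close> does not affect the
lengths of powers either, because these can also be read off from the first column. So it suffices
to find, after changing \<open>a\<close> modulo \<open>b\<close>, two numbers \<open>p\<close> and \<open>q\<close> congruent to \<open>b\<close> modulo \<open>a\<close> and
consecutive exponents \<open>k + 1\<close> and \<open>k\<close> for which \<open>a\<^bsup>k+1\<^esup>\<close> is \<open>1\<close> or \<open>-1\<close> modulo \<open>p\<close> and \<open>a\<^sup>k\<close> is \<open>1\<close>
modulo \<open>q\<close>: then the matrix itself is a quotient of two short matrices. Primes in suitable arithmetic
progressions do this (\<open>coprime_exponents\<close>).

\<^bold>\<open>Dirichlet's theorem.\<close> The primes come from \<open>dirichlet_primes_infinite\<close>, which is proved by the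
classical route: orthogonality of characters, Euler products for real \<open>s > 1\<close>, and \<open>L(1, \<psi>) \<noteq> 0\<close>.
For characters that are not real-valued, non-vanishing holds because at most one \<open>L\<close>-function can
vanish at \<open>1\<close>; for real characters it is Monsky's argument with the series
\<open>\<Sum> \<psi>(n) t\<^sup>n / (1 - t\<^sup>n)\<close>.\<close>

section \<open>Dirichlet characters\<close>

definition dirichlet_characters :: "nat \<Rightarrow> (nat \<Rightarrow> complex) set" where
  "dirichlet_characters m = {\<psi>. \<psi> 1 = 1 \<and> (\<forall>x y. \<psi> (x * y) = \<psi> x * \<psi> y) \<and>
     (\<forall>x. \<psi> (x mod m) = \<psi> x) \<and> (\<forall>x. \<psi> x = 0 \<longleftrightarrow> \<not> coprime x m)}"

text \<open>Characters of a subgroup of the units modulo \<open>m\<close>. Both the subgroup and the character are kept as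
objects on the natural numbers that are invariant under reduction modulo \<open>m\<close>, so that products
need no reduction.\<close>

definition partial_character :: "nat \<Rightarrow> nat set \<Rightarrow> (nat \<Rightarrow> complex) \<Rightarrow> bool" where
  "partial_character m H \<psi> \<longleftrightarrow> 1 \<in> H \<and> (\<forall>x\<in>H. coprime x m) \<and> (\<forall>x\<in>H. \<forall>y\<in>H. x * y \<in> H) \<and>
     (\<forall>x. x mod m \<in> H \<longleftrightarrow> x \<in> H) \<and> \<psi> 1 = 1 \<and> (\<forall>x\<in>H. \<forall>y\<in>H. \<psi> (x * y) = \<psi> x * \<psi> y) \<and>
     (\<forall>x\<in>H. \<psi> (x mod m) = \<psi> x)"

lemma partial_character_pow:
  assumes "partial_character m H \<psi>" "x \<in> H"
  shows "x ^ j \<in> H" "\<psi> (x ^ j) = \<psi> x ^ j"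
  using assms by (induction j) (auto simp: partial_character_def)

lemma partial_character_cong:
  assumes "partial_character m H \<psi>" "x \<in> H" "[x = y] (mod m)"
  shows "y \<in> H" "\<psi> y = \<psi> x"
  using assms unfolding partial_character_def cong_def by metis+

text \<open>Some power of a unit is \<open>1\<close>.\<close>

lemma partial_character_nonzero:
  assumes pc: "partial_character m H \<psi>" and x: "x \<in> H" and m: "m > 0"
  shows "\<psi> x \<noteq> 0"
proof
  assume 0: "\<psi> x = 0"
  have "coprime x m" using pc x by (auto simp: partial_character_def)
  then have "[x ^ totient m = 1] (mod m)" by (rule euler_theorem)
  then have "\<psi> (x ^ totient m) = \<psi> 1"
    using partial_character_cong(2)[OF pc] partial_character_pow(1)[OF pc x] by metis
  moreover have "\<psi> (x ^ totient m) = 0"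
    using 0 m partial_character_pow(2)[OF pc x] by (simp add: zero_power)
  ultimately show False using pc by (simp add: partial_character_def)
qed

text \<open>Inverses modulo \<open>m\<close> are powers, so a set closed under products is a subgroup.\<close>

lemma partial_character_quotient:
  assumes pc: "partial_character m H \<psi>" and xH: "x \<in> H" and yH: "x * y \<in> H" and y: "coprime y m"
    and m: "m > 0"
  shows "y \<in> H"
proof -
  let ?f = "totient m"
  have "coprime x m" using pc xH by (auto simp: partial_character_def)
  then have "[x ^ ?f = 1] (mod m)" by (rule euler_theorem)
  moreover have f: "?f > 0" using m by simp
  then have "x ^ ?f = x ^ (?f - 1) * x" by (metis Suc_diff_1 mult.commute power_Suc)
  ultimately have "[x ^ (?f - 1) * x * y = 1 * y] (mod m)" by (metis cong_scalar_right)
  moreover have "x ^ (?f - 1) * (x * y) \<in> H"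
    using partial_character_pow(1)[OF pc xH] yH pc by (auto simp: partial_character_def)
  ultimately show "y \<in> H" using partial_character_cong(1)[OF pc] by (metis mult.assoc mult_1)
qed

text \<open>The one-step extension of characters of a finite abelian group: \<open>H\<close> and \<open>g\<close> generate the elements
\<open>h g\<^sup>j\<close>, and a value \<open>z\<close> for \<open>g\<close> is consistent as soon as it is correct for the first power of
\<open>g\<close> that lies in \<open>H\<close>.\<close>

lemma partial_character_extend:
  assumes pc: "partial_character m H \<psi>" and g: "coprime g m" and m: "m > 0"
    and k: "k > 0" "g ^ k \<in> H" "\<And>j. 0 < j \<Longrightarrow> j < k \<Longrightarrow> g ^ j \<notin> H"
    and z: "z ^ k = \<psi> (g ^ k)"
  shows "\<exists>H' \<psi>'. partial_character m H' \<psi>' \<and> H \<subseteq> H' \<and> g \<in> H' \<and> \<psi>' g = z \<and>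
    (\<forall>x\<in>H. \<psi>' x = \<psi> x)"
proof -
  define R where "R x h j \<longleftrightarrow> h \<in> H \<and> [x = h * g ^ j] (mod m)" for x h j
  define H' where "H' = {x. \<exists>h j. R x h j}"
  have divk: "k dvd j" if "g ^ j \<in> H" for j
  proof -
    have "g ^ j = (g ^ k) ^ (j div k) * g ^ (j mod k)"
      by (simp flip: power_mult power_add)
    moreover have "(g ^ k) ^ (j div k) \<in> H" by (rule partial_character_pow(1)[OF pc k(2)])
    ultimately have "g ^ (j mod k) \<in> H"
      using partial_character_quotient[OF pc _ _ _ m] that g by (metis coprime_power_left_iff)
    then show ?thesis using k by (metis dvd_eq_mod_eq_0 gr0I mod_less_divisor)
  qed
  have half: "\<psi> h * z ^ j = \<psi> h' * z ^ i" if "R x h j" "R x h' i" "i \<le> j" for x h h' i j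
  proof -
    have H: "h \<in> H" "h' \<in> H" using that by (auto simp: R_def)
    have "[h * g ^ j = h' * g ^ i] (mod m)" using that unfolding R_def by (metis cong_sym cong_trans)
    moreover have "g ^ j = g ^ (j - i) * g ^ i" using \<open>i \<le> j\<close> by (simp flip: power_add)
    ultimately have "[(h * g ^ (j - i)) * g ^ i = h' * g ^ i] (mod m)" by (simp add: mult.assoc)
    then have c: "[h * g ^ (j - i) = h'] (mod m)"
      using g cong_mult_rcancel_nat by (metis coprime_power_left_iff)
    have 1: "h * g ^ (j - i) \<in> H" using partial_character_cong(1)[OF pc H(2) cong_sym[OF c]] .
    have 2: "g ^ (j - i) \<in> H"
      using partial_character_quotient[OF pc H(1) 1 _ m] g by (metis coprime_power_left_iff)
    then obtain q where q: "j - i = k * q" using divk by (meson dvdE)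
    have "\<psi> h' = \<psi> (h * g ^ (j - i))" using partial_character_cong(2)[OF pc 1 c] by simp
    also have "\<dots> = \<psi> h * \<psi> (g ^ (j - i))" using pc H 2 by (auto simp: partial_character_def)
    also have "\<psi> (g ^ (j - i)) = z ^ (j - i)"
      using partial_character_pow(2)[OF pc k(2)] z q by (simp add: power_mult)
    finally show ?thesis using \<open>i \<le> j\<close> by (simp flip: power_add)
  qed
  have wd: "\<psi> h * z ^ j = \<psi> h' * z ^ i" if "R x h j" "R x h' i" for x h h' i j
    using half[OF that] half[OF that(2,1)] by (metis nat_le_linear)
  define \<psi>' where "\<psi>' x = (THE w. \<exists>h j. R x h j \<and> w = \<psi> h * z ^ j)" for x
  have \<psi>': "\<psi>' x = \<psi> h * z ^ j" if "R x h j" for x h j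
    unfolding \<psi>'_def using that wd by (intro the_equality) blast+
  have Rmult: "R (x * y) (h * h') (j + i)" if "R x h j" "R y h' i" for x y h h' i j
  proof -
    have "[x * y = (h * g ^ j) * (h' * g ^ i)] (mod m)" using that by (auto simp: R_def intro: cong_mult)
    then show ?thesis using that pc by (auto simp: R_def partial_character_def power_add mult_ac)
  qed
  have RH: "R x x 0" if "x \<in> H" for x using that by (simp add: R_def)
  have Rg: "R g 1 1" using pc by (simp add: R_def partial_character_def)
  have one: "1 \<in> H" using pc by (auto simp: partial_character_def)
  have "\<psi>' (x * y) = \<psi>' x * \<psi>' y" if "x \<in> H'" "y \<in> H'" for x y
  proof -
    obtain h j h' i where R: "R x h j" "R y h' i" using \<open>x \<in> H'\<close> \<open>y \<in> H'\<close>
      unfolding H'_def by blast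
    then have "\<psi> (h * h') = \<psi> h * \<psi> h'" using pc by (auto simp: R_def partial_character_def)
    then show ?thesis using R by (simp add: \<psi>'[OF Rmult[OF R]] \<psi>'[OF R(1)] \<psi>'[OF R(2)] power_add)
  qed
  moreover have Rmod: "R (x mod m) = R x" for x
    by (intro ext) (simp add: R_def cong_def)
  then have "x mod m \<in> H' \<longleftrightarrow> x \<in> H'" for x by (simp add: H'_def)
  moreover have "\<psi>' (x mod m) = \<psi>' x" for x by (simp add: \<psi>'_def Rmod)
  moreover have "coprime x m" if "x \<in> H'" for x
  proof -
    obtain h j where R: "R x h j" using \<open>x \<in> H'\<close> by (auto simp: H'_def)
    then have "coprime (h * g ^ j) m" using g pc by (auto simp: R_def partial_character_def)
    then show ?thesis using R cong_imp_coprime cong_sym unfolding R_def by blast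
  qed
  moreover have "x * y \<in> H'" if "x \<in> H'" "y \<in> H'" for x y using that Rmult unfolding H'_def by blast
  moreover have "1 \<in> H'" "\<psi>' 1 = 1" using RH[OF one] \<psi>'[OF RH[OF one]] pc
    by (auto simp: H'_def partial_character_def)
  ultimately have "partial_character m H' \<psi>'" by (simp add: partial_character_def)
  moreover have "H \<subseteq> H'" using RH by (auto simp: H'_def)
  moreover have "g \<in> H'" using Rg by (auto simp: H'_def)
  moreover have "\<psi>' g = z" using \<psi>'[OF Rg] pc by (simp add: partial_character_def)
  moreover have "\<psi>' x = \<psi> x" if "x \<in> H" for x using \<psi>'[OF RH[OF that]] by simp
  ultimately show ?thesis by blast
qed

lemma least_power_in:
  assumes "coprime g m" "m > 0" "partial_character m H \<psi>"
  obtains k where "k > 0" "g ^ k \<in> H" "\<And>j. 0 < j \<Longrightarrow> j < k \<Longrightarrow> g ^ j \<notin> H"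
proof -
  have "[g ^ totient m = 1] (mod m)" using assms(1) by (rule euler_theorem)
  moreover have "1 \<in> H" using assms by (simp add: partial_character_def)
  ultimately have "g ^ totient m \<in> H" using partial_character_cong(1)[OF assms(3)] cong_sym by blast
  moreover have "totient m > 0" using assms by simp
  ultimately have ex: "\<exists>k. 0 < k \<and> g ^ k \<in> H" by blast
  show thesis
    by (rule that[of "LEAST k. 0 < k \<and> g ^ k \<in> H"])
       (use LeastI_ex[OF ex] not_less_Least in blast)+
qed

lemma partial_character_total:
  assumes "partial_character m H \<psi>" "m > 0"
  shows "\<exists>\<psi>'\<in>dirichlet_characters m. \<forall>x\<in>H. \<psi>' x = \<psi> x"
  using assms(1)
proof (induction "card {x. x < m \<and> coprime x m \<and> x \<notin> H}" arbitrary: H \<psi> rule: less_induct)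
  case less
  show ?case
  proof (cases "\<exists>g. coprime g m \<and> g \<notin> H")
    case True
    then obtain g where g: "coprime g m" "g \<notin> H" by blast
    obtain k where k: "k > 0" "g ^ k \<in> H" "\<And>j. 0 < j \<Longrightarrow> j < k \<Longrightarrow> g ^ j \<notin> H"
      using least_power_in[OF g(1) assms(2) less.prems] by blast
    have "\<psi> (g ^ k) \<noteq> 0" by (rule partial_character_nonzero[OF less.prems k(2) assms(2)])
    then have root: "(exp (Ln (\<psi> (g ^ k)) / of_nat k)) ^ k = \<psi> (g ^ k)"
      using k by (simp flip: exp_of_nat_mult)
    obtain H' \<psi>' where H': "partial_character m H' \<psi>'" "H \<subseteq> H'" "g \<in> H'"
      "\<forall>x\<in>H. \<psi>' x = \<psi> x"
      using partial_character_extend[OF less.prems g(1) assms(2) k root] by blast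
    have modH: "x mod m \<in> H \<longleftrightarrow> x \<in> H" "x mod m \<in> H' \<longleftrightarrow> x \<in> H'" for x
      using less.prems H'(1) by (auto simp: partial_character_def)
    have "g mod m \<in> {x. x < m \<and> coprime x m \<and> x \<notin> H}" "g mod m \<notin> {x. x < m \<and> coprime x m \<and> x \<notin> H'}"
      using modH g H'(3) assms(2) by auto
    then have "{x. x < m \<and> coprime x m \<and> x \<notin> H'} \<subset> {x. x < m \<and> coprime x m \<and> x \<notin> H}"
      using H'(2) by blast
    then have "card {x. x < m \<and> coprime x m \<and> x \<notin> H'} < card {x. x < m \<and> coprime x m \<and> x \<notin> H}"
      by (intro psubset_card_mono) auto
    from less.hyps[OF this H'(1)] show ?thesis using H'(2,4) by (metis subsetD)
  next
    case False
    define \<psi>' where "\<psi>' x = (if coprime x m then \<psi> x else 0)" for x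
    have H: "H = {x. coprime x m}" using False less.prems by (auto simp: partial_character_def)
    have "\<psi>' \<in> dirichlet_characters m"
      unfolding dirichlet_characters_def mem_Collect_eq
    proof (intro conjI allI)
      fix x y
      show "\<psi>' 1 = 1" using less.prems by (simp add: \<psi>'_def partial_character_def)
      show "\<psi>' (x * y) = \<psi>' x * \<psi>' y"
        using less.prems H by (simp add: \<psi>'_def partial_character_def)
      show "\<psi>' (x mod m) = \<psi>' x"
        using less.prems H by (simp add: \<psi>'_def partial_character_def)
      show "\<psi>' x = 0 \<longleftrightarrow> \<not> coprime x m"
        using partial_character_nonzero[OF less.prems _ assms(2)] H by (simp add: \<psi>'_def)
    qed
    then show ?thesis by (rule rev_bexI) (auto simp: \<psi>'_def H)
  qed
qed

text \<open>On the group generated by \<open>u\<close> a primitive root of unity is an admissible value at \<open>u\<close>; the character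
obtained in this way extends to all units.\<close>

lemma dirichlet_characters_separate:
  assumes u: "coprime u m" and ne: "\<not> [u = 1] (mod m)" and m: "m > 0"
  shows "\<exists>\<psi>\<in>dirichlet_characters m. \<psi> u \<noteq> 1"
proof -
  define H where "H = {x. [x = 1] (mod m)}"
  have cop: "coprime x m" if "[x = 1] (mod m)" for x
    using that cong_imp_coprime cong_sym coprime_1_left by blast
  have pc: "partial_character m H (\<lambda>_. 1)"
    unfolding partial_character_def H_def
  proof (intro conjI ballI allI)
    fix x y assume "x \<in> {x. [x = 1] (mod m)}" "y \<in> {x. [x = 1] (mod m)}"
    then show "x * y \<in> {x. [x = 1] (mod m)}" using cong_mult[of x 1 m y 1] by simp
  qed (use cop in \<open>simp_all add: cong_def\<close>)
  obtain k where k: "k > 0" "u ^ k \<in> H" "\<And>j. 0 < j \<Longrightarrow> j < k \<Longrightarrow> u ^ j \<notin> H"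
    using least_power_in[OF u m pc] by blast
  have "k \<noteq> 1" using k(2) ne by (auto simp: H_def)
  with k have k2: "k \<ge> 2" by simp
  define z where "z = cis (2 * pi / k)"
  have "z ^ k = cis (real k * (2 * pi / k))" unfolding z_def by (rule Complex.DeMoivre)
  then have zk: "z ^ k = 1" using k by (simp add: cis_2pi)
  have "z \<noteq> 1"
  proof
    assume "z = 1"
    then have "cos (2 * pi / k) = 1" by (simp add: z_def complex_eq_iff)
    then obtain i :: int where "2 * pi / k = real_of_int i * 2 * pi" using cos_one_2pi_int[of "2 * pi / k"] by metis
    then have "1 = real_of_int i * k" using k by (simp add: field_simps)
    then have "i * int k = 1" by (metis of_int_1 of_int_eq_iff of_int_mult of_int_of_nat_eq)
    then have "int k dvd 1" by (metis dvd_triv_right)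
    then show False using k2 by simp
  qed
  obtain H' \<psi>' where H': "partial_character m H' \<psi>'" "u \<in> H'" "\<psi>' u = z"
    using partial_character_extend[OF pc u m k, of z] zk by auto
  then show ?thesis using partial_character_total[OF H'(1) m] \<open>z \<noteq> 1\<close> by metis
qed


lemma dirichlet_characters_cong:
  assumes "\<psi> \<in> dirichlet_characters m" "[x = y] (mod m)"
  shows "\<psi> x = \<psi> y"
  using assms unfolding dirichlet_characters_def cong_def by (metis (mono_tags, lifting) mem_Collect_eq)

lemma dirichlet_characters_mult:
  "\<psi> \<in> dirichlet_characters m \<Longrightarrow> \<psi> (x * y) = \<psi> x * \<psi> y"
  by (simp add: dirichlet_characters_def)

lemma dirichlet_characters_1:
  "\<psi> \<in> dirichlet_characters m \<Longrightarrow> \<psi> (Suc 0) = 1"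
  by (simp add: dirichlet_characters_def)

lemma dirichlet_characters_eq_0_iff:
  "\<psi> \<in> dirichlet_characters m \<Longrightarrow> \<psi> x = 0 \<longleftrightarrow> \<not> coprime x m"
  by (simp add: dirichlet_characters_def)

lemma dirichlet_characters_power:
  "\<psi> \<in> dirichlet_characters m \<Longrightarrow> \<psi> (x ^ k) = \<psi> x ^ k"
  by (induction k) (simp_all add: dirichlet_characters_mult dirichlet_characters_1)

lemma dirichlet_characters_power_totient:
  assumes "\<psi> \<in> dirichlet_characters m" "coprime x m"
  shows "\<psi> x ^ totient m = 1"
  using dirichlet_characters_cong[OF assms(1) euler_theorem[OF assms(2)]] assms(1)
  by (simp add: dirichlet_characters_power dirichlet_characters_1)

lemma norm_dirichlet_character:
  assumes "\<psi> \<in> dirichlet_characters m" "m > 0"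
  shows "norm (\<psi> x) = (if coprime x m then 1 else 0)"
proof (cases "coprime x m")
  case True
  have "norm (\<psi> x) ^ totient m = 1"
    using dirichlet_characters_power_totient[OF assms(1) True] by (simp flip: norm_power)
  then have "norm (\<psi> x) = 1" using assms(2) power_eq_iff_eq_base[of "totient m" "norm (\<psi> x)" 1] by simp
  then show ?thesis using True by simp
qed (use assms dirichlet_characters_eq_0_iff in auto)

lemma norm_dirichlet_character_le:
  "\<psi> \<in> dirichlet_characters m \<Longrightarrow> m > 0 \<Longrightarrow> norm (\<psi> x) \<le> 1"
  by (simp add: norm_dirichlet_character)

lemma finite_dirichlet_characters:
  assumes m: "m > 0"
  shows "finite (dirichlet_characters m)"
proof -
  let ?V = "insert 0 {z :: complex. z ^ totient m = 1}"
  have fin: "finite ?V" using m by (simp add: finite_roots_unity Suc_leI)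
  have "inj_on (\<lambda>\<psi>. restrict \<psi> {..<m}) (dirichlet_characters m)"
  proof (rule inj_onI)
    fix \<psi> \<phi> assume *: "\<psi> \<in> dirichlet_characters m" "\<phi> \<in> dirichlet_characters m"
      "restrict \<psi> {..<m} = restrict \<phi> {..<m}"
    have "\<psi> x = \<phi> x" for x
    proof -
      have "x mod m \<in> {..<m}" using m by simp
      then have "\<psi> (x mod m) = \<phi> (x mod m)" using fun_cong[OF *(3), of "x mod m"] by simp
      then show ?thesis using *(1,2) by (simp add: dirichlet_characters_def)
    qed
    then show "\<psi> = \<phi>" by blast
  qed
  moreover have "(\<lambda>\<psi>. restrict \<psi> {..<m}) ` dirichlet_characters m \<subseteq> {..<m} \<rightarrow>\<^sub>E ?V"
  proof (rule image_subsetI)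
    fix \<psi> assume "\<psi> \<in> dirichlet_characters m"
    then have "\<psi> x \<in> ?V" for x
      using dirichlet_characters_power_totient dirichlet_characters_eq_0_iff by blast
    then show "restrict \<psi> {..<m} \<in> {..<m} \<rightarrow>\<^sub>E ?V" by simp
  qed
  moreover have "finite ({..<m} \<rightarrow>\<^sub>E ?V)" by (rule finite_PiE) (use fin in auto)
  ultimately have "inj_on (\<lambda>\<psi>. restrict \<psi> {..<m}) (dirichlet_characters m)"
    "finite ((\<lambda>\<psi>. restrict \<psi> {..<m}) ` dirichlet_characters m)"
    by (blast, meson finite_subset)
  then show ?thesis by (simp add: finite_image_iff)
qed

definition principal_character :: "nat \<Rightarrow> nat \<Rightarrow> complex" where
  "principal_character m x = (if coprime x m then 1 else 0)"

lemma principal_character_in [simp]: "principal_character m \<in> dirichlet_characters m"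
proof -
  have "coprime (x mod m) m \<longleftrightarrow> coprime x m" for x
    by (metis coprime_iff_gcd_eq_1 gcd.commute gcd_red_nat)
  then show ?thesis by (auto simp: dirichlet_characters_def principal_character_def)
qed

text \<open>Multiplication by a character that is not \<open>1\<close> at \<open>u\<close> permutes the characters and multiplies the sum
by a number different from \<open>1\<close>.\<close>

lemma sum_dirichlet_characters:
  assumes m: "m > 0" and u: "coprime u m"
  shows "(\<Sum>\<psi>\<in>dirichlet_characters m. \<psi> u) =
    (if [u = 1] (mod m) then of_nat (card (dirichlet_characters m)) else 0)"
proof (cases "[u = 1] (mod m)")
  case True
  then have "\<psi> u = 1" if "\<psi> \<in> dirichlet_characters m" for \<psi>
    using dirichlet_characters_cong[OF that True] that by (simp add: dirichlet_characters_1)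
  then have "(\<Sum>\<psi>\<in>dirichlet_characters m. \<psi> u) = (\<Sum>\<psi>\<in>dirichlet_characters m. 1)"
    by (intro sum.cong) auto
  then show ?thesis using True by simp
next
  case False
  then obtain \<phi> where \<phi>: "\<phi> \<in> dirichlet_characters m" "\<phi> u \<noteq> 1"
    using dirichlet_characters_separate[OF u _ m] by blast
  let ?T = "\<lambda>\<psi> x. \<phi> x * \<psi> x"
  have "inj_on ?T (dirichlet_characters m)"
  proof (rule inj_onI, rule ext)
    fix \<psi> \<psi>' x assume *: "\<psi> \<in> dirichlet_characters m" "\<psi>' \<in> dirichlet_characters m"
      "?T \<psi> = ?T \<psi>'"
    then have "\<phi> x * \<psi> x = \<phi> x * \<psi>' x" by metis
    then show "\<psi> x = \<psi>' x"
      using dirichlet_characters_eq_0_iff *(1,2) \<phi>(1) by (metis mult_left_cancel)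
  qed
  moreover have "?T ` dirichlet_characters m \<subseteq> dirichlet_characters m"
    using \<phi>(1) by (auto simp: dirichlet_characters_def)
  ultimately have img: "?T ` dirichlet_characters m = dirichlet_characters m" and
    inj: "inj_on ?T (dirichlet_characters m)"
    using endo_inj_surj[OF finite_dirichlet_characters[OF m]] by blast+
  have "(\<Sum>\<psi>\<in>dirichlet_characters m. \<psi> u) = (\<Sum>\<psi>\<in>?T ` dirichlet_characters m. \<psi> u)"
    by (simp only: img)
  also have "\<dots> = \<phi> u * (\<Sum>\<psi>\<in>dirichlet_characters m. \<psi> u)"
    by (simp add: sum.reindex[OF inj] sum_distrib_left)
  finally show ?thesis using \<phi>(2) False by simp
qed

lemma sum_dirichlet_characters_eq_0:
  assumes \<psi>: "\<psi> \<in> dirichlet_characters m" "\<psi> \<noteq> principal_character m" and m: "m > 0"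
  shows "(\<Sum>n<m. \<psi> n) = 0"
proof -
  obtain u where u: "coprime u m" "\<psi> u \<noteq> 1"
  proof (rule ccontr)
    assume "\<not> thesis"
    then have "\<psi> x = principal_character m x" for x
      using that \<psi>(1) by (cases "coprime x m") (auto simp: principal_character_def dirichlet_characters_eq_0_iff)
    then show False using \<psi>(2) by blast
  qed
  let ?T = "\<lambda>n. u * n mod m"
  have "inj_on ?T {..<m}"
  proof (rule inj_onI)
    fix x y assume "x \<in> {..<m}" "y \<in> {..<m}" "?T x = ?T y"
    then show "x = y" using u(1) cong_mult_lcancel_nat[of u m x y] by (simp add: cong_def)
  qed
  moreover have "?T ` {..<m} \<subseteq> {..<m}" using m by auto
  ultimately have img: "?T ` {..<m} = {..<m}" and inj: "inj_on ?T {..<m}"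
    using endo_inj_surj[of "{..<m}"] by blast+
  have "(\<Sum>n<m. \<psi> n) = (\<Sum>n\<in>?T ` {..<m}. \<psi> n)" by (simp only: img)
  also have "\<dots> = (\<Sum>n<m. \<psi> (u * n))"
    unfolding sum.reindex[OF inj] o_def
    by (intro sum.cong refl dirichlet_characters_cong[OF \<psi>(1)]) (simp add: cong_def)
  also have "\<dots> = \<psi> u * (\<Sum>n<m. \<psi> n)" using dirichlet_characters_mult[OF \<psi>(1)] by (simp add: sum_distrib_left)
  finally show ?thesis using u(2) by simp
qed

lemma norm_sum_dirichlet_character_le:
  assumes \<psi>: "\<psi> \<in> dirichlet_characters m" "\<psi> \<noteq> principal_character m" and m: "m > 0"
  shows "norm (\<Sum>n<N. \<psi> n) \<le> m"
proof -
  have shift: "(\<Sum>n<m * k + r. \<psi> n) = (\<Sum>n<m * k. \<psi> n) + (\<Sum>n<r. \<psi> n)" for k r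
  proof (induction r)
    case (Suc r)
    have "\<psi> (m * k + r) = \<psi> r"
      by (rule dirichlet_characters_cong[OF \<psi>(1)]) (simp add: cong_def)
    then show ?case using Suc by (simp add: algebra_simps)
  qed simp
  have "(\<Sum>n<m * k. \<psi> n) = 0" for k
  proof (induction k)
    case (Suc k)
    then show ?case using shift[of k m] sum_dirichlet_characters_eq_0[OF assms] by (simp add: algebra_simps)
  qed simp
  then have "(\<Sum>n<N. \<psi> n) = (\<Sum>n<N mod m. \<psi> n)"
    using shift[of "N div m" "N mod m"] by simp
  also have "norm \<dots> \<le> (\<Sum>n<N mod m. norm (\<psi> n))" by (rule norm_sum)
  also have "\<dots> \<le> (\<Sum>n<N mod m. 1)"
    by (intro sum_mono norm_dirichlet_character_le[OF \<psi>(1) m])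
  also have "\<dots> \<le> m" using m by (simp add: less_imp_le)
  finally show ?thesis .
qed

section \<open>Euler products and Abel summation\<close>

text \<open>Multiplying the sum by \<open>1 - f p\<close> removes the multiples of the prime \<open>p\<close>, which is the sieve behind
the Euler product.\<close>

lemma euler_sieve:
  fixes f :: "nat \<Rightarrow> complex"
  assumes mult: "\<And>x y. f (x * y) = f x * f y" and sum: "(\<lambda>n. norm (f n)) summable_on UNIV"
    and P: "finite P" "\<And>p. p \<in> P \<Longrightarrow> prime p"
  shows "(\<Prod>p\<in>P. 1 - f p) * infsum f {n. n > 0} = infsum f {n. n > 0 \<and> (\<forall>p\<in>P. \<not> p dvd n)}"
  using P
proof (induction P rule: finite_induct)
  case (insert q P)
  let ?A = "{n. n > 0 \<and> (\<forall>p\<in>P. \<not> p dvd n)}"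
  let ?B = "{n. n > 0 \<and> (\<forall>p\<in>insert q P. \<not> p dvd n)}"
  have q: "prime q" using insert.prems by simp
  have eq: "?A - ?B = (\<lambda>n. q * n) ` ?A"
  proof (intro Set.set_eqI iffI)
    fix n assume n: "n \<in> ?A - ?B"
    then have "q dvd n" by auto
    then obtain k where k: "n = q * k" ..
    then have "k \<in> ?A" using n by auto
    then show "n \<in> (\<lambda>n. q * n) ` ?A" using k by blast
  next
    fix n assume "n \<in> (\<lambda>n. q * n) ` ?A"
    then obtain k where k: "n = q * k" "k \<in> ?A" by blast
    have "\<not> p dvd n" if "p \<in> P" for p
    proof
      assume "p dvd n"
      moreover have p: "prime p" using insert.prems that by simp
      ultimately have "p dvd q" using k that by (auto simp: prime_dvd_mult_iff)
      then have "p = q" using p q by (simp add: primes_dvd_imp_eq)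
      then show False using that insert.hyps by simp
    qed
    then show "n \<in> ?A - ?B" using k q by (auto simp: prime_gt_0_nat)
  qed
  have sm: "f summable_on X" for X
    using summable_on_subset_banach[OF abs_summable_summable[OF sum]] by blast
  have inj: "inj_on (\<lambda>n. q * n) ?A" using q by (auto simp: inj_on_def)
  have "infsum f ?A - infsum f ?B = infsum f (?A - ?B)"
    by (rule infsum_Diff[symmetric]) (use sm in auto)
  also have "\<dots> = infsum (\<lambda>n. f q * f n) ?A"
    unfolding eq infsum_reindex[OF inj] o_def mult ..
  also have "\<dots> = f q * infsum f ?A" by (rule infsum_cmult_right')
  finally have "infsum f ?B = (1 - f q) * infsum f ?A" by (simp add: algebra_simps)
  then show ?case using insert by (simp add: mult.assoc)
qed simp

lemma euler_product:
  fixes f :: "nat \<Rightarrow> complex"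
  assumes mult: "\<And>x y. f (x * y) = f x * f y" and sum: "summable (\<lambda>n. norm (f n))"
    and f0: "f 0 = 0" and f1: "f 1 = 1"
  shows "(\<lambda>N. (\<Prod>p | p < N \<and> prime p. 1 - f p) * suminf f) \<longlonglongrightarrow> 1"
proof -
  have as: "(\<lambda>n. norm (f n)) summable_on UNIV" using sum by (rule norm_summable_imp_summable_on[of "\<lambda>n. norm (f n)", simplified])
  have sm: "f summable_on X" for X
    using summable_on_subset_banach[OF abs_summable_summable[OF as]] by blast
  have "infsum f UNIV = suminf f"
    by (rule infsumI, rule norm_summable_imp_has_sum) (use sum summable_norm_cancel summable_sums in blast)+
  moreover have "infsum f UNIV = infsum f {n. n > 0}"
    by (rule infsum_cong_neutral) (use f0 in auto)
  ultimately have S: "suminf f = infsum f {n. n > 0}" by simp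
  define T where "T N = (\<Sum>n. norm (f (n + N)))" for N
  have T: "T \<longlonglongrightarrow> 0"
  proof -
    have "(\<lambda>N. (\<Sum>n. norm (f n)) - (\<Sum>n<N. norm (f n))) \<longlonglongrightarrow> (\<Sum>n. norm (f n)) - (\<Sum>n. norm (f n))"
      by (intro tendsto_diff tendsto_const summable_LIMSEQ sum)
    moreover have "T = (\<lambda>N. (\<Sum>n. norm (f n)) - (\<Sum>n<N. norm (f n)))"
    proof
      fix N show "T N = (\<Sum>n. norm (f n)) - (\<Sum>n<N. norm (f n))"
        using suminf_split_initial_segment[OF sum, of N] by (simp add: T_def)
    qed
    ultimately show ?thesis by simp
  qed
  have bound: "norm ((\<Prod>p | p < N \<and> prime p. 1 - f p) * suminf f - 1) \<le> T N" if N: "N \<ge> 2" for N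
  proof -
    let ?A = "{n. n > 0 \<and> (\<forall>p\<in>{p. p < N \<and> prime p}. \<not> p dvd n)}"
    have A: "n = 1 \<or> n \<ge> N" if "n \<in> ?A" for n
    proof (cases "n = 1")
      case False
      then obtain p where p: "prime p" "p dvd n" using prime_factor_nat by blast
      then have "\<not> p < N" using that by auto
      moreover have "p \<le> n" using p that by (auto intro: dvd_imp_le)
      ultimately show ?thesis by simp
    qed simp
    have 1: "1 \<in> ?A" by auto
    have "(\<Prod>p | p < N \<and> prime p. 1 - f p) * suminf f - 1 = infsum f ?A - infsum f {1}"
    proof -
      have "(\<Prod>p | p < N \<and> prime p. 1 - f p) * infsum f {n. n > 0} = infsum f ?A"
        by (rule euler_sieve[OF mult as]) auto
      moreover have "infsum f {1} = 1" using f1 by simp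
      ultimately show ?thesis by (simp only: S)
    qed
    also have "\<dots> = infsum f (?A - {1})"
      by (rule infsum_Diff[symmetric]) (use sm 1 in auto)
    also have "norm \<dots> \<le> infsum (\<lambda>n. norm (f n)) (?A - {1})"
      by (rule norm_infsum_bound) (use as summable_on_subset_banach in blast)
    also have "\<dots> \<le> infsum (\<lambda>n. norm (f n)) {N..}"
    proof (rule infsum_mono_neutral)
      have "?A - {1} \<subseteq> {N..}" using A by auto
      then show "\<And>n. n \<in> ?A - {1} - {N..} \<Longrightarrow> norm (f n) \<le> 0" by blast
      show "(\<lambda>n. norm (f n)) summable_on ?A - {1}" "(\<lambda>n. norm (f n)) summable_on {N..}"
        using as summable_on_subset_banach by blast+
    qed auto
    also have "{N..} = (\<lambda>n. n + N) ` UNIV"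
      by (auto simp: image_def) (metis le_add_diff_inverse2)
    also have "infsum (\<lambda>n. norm (f n)) \<dots> = infsum (\<lambda>n. norm (f (n + N))) UNIV"
      by (subst infsum_reindex) (auto simp: o_def)
    also have "\<dots> = T N" unfolding T_def
    proof (rule infsumI, rule norm_summable_imp_has_sum)
      show "summable (\<lambda>n. norm (norm (f (n + N))))" using summable_ignore_initial_segment[OF sum, of N] by simp
      show "(\<lambda>n. norm (f (n + N))) sums (\<Sum>n. norm (f (n + N)))"
        using summable_ignore_initial_segment[OF sum, of N] by (rule summable_sums)
    qed
    finally show ?thesis .
  qed
  have "(\<lambda>N. (\<Prod>p | p < N \<and> prime p. 1 - f p) * suminf f - 1) \<longlonglongrightarrow> 0"
    by (rule Lim_null_comparison[OF _ T]) (use bound in \<open>auto simp: eventually_sequentially\<close>)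
  then show ?thesis by (simp add: LIM_zero_iff)
qed

lemma abel_sum:
  fixes c :: "nat \<Rightarrow> complex" and b :: "nat \<Rightarrow> real"
  assumes M: "\<And>N. norm (\<Sum>n<N. c n) \<le> M" and b: "b \<longlonglongrightarrow> 0"
    and V: "summable (\<lambda>n. \<bar>b n - b (Suc n)\<bar>)"
  shows "summable (\<lambda>n. c n * of_real (b n))"
    and "norm (\<Sum>n. c n * of_real (b n)) \<le> M * (\<Sum>n. \<bar>b n - b (Suc n)\<bar>)"
proof -
  define S where "S N = (\<Sum>n<N. c n)" for N
  let ?g = "\<lambda>n. S (Suc n) * of_real (b n - b (Suc n))"
  have part: "(\<Sum>n<N. c n * of_real (b n)) = (\<Sum>n<N. ?g n) + S N * of_real (b N)" for N
    by (induction N) (simp_all add: S_def algebra_simps)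
  have le: "norm (?g n) \<le> M * \<bar>b n - b (Suc n)\<bar>" for n
    unfolding norm_mult norm_of_real S_def by (intro mult_right_mono M) simp
  have sMV: "summable (\<lambda>n. M * \<bar>b n - b (Suc n)\<bar>)" using V by (rule summable_mult)
  have sng: "summable (\<lambda>n. norm (?g n))"
    by (rule summable_comparison_test'[OF sMV, of 0]) (use le in simp)
  then have sg: "summable ?g" by (rule summable_norm_cancel)
  have "(\<lambda>N. S N * of_real (b N)) \<longlonglongrightarrow> 0"
  proof (rule Lim_null_comparison)
    show "\<forall>\<^sub>F N in sequentially. norm (S N * of_real (b N)) \<le> M * \<bar>b N\<bar>"
      unfolding norm_mult norm_of_real S_def by (intro always_eventually allI mult_right_mono M) simp
    show "(\<lambda>N. M * \<bar>b N\<bar>) \<longlonglongrightarrow> 0" using b by (simp add: tendsto_mult_right_zero tendsto_rabs_zero)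
  qed
  then have "(\<lambda>N. \<Sum>n<N. c n * of_real (b n)) \<longlonglongrightarrow> suminf ?g + 0"
    unfolding part by (intro tendsto_add summable_LIMSEQ sg)
  then have sums: "(\<lambda>n. c n * of_real (b n)) sums suminf ?g" by (simp add: sums_def)
  then show "summable (\<lambda>n. c n * of_real (b n))" by (rule sums_summable)
  have "norm (suminf ?g) \<le> (\<Sum>n. norm (?g n))" by (rule summable_norm[OF sng])
  also have "\<dots> \<le> (\<Sum>n. M * \<bar>b n - b (Suc n)\<bar>)" by (rule suminf_le[OF le sng sMV])
  also have "\<dots> = M * (\<Sum>n. \<bar>b n - b (Suc n)\<bar>)" by (rule suminf_mult[OF V])
  finally show "norm (\<Sum>n. c n * of_real (b n)) \<le> M * (\<Sum>n. \<bar>b n - b (Suc n)\<bar>)"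
    using sums_unique[OF sums] by simp
qed

lemma nonprincipal_character_0:
  assumes "\<psi> \<in> dirichlet_characters m" "\<psi> \<noteq> principal_character m"
  shows "\<psi> 0 = 0"
proof (rule ccontr)
  assume "\<psi> 0 \<noteq> 0"
  then have m: "m = 1" using assms(1) by (simp add: dirichlet_characters_eq_0_iff)
  have "\<psi> x = 1" for x
    using dirichlet_characters_cong[OF assms(1), of x 1] assms(1) m
    by (simp add: dirichlet_characters_1 cong_def)
  then show False using assms(2) m by (auto simp: principal_character_def)
qed

lemma nonprincipal_abel_sum:
  fixes b :: "nat \<Rightarrow> real"
  assumes \<psi>: "\<psi> \<in> dirichlet_characters m" "\<psi> \<noteq> principal_character m" "m > 0"
    and b: "b \<longlonglongrightarrow> 0" and V: "summable (\<lambda>n. \<bar>b (Suc n) - b (Suc (Suc n))\<bar>)"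
  shows "summable (\<lambda>n. \<psi> n * of_real (b n))"
    and "norm (\<Sum>n. \<psi> n * of_real (b n)) \<le> m * (\<Sum>n. \<bar>b (Suc n) - b (Suc (Suc n))\<bar>)"
proof -
  have 0: "\<psi> 0 = 0" by (rule nonprincipal_character_0[OF \<psi>(1,2)])
  have M: "norm (\<Sum>n<N. \<psi> (Suc n)) \<le> m" for N
    using norm_sum_dirichlet_character_le[OF \<psi>, of "Suc N"] 0 by (simp only: sum.lessThan_Suc_shift) simp
  note A = abel_sum[of "\<lambda>n. \<psi> (Suc n)" m "\<lambda>n. b (Suc n)", OF M LIMSEQ_Suc[OF b] V]
  show s: "summable (\<lambda>n. \<psi> n * of_real (b n))"
    using A(1) summable_Suc_iff[of "\<lambda>n. \<psi> n * of_real (b n)"] by simp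
  show "norm (\<Sum>n. \<psi> n * of_real (b n)) \<le> m * (\<Sum>n. \<bar>b (Suc n) - b (Suc (Suc n))\<bar>)"
    using A(2) suminf_split_head[OF s] 0 by simp
qed

lemma nonprincipal_decreasing_sum:
  fixes b :: "nat \<Rightarrow> real"
  assumes \<psi>: "\<psi> \<in> dirichlet_characters m" "\<psi> \<noteq> principal_character m" "m > 0"
    and b: "b \<longlonglongrightarrow> 0" and dec: "\<And>n. n \<ge> 1 \<Longrightarrow> b (Suc n) \<le> b n"
  shows "summable (\<lambda>n. \<psi> n * of_real (b n))"
    and "norm (\<Sum>n. \<psi> n * of_real (b n)) \<le> m * b 1"
proof -
  have "(\<lambda>n. b (Suc n) - b (Suc (Suc n))) sums (b (Suc 0) - 0)"
    by (rule telescope_sums') (rule LIMSEQ_Suc[OF b])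
  then have s: "(\<lambda>n. \<bar>b (Suc n) - b (Suc (Suc n))\<bar>) sums b 1"
    using dec by (simp add: abs_of_nonneg)
  note A = nonprincipal_abel_sum[OF \<psi> b sums_summable[OF s]]
  show "summable (\<lambda>n. \<psi> n * of_real (b n))" by (rule A(1))
  show "norm (\<Sum>n. \<psi> n * of_real (b n)) \<le> m * b 1" using A(2) sums_unique[OF s] by simp
qed


text \<open>The terms of the Dirichlet series for a real exponent. The term at \<open>0\<close> is \<open>0\<close>, because \<open>0 powr x = 0\<close>,
so series may be indexed by all natural numbers.\<close>

definition dterm :: "(nat \<Rightarrow> complex) \<Rightarrow> real \<Rightarrow> nat \<Rightarrow> complex" where
  "dterm \<psi> s n = \<psi> n * of_real (real n powr - s)"

definition Lfun :: "(nat \<Rightarrow> complex) \<Rightarrow> real \<Rightarrow> complex" where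
  "Lfun \<psi> s = (\<Sum>n. dterm \<psi> s n)"

definition primesum :: "(nat \<Rightarrow> complex) \<Rightarrow> real \<Rightarrow> complex" where
  "primesum \<psi> s = (\<Sum>p. if prime p then dterm \<psi> s p else 0)"

text \<open>A particular logarithm of the \<open>L\<close>-function (see \<open>exp_logL\<close>), namely the sum of the principal logarithms of its
Euler factors. Its imaginary part is not confined to an interval of length \<open>2 \<pi>\<close>.\<close>

definition logL :: "(nat \<Rightarrow> complex) \<Rightarrow> real \<Rightarrow> complex" where
  "logL \<psi> s = (\<Sum>p. if prime p then - Ln (1 - dterm \<psi> s p) else 0)"

context
  fixes m :: nat and \<psi> :: "nat \<Rightarrow> complex"
  assumes m: "m > 0" and \<psi>: "\<psi> \<in> dirichlet_characters m"
begin

lemma norm_dterm_le: "norm (dterm \<psi> s n) \<le> real n powr - s"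
  using norm_dirichlet_character_le[OF \<psi> m, of n]
  by (simp add: dterm_def norm_mult mult_left_le_one_le)

lemma summable_norm_dterm: "s > 1 \<Longrightarrow> summable (\<lambda>n. norm (dterm \<psi> s n))"
  by (rule summable_comparison_test'[of "\<lambda>n. real n powr - s" 0])
    (use norm_dterm_le in \<open>auto simp: summable_real_powr_iff\<close>)

lemma norm_dterm_prime_le: "s \<ge> 1 \<Longrightarrow> prime p \<Longrightarrow> norm (dterm \<psi> s p) \<le> 1 / 2"
proof -
  assume s: "s \<ge> 1" and "prime p"
  then have p: "p \<ge> 2" using prime_ge_2_nat by blast
  have "real p powr - s \<le> real p powr - 1" using p s by (intro powr_mono) auto
  also have "\<dots> = 1 / p" using p by (simp add: powr_minus_divide)
  also have "\<dots> \<le> 1 / 2" using p by (simp add: field_simps)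
  finally show ?thesis using norm_dterm_le[of s p] by simp
qed

lemma log_term_diff:
  assumes s: "s \<ge> 1" and p: "prime p"
  shows "norm (- Ln (1 - dterm \<psi> s p) - dterm \<psi> s p) \<le> 2 * real p powr - 2"
proof -
  let ?z = "- dterm \<psi> s p"
  have z: "norm ?z \<le> 1 / 2" using norm_dterm_prime_le[OF s p] by simp
  have "norm (- Ln (1 - dterm \<psi> s p) - dterm \<psi> s p) = norm (Ln (1 + ?z) - ?z)"
    by (subst norm_minus_cancel[symmetric]) simp
  also have "\<dots> \<le> (norm ?z)\<^sup>2 / (1 - norm ?z)" by (rule Ln_approx_linear) (use z in simp)
  also have "\<dots> \<le> (norm ?z)\<^sup>2 / (1 / 2)" by (intro divide_left_mono) (use z in auto)
  also have "\<dots> \<le> (real p powr - s)\<^sup>2 / (1 / 2)"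
    using norm_dterm_le[of s p] by (intro divide_right_mono power_mono) auto
  also have "\<dots> = 2 * real p powr - (2 * s)" by (simp add: power2_eq_square flip: powr_add)
  also have "\<dots> \<le> 2 * real p powr - 2"
    using p s prime_ge_2_nat[OF p] by (intro mult_left_mono powr_mono) auto
  finally show ?thesis .
qed

lemma norm_log_term_le:
  assumes s: "s \<ge> 1" and p: "prime p"
  shows "norm (Ln (1 - dterm \<psi> s p)) \<le> 3 * real p powr - s"
proof -
  let ?z = "- dterm \<psi> s p"
  have z: "norm ?z \<le> 1 / 2" using norm_dterm_prime_le[OF s p] by simp
  have "norm (Ln (1 - dterm \<psi> s p)) \<le> norm ?z + norm (Ln (1 + ?z) - ?z)"
    using norm_triangle_sub[of "Ln (1 + ?z)" ?z] by simp
  also have "norm (Ln (1 + ?z) - ?z) \<le> (norm ?z)\<^sup>2 / (1 - norm ?z)" by (rule Ln_approx_linear) (use z in simp)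
  also have "\<dots> \<le> (norm ?z)\<^sup>2 / (1 / 2)" by (intro divide_left_mono) (use z in auto)
  also have "\<dots> \<le> 2 * norm ?z"
    using mult_right_mono[of "norm ?z" 1 "norm ?z"] z by (simp add: power2_eq_square)
  finally show ?thesis using norm_dterm_le[of s p] by simp
qed

lemma summable_primesum: "s > 1 \<Longrightarrow> summable (\<lambda>p. if prime p then dterm \<psi> s p else 0)"
  by (rule summable_comparison_test'[of "\<lambda>n. real n powr - s" 0])
    (use norm_dterm_le in \<open>auto simp: summable_real_powr_iff\<close>)

lemma summable_logL: "s > 1 \<Longrightarrow> summable (\<lambda>p. if prime p then - Ln (1 - dterm \<psi> s p) else 0)"
  by (rule summable_comparison_test'[of "\<lambda>n. 3 * real n powr - s" 0])
    (use norm_log_term_le in \<open>auto simp: summable_real_powr_iff intro!: summable_mult\<close>)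

lemma norm_logL_minus_primesum:
  assumes s: "s > 1"
  shows "norm (logL \<psi> s - primesum \<psi> s) \<le> (\<Sum>n. 2 * real n powr - 2)"
proof -
  let ?f = "\<lambda>p. (if prime p then - Ln (1 - dterm \<psi> s p) else 0) - (if prime p then dterm \<psi> s p else 0)"
  have sm: "summable (\<lambda>n. 2 * real n powr - 2)"
    by (intro summable_mult) (simp add: summable_real_powr_iff)
  have le: "norm (?f p) \<le> 2 * real p powr - 2" for p
    using log_term_diff[of s p] s by simp
  have "logL \<psi> s - primesum \<psi> s = suminf ?f"
    unfolding logL_def primesum_def by (rule suminf_diff[OF summable_logL[OF s] summable_primesum[OF s]])
  also have "norm \<dots> \<le> (\<Sum>n. 2 * real n powr - 2)"
    by (rule norm_suminf_le[OF le sm])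
  finally show ?thesis .
qed

lemma exp_logL:
  assumes s: "s > 1"
  shows "exp (logL \<psi> s) = Lfun \<psi> s"
proof -
  let ?g = "\<lambda>p. if prime p then - Ln (1 - dterm \<psi> s p) else 0"
  have mult: "dterm \<psi> s (x * y) = dterm \<psi> s x * dterm \<psi> s y" for x y
    by (simp add: dterm_def dirichlet_characters_mult[OF \<psi>] powr_mult)
  have E: "(\<lambda>N. (\<Prod>p | p < N \<and> prime p. 1 - dterm \<psi> s p) * Lfun \<psi> s) \<longlonglongrightarrow> 1"
    unfolding Lfun_def
    by (rule euler_product[OF mult summable_norm_dterm[OF s]])
      (simp_all add: dterm_def dirichlet_characters_1[OF \<psi>])
  have prod: "(\<Prod>p | p < N \<and> prime p. 1 - dterm \<psi> s p) = exp (- (\<Sum>p<N. ?g p))" for N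
  proof -
    have "- (\<Sum>p<N. ?g p) = (\<Sum>p | p < N \<and> prime p. Ln (1 - dterm \<psi> s p))"
      by (simp add: sum.If_cases sum_negf Collect_conj_eq lessThan_def)
    also have "exp \<dots> = (\<Prod>p | p < N \<and> prime p. exp (Ln (1 - dterm \<psi> s p)))"
      by (rule exp_sum) simp
    also have "\<dots> = (\<Prod>p | p < N \<and> prime p. 1 - dterm \<psi> s p)"
    proof (rule prod.cong)
      fix p assume "p \<in> {p. p < N \<and> prime p}"
      then have "dterm \<psi> s p \<noteq> 1" using norm_dterm_prime_le[of s p] s by fastforce
      then show "exp (Ln (1 - dterm \<psi> s p)) = 1 - dterm \<psi> s p" by (simp add: exp_Ln)
    qed simp
    finally show ?thesis ..
  qed
  have "(\<lambda>N. exp (- (\<Sum>p<N. ?g p)) * Lfun \<psi> s) \<longlonglongrightarrow> exp (- logL \<psi> s) * Lfun \<psi> s"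
    unfolding logL_def by (intro tendsto_intros summable_LIMSEQ summable_logL s)
  then have "exp (- logL \<psi> s) * Lfun \<psi> s = 1"
    using E LIMSEQ_unique unfolding prod by blast
  then show ?thesis by (simp add: exp_minus field_simps)
qed

lemma continuous_on_logL: "continuous_on {1<..} (logL \<psi>)"
proof -
  have "continuous_on {a<..} (logL \<psi>)" if a: "a > 1" for a
  proof -
    let ?g = "\<lambda>p s. if prime p then - Ln (1 - dterm \<psi> s p) else 0"
    have ul: "uniform_limit {a<..} (\<lambda>N s. \<Sum>p<N. ?g p s) (\<lambda>s. \<Sum>p. ?g p s) sequentially"
    proof (rule Weierstrass_m_test)
      show "summable (\<lambda>p. 3 * real p powr - a)"
        using a by (intro summable_mult) (simp add: summable_real_powr_iff)
      show "norm (?g p s) \<le> 3 * real p powr - a" if "s \<in> {a<..}" for p s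
      proof (cases "prime p")
        case True
        have "norm (?g p s) \<le> 3 * real p powr - s"
          using norm_log_term_le[of s p] True that a by simp
        also have "\<dots> \<le> 3 * real p powr - a"
          using that prime_ge_2_nat[OF True] by (intro mult_left_mono powr_mono) auto
        finally show ?thesis .
      qed simp
    qed
    have cont: "continuous_on {a<..} (?g p)" for p
    proof (cases "prime p")
      case True
      have "1 - dterm \<psi> s p \<notin> \<real>\<^sub>\<le>\<^sub>0" if "s \<in> {a<..}" for s
      proof
        assume "1 - dterm \<psi> s p \<in> \<real>\<^sub>\<le>\<^sub>0"
        then have "Re (1 - dterm \<psi> s p) \<le> 0" by (simp add: complex_nonpos_Reals_iff)
        moreover have "Re (dterm \<psi> s p) \<le> 1 / 2"
          using norm_dterm_prime_le[of s p] True that a complex_Re_le_cmod[of "dterm \<psi> s p"] by simp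
        ultimately show False by simp
      qed
      moreover have "continuous_on {a<..} (\<lambda>s. 1 - dterm \<psi> s p)"
        unfolding dterm_def using prime_gt_0_nat[OF True] by (intro continuous_intros) auto
      ultimately have "continuous_on {a<..} (\<lambda>s. - Ln (1 - dterm \<psi> s p))"
        by (intro continuous_on_minus continuous_on_Ln') auto
      then show ?thesis using True by simp
    qed simp
    show ?thesis unfolding logL_def
      by (rule uniform_limit_theorem[OF _ ul]) (auto intro!: always_eventually continuous_on_sum cont)
  qed
  then have "isCont (logL \<psi>) s" if "s > 1" for s
    using that continuous_on_interior[of "{(1 + s) / 2<..}" "logL \<psi>" s] by (auto simp: interior_open)
  then show ?thesis by (intro continuous_at_imp_continuous_on) auto
qed

end

section \<open>L-functions near 1\<close>

lemma nonprincipal_Lfun_bound: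
  assumes \<psi>: "\<psi> \<in> dirichlet_characters m" "\<psi> \<noteq> principal_character m" "m > 0" and s: "s \<ge> 1"
  shows "summable (dterm \<psi> s)" "norm (Lfun \<psi> s) \<le> m"
proof -
  have lim: "(\<lambda>n. real n powr - s) \<longlonglongrightarrow> 0"
    using s by (intro tendsto_neg_powr filterlim_real_sequentially) auto
  have dec: "real (Suc n) powr - s \<le> real n powr - s" if "n \<ge> 1" for n
    using that s by (intro powr_mono2') auto
  show "summable (dterm \<psi> s)" "norm (Lfun \<psi> s) \<le> m"
    using nonprincipal_decreasing_sum[OF \<psi> lim dec] unfolding Lfun_def dterm_def by simp_all
qed

lemma powr_diff_bound:
  fixes x s :: real
  assumes x: "x \<ge> 1" and s: "s \<ge> 1"
  shows "\<bar>s * x powr (- s - 1) - x powr - 2\<bar> \<le> 2 * (s - 1) * x powr - (3 / 2)"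
proof -
  define e where "e = s - 1"
  have e: "e \<ge> 0" using s by (simp add: e_def)
  have 1: "s * x powr (- s - 1) - x powr - 2 = x powr - 2 * (e * x powr - e + (x powr - e - 1))"
  proof -
    have "x powr (- s - 1) = x powr (- 2 + - e)"
      by (rule arg_cong[where f = "\<lambda>u. x powr u"]) (simp add: e_def)
    also have "\<dots> = x powr - 2 * x powr - e" by (rule powr_add)
    finally show ?thesis by (simp add: e_def algebra_simps)
  qed
  have "x powr - e \<le> x powr 0" using x e by (intro powr_mono) auto
  then have le1: "x powr - e \<le> 1" using x by simp
  have "1 + - e * ln x \<le> exp (- e * ln x)" by (rule exp_ge_add_one_self)
  moreover have "x powr - e = exp (- e * ln x)" using x by (simp add: powr_def)
  ultimately have ge: "1 - x powr - e \<le> e * ln x" by simp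
  have "ln (sqrt x) \<le> sqrt x - 1" using x by (intro ln_le_minus_one) auto
  then have ln: "1 + ln x \<le> 2 * sqrt x" using x by (simp add: ln_sqrt)
  have "\<bar>e * x powr - e + (x powr - e - 1)\<bar> \<le> e * x powr - e + (1 - x powr - e)"
    using le1 mult_nonneg_nonneg[OF e, of "x powr - e"] by (simp add: abs_le_iff)
  also have "\<dots> \<le> e * 1 + e * ln x"
    using le1 e ge by (intro add_mono mult_left_mono) auto
  also have "\<dots> = e * (1 + ln x)" by (simp add: algebra_simps)
  also have "\<dots> \<le> e * (2 * sqrt x)" using ln e by (intro mult_left_mono)
  finally have "x powr - 2 * \<bar>e * x powr - e + (x powr - e - 1)\<bar> \<le> x powr - 2 * (e * (2 * x powr (1 / 2)))"
    using x by (intro mult_left_mono) (auto simp: powr_half_sqrt)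
  also have "\<dots> = 2 * e * (x powr - 2 * x powr (1 / 2))" by simp
  also have "x powr - 2 * x powr (1 / 2) = x powr - (3 / 2)" by (simp flip: powr_add)
  finally show ?thesis unfolding 1 abs_mult by (simp add: e_def)
qed

text \<open>The difference of the two series is an Abel sum whose weights have total variation of order
\<open>s - 1\<close>; the variation is estimated by the mean value theorem.\<close>

lemma nonprincipal_Lfun_Lipschitz:
  assumes \<psi>: "\<psi> \<in> dirichlet_characters m" "\<psi> \<noteq> principal_character m" "m > 0"
  shows "\<exists>C. \<forall>s>1. norm (Lfun \<psi> s - Lfun \<psi> 1) \<le> C * (s - 1)"
proof (intro exI allI impI)
  fix s :: real assume s: "s > 1"
  define b where "b x = x powr - s - x powr - 1" for x :: real
  let ?V = "\<lambda>n. real (Suc n) powr - (3 / 2)"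
  have sV: "summable ?V"
    using summable_Suc_iff[of "\<lambda>n. real n powr - (3 / 2)"] by (simp add: summable_real_powr_iff)
  have lim: "(\<lambda>n. b (real n)) \<longlonglongrightarrow> 0 - 0" unfolding b_def
    using s by (intro tendsto_diff tendsto_neg_powr filterlim_real_sequentially) auto
  have var: "\<bar>b (real (Suc n)) - b (real (Suc (Suc n)))\<bar> \<le> 2 * (s - 1) * ?V n" for n
  proof -
    have "\<exists>z. real (Suc n) < z \<and> z < real (Suc (Suc n)) \<and>
      b (real (Suc (Suc n))) - b (real (Suc n)) =
        (real (Suc (Suc n)) - real (Suc n)) * (- s * z powr (- s - 1) - (- 1 * z powr (- 1 - 1)))"
      unfolding b_def by (rule MVT2, simp, intro DERIV_diff has_real_derivative_powr) simp_all
    then obtain z where z: "real (Suc n) < z" and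
      eq: "b (real (Suc (Suc n))) - b (real (Suc n)) = - (s * z powr (- s - 1) - z powr - 2)"
      by (auto simp: algebra_simps)
    have "\<bar>b (real (Suc n)) - b (real (Suc (Suc n)))\<bar> = \<bar>s * z powr (- s - 1) - z powr - 2\<bar>"
      using eq by linarith
    also have "\<dots> \<le> 2 * (s - 1) * z powr - (3 / 2)" using z s by (intro powr_diff_bound) auto
    also have "\<dots> \<le> 2 * (s - 1) * ?V n"
      using z s by (intro mult_left_mono powr_mono2') auto
    finally show ?thesis .
  qed
  have sV2: "summable (\<lambda>n. 2 * (s - 1) * ?V n)" using sV by (rule summable_mult)
  have sb: "summable (\<lambda>n. \<bar>b (real (Suc n)) - b (real (Suc (Suc n)))\<bar>)"
    by (rule summable_comparison_test'[OF sV2, of 0]) (use var in simp)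
  have "Lfun \<psi> s - Lfun \<psi> 1 = (\<Sum>n. dterm \<psi> s n - dterm \<psi> 1 n)" unfolding Lfun_def
    using s by (intro suminf_diff nonprincipal_Lfun_bound(1)[OF \<psi>]) auto
  also have "\<dots> = (\<Sum>n. \<psi> n * of_real (b (real n)))"
    by (simp add: dterm_def b_def algebra_simps)
  also have "norm \<dots> \<le> m * (\<Sum>n. \<bar>b (real (Suc n)) - b (real (Suc (Suc n)))\<bar>)"
    by (rule nonprincipal_abel_sum(2)[OF \<psi> _ sb]) (use lim in simp)
  also have "\<dots> \<le> m * (\<Sum>n. 2 * (s - 1) * ?V n)"
    by (intro mult_left_mono suminf_le var sb sV2) auto
  also have "\<dots> = m * (2 * (\<Sum>n. ?V n)) * (s - 1)" using suminf_mult[OF sV] by simp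
  finally show "norm (Lfun \<psi> s - Lfun \<psi> 1) \<le> m * (2 * (\<Sum>n. ?V n)) * (s - 1)" .
qed

lemma zeta_bound:
  fixes s :: real
  assumes s: "s > 1"
  shows "(\<Sum>n. real n powr - s) \<le> s / (s - 1)"
proof -
  let ?h = "\<lambda>n. real (Suc n) powr (1 - s)"
  have sm: "summable (\<lambda>n. real n powr - s)" using s by (simp add: summable_real_powr_iff)
  have "(\<lambda>n. real n powr (1 - s)) \<longlonglongrightarrow> 0"
    using s tendsto_neg_powr[OF _ filterlim_real_sequentially, of "1 - s"] by simp
  then have "?h \<longlonglongrightarrow> 0" by (rule LIMSEQ_Suc)
  then have "(\<lambda>n. (?h n - ?h (Suc n)) / (s - 1)) sums ((?h 0 - 0) / (s - 1))"
    by (intro sums_divide telescope_sums')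
  then have T: "(\<lambda>n. (?h n - ?h (Suc n)) / (s - 1)) sums (1 / (s - 1))" by simp
  have le: "real (Suc (Suc n)) powr - s \<le> (?h n - ?h (Suc n)) / (s - 1)" for n
  proof -
    have "\<exists>z. real (Suc n) < z \<and> z < real (Suc (Suc n)) \<and>
      real (Suc (Suc n)) powr (1 - s) - real (Suc n) powr (1 - s) =
        (real (Suc (Suc n)) - real (Suc n)) * ((1 - s) * z powr (1 - s - 1))"
      by (rule MVT2, simp, intro has_real_derivative_powr) simp
    then obtain z where z: "real (Suc n) < z" "z < real (Suc (Suc n))" and
      eq: "?h n - ?h (Suc n) = (s - 1) * z powr - s"
      by (auto simp: algebra_simps)
    have "real (Suc (Suc n)) powr - s \<le> z powr - s" using z s by (intro powr_mono2') auto
    then show ?thesis using eq s by simp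
  qed
  have sm1: "summable (\<lambda>n. real (Suc n) powr - s)" 
    by (rule iffD2[OF summable_Suc_iff[of "\<lambda>n. real n powr - s"] sm])
  have sm2: "summable (\<lambda>n. real (Suc (Suc n)) powr - s)"
    by (rule iffD2[OF summable_Suc_iff[of "\<lambda>n. real (Suc n) powr - s"] sm1])
  have "(\<Sum>n. real n powr - s) = 1 + (\<Sum>n. real (Suc (Suc n)) powr - s)"
    using suminf_split_head[OF sm] suminf_split_head[OF sm1] by simp
  also have "\<dots> \<le> 1 + 1 / (s - 1)"
    using suminf_le[OF le sm2 sums_summable[OF T]] sums_unique[OF T] by simp
  also have "\<dots> = s / (s - 1)" using s by (simp add: field_simps)
  finally show ?thesis .
qed

lemma norm_Lfun_le:
  assumes "\<psi> \<in> dirichlet_characters m" "m > 0" and s: "s > 1"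
  shows "norm (Lfun \<psi> s) \<le> s / (s - 1)"
proof -
  have "norm (Lfun \<psi> s) \<le> (\<Sum>n. real n powr - s)" unfolding Lfun_def
    by (rule norm_suminf_le) (use norm_dterm_le assms in \<open>auto simp: summable_real_powr_iff\<close>)
  then show ?thesis using zeta_bound[OF s] by simp
qed

text \<open>The terms of the residue class of \<open>1\<close> alone already form a divergent series at \<open>s = 1\<close>.\<close>

lemma Lfun_principal_unbounded:
  assumes m: "m > 0"
  shows "\<exists>d>0. \<forall>s. 1 < s \<and> s < 1 + d \<longrightarrow> B \<le> norm (Lfun (principal_character m) s)"
proof -
  let ?a = "\<lambda>j. 1 / real (Suc j)"
  have "\<not> bounded (range (\<lambda>n. \<Sum>j<n. ?a j))"
  proof
    assume "bounded (range (\<lambda>n. \<Sum>j<n. ?a j))"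
    then obtain K where K: "\<And>n. \<bar>\<Sum>j<n. ?a j\<bar> \<le> K" by (auto simp: bounded_iff)
    have "summable ?a" by (rule summableI_nonneg_bounded[of _ K]) (use K in \<open>auto simp: abs_le_iff\<close>)
    then show False using not_summable_harmonic[where 'a=real] summable_Suc_iff[of "\<lambda>n. inverse (real n)"]
      by (simp add: inverse_eq_divide)
  qed
  then obtain J where J: "\<bar>\<Sum>j<J. ?a j\<bar> > m * (\<bar>B\<bar> + 1)" by (force simp: bounded_iff not_le)
  have J2: "(\<Sum>j<J. real (1 + j * m) powr - 1) \<ge> \<bar>B\<bar> + 1"
  proof -
    have "m * (\<bar>B\<bar> + 1) \<le> (\<Sum>j<J. ?a j)" using J by (simp add: sum_nonneg)
    also have "\<dots> \<le> (\<Sum>j<J. m * real (1 + j * m) powr - 1)"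
    proof (rule sum_mono)
      fix j
      have "real (1 + j * m) \<le> m * Suc j" using m by (simp add: algebra_simps flip: of_nat_mult of_nat_add of_nat_Suc)
      then show "?a j \<le> m * real (1 + j * m) powr - 1"
        using m by (simp add: powr_minus_divide field_simps add_pos_nonneg)
    qed
    also have "\<dots> = m * (\<Sum>j<J. real (1 + j * m) powr - 1)" by (simp only: sum_distrib_left)
    finally show ?thesis using m by simp
  qed
  define g where "g s = (\<Sum>j<J. real (1 + j * m) powr - s)" for s
  have "isCont g 1" unfolding g_def by (intro continuous_intros) (auto simp: add_nonneg_eq_0_iff)
  then have "\<forall>e>0. \<exists>d>0. \<forall>s. dist s 1 < d \<longrightarrow> dist (g s) (g 1) < e"
    unfolding continuous_at_eps_delta .
  from this[rule_format, of 1]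
  obtain d where d: "d > 0" "\<And>s. dist s 1 < d \<Longrightarrow> dist (g s) (g 1) < 1" by auto
  have "B \<le> norm (Lfun (principal_character m) s)" if s: "1 < s" "s < 1 + d" for s
  proof -
    let ?u = "\<lambda>n. (if coprime n m then real n powr - s else 0)"
    have su: "summable ?u"
      by (rule summable_comparison_test'[of "\<lambda>n. real n powr - s" 0]) (use s in \<open>auto simp: summable_real_powr_iff\<close>)
    have eq: "dterm (principal_character m) s = (\<lambda>n. of_real (?u n))"
      by (simp add: dterm_def principal_character_def fun_eq_iff)
    have L: "Lfun (principal_character m) s = of_real (suminf ?u)"
      unfolding Lfun_def eq by (rule suminf_of_real[OF su, symmetric])
    have inj: "inj_on (\<lambda>j. 1 + j * m) {..<J}" using m by (auto simp: inj_on_def)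
    have cop: "coprime (1 + j * m) m" for j
      by (metis coprime_1_left coprime_iff_gcd_eq_1 gcd.commute gcd_add_mult add.commute mult.commute)
    have "g s = sum ?u ((\<lambda>j. 1 + j * m) ` {..<J})"
      unfolding g_def sum.reindex[OF inj] o_def using cop by (intro sum.cong) auto
    also have "\<dots> \<le> suminf ?u" by (rule sum_le_suminf[OF su]) auto
    finally have "g s \<le> suminf ?u" .
    moreover have "\<bar>B\<bar> + 1 \<le> g 1" using J2 by (simp add: g_def)
    moreover have "\<bar>g s - g 1\<bar> < 1" using d(2)[of s] s by (simp add: dist_real_def)
    ultimately show ?thesis unfolding L norm_of_real by linarith
  qed
  then show ?thesis using d(1) by blast
qed

lemma sum_character_primesum:
  assumes m: "m > 0" and a: "coprime a m" and s: "s > 1"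
  shows "(\<Sum>\<psi>\<in>dirichlet_characters m. \<psi> a * primesum \<psi> s) =
    of_real (card (dirichlet_characters m) *
      (\<Sum>p. if prime p \<and> [a * p = 1] (mod m) then real p powr - s else 0))"
proof -
  let ?D = "dirichlet_characters m"
  let ?u = "\<lambda>p. if prime p \<and> [a * p = 1] (mod m) then real p powr - s else 0"
  have su: "summable ?u"
    by (rule summable_comparison_test'[of "\<lambda>n. real n powr - s" 0]) (use s in \<open>auto simp: summable_real_powr_iff\<close>)
  have sm: "summable (\<lambda>p. \<psi> a * (if prime p then dterm \<psi> s p else 0))" if "\<psi> \<in> ?D" for \<psi>
    by (intro summable_mult summable_primesum[OF m that s])
  have "(\<Sum>\<psi>\<in>?D. \<psi> a * primesum \<psi> s) = (\<Sum>\<psi>\<in>?D. \<Sum>p. \<psi> a * (if prime p then dterm \<psi> s p else 0))"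
    unfolding primesum_def
    by (intro sum.cong suminf_mult[symmetric] summable_primesum[OF m _ s]) auto
  also have "\<dots> = (\<Sum>p. \<Sum>\<psi>\<in>?D. \<psi> a * (if prime p then dterm \<psi> s p else 0))"
    by (rule suminf_sum[symmetric]) (use sm in auto)
  also have "(\<lambda>p. \<Sum>\<psi>\<in>?D. \<psi> a * (if prime p then dterm \<psi> s p else 0)) =
    (\<lambda>p. of_real (card ?D * ?u p))"
  proof
    fix p
    have "(\<Sum>\<psi>\<in>?D. \<psi> a * \<psi> p) = (if [a * p = 1] (mod m) then of_nat (card ?D) else 0)"
    proof (cases "coprime p m")
      case True
      have "(\<Sum>\<psi>\<in>?D. \<psi> a * \<psi> p) = (\<Sum>\<psi>\<in>?D. \<psi> (a * p))"
        by (intro sum.cong) (auto simp: dirichlet_characters_mult)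
      then show ?thesis using sum_dirichlet_characters[OF m, of "a * p"] True a by simp
    next
      case False
      then have "\<not> [a * p = 1] (mod m)"
        using cong_imp_coprime[OF cong_sym, of "a * p" 1 m] by auto
      moreover have "\<psi> p = 0" if "\<psi> \<in> ?D" for \<psi>
        using that False by (simp add: dirichlet_characters_eq_0_iff)
      then have "(\<Sum>\<psi>\<in>?D. \<psi> a * \<psi> p) = 0" by (intro sum.neutral ballI) auto
      ultimately show ?thesis by simp
    qed
    note that = this
    have "(\<Sum>\<psi>\<in>?D. \<psi> a * dterm \<psi> s p) =
        (if [a * p = 1] (mod m) then of_nat (card ?D) else 0) * of_real (real p powr - s)"
    proof -
      have "(\<Sum>\<psi>\<in>?D. \<psi> a * dterm \<psi> s p) = (\<Sum>\<psi>\<in>?D. \<psi> a * \<psi> p) * of_real (real p powr - s)"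
        unfolding sum_distrib_right by (intro sum.cong refl) (simp add: dterm_def mult.assoc)
      then show ?thesis using that by (simp only:)
    qed
    then show "(\<Sum>\<psi>\<in>?D. \<psi> a * (if prime p then dterm \<psi> s p else 0)) = of_real (card ?D * ?u p)"
      by (cases "prime p") simp_all
  qed
  also have "(\<Sum>p. of_real (card ?D * ?u p)) = complex_of_real (\<Sum>p. card ?D * ?u p)"
    by (rule suminf_of_real[symmetric]) (intro summable_mult su)
  also have "(\<Sum>p. card ?D * ?u p) = card ?D * suminf ?u" by (rule suminf_mult[OF su])
  finally show ?thesis .
qed

text \<open>By orthogonality the sum over all characters is, up to a bounded error, a positive multiple of a sum
over the primes that are \<open>1\<close> modulo \<open>m\<close>.\<close>

lemma sum_Re_logL_bounded_below:
  assumes m: "m > 0"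
  shows "\<exists>C. \<forall>s>1. C \<le> (\<Sum>\<psi>\<in>dirichlet_characters m. Re (logL \<psi> s))"
proof (intro exI allI impI)
  fix s :: real assume s: "s > 1"
  let ?D = "dirichlet_characters m"
  let ?K = "\<Sum>n. 2 * real n powr - 2"
  let ?u = "\<lambda>p. if prime p \<and> [1 * p = 1] (mod m) then real p powr - s else 0"
  have su: "summable ?u"
    by (rule summable_comparison_test'[of "\<lambda>n. real n powr - s" 0]) (use s in \<open>auto simp: summable_real_powr_iff\<close>)
  have "0 \<le> suminf ?u" by (rule suminf_nonneg[OF su]) simp
  then have "0 \<le> Re (of_real (card ?D * suminf ?u))" by simp
  also have "\<dots> = Re (\<Sum>\<psi>\<in>?D. \<psi> 1 * primesum \<psi> s)"
    by (simp only: sum_character_primesum[OF m coprime_1_left s])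
  also have "(\<Sum>\<psi>\<in>?D. \<psi> 1 * primesum \<psi> s) = (\<Sum>\<psi>\<in>?D. primesum \<psi> s)"
    by (intro sum.cong refl) (simp add: dirichlet_characters_1)
  also have "Re \<dots> = (\<Sum>\<psi>\<in>?D. Re (primesum \<psi> s))" by (rule Re_sum)
  finally have 1: "0 \<le> (\<Sum>\<psi>\<in>?D. Re (primesum \<psi> s))" .
  have "Re (primesum \<psi> s) - ?K \<le> Re (logL \<psi> s)" if "\<psi> \<in> ?D" for \<psi>
    using norm_logL_minus_primesum[OF m that s] abs_Re_le_cmod[of "logL \<psi> s - primesum \<psi> s"] by simp
  then have "(\<Sum>\<psi>\<in>?D. Re (primesum \<psi> s) - ?K) \<le> (\<Sum>\<psi>\<in>?D. Re (logL \<psi> s))" by (rule sum_mono)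
  then show "- (card ?D * ?K) \<le> (\<Sum>\<psi>\<in>?D. Re (logL \<psi> s))" using 1 by (simp add: sum_subtractf)
qed

text \<open>As \<open>s\<close> tends to \<open>1\<close>, the principal \<open>L\<close>-function grows at most like \<open>1 / (s - 1)\<close>, while each zero
contributes a factor of order \<open>s - 1\<close>. Two zeros would make the product of all \<open>L\<close>-functions tend to \<open>0\<close>,
against the lower bound for the sum of their logarithms.\<close>

lemma Lfun_at_most_one_zero:
  assumes m: "m > 0" and \<psi>: "\<psi> \<in> dirichlet_characters m" "\<psi> \<noteq> principal_character m"
    and \<phi>: "\<phi> \<in> dirichlet_characters m" "\<phi> \<noteq> principal_character m"
    and z: "Lfun \<psi> 1 = 0" "Lfun \<phi> 1 = 0"
  shows "\<psi> = \<phi>"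
proof (rule ccontr)
  assume ne: "\<psi> \<noteq> \<phi>"
  let ?D = "dirichlet_characters m" and ?p = "principal_character m"
  let ?E = "?D - {?p, \<psi>, \<phi>}"
  have fin: "finite ?D" by (rule finite_dirichlet_characters[OF m])
  obtain C where C: "\<And>s. s > 1 \<Longrightarrow> C \<le> (\<Sum>\<psi>\<in>?D. Re (logL \<psi> s))"
    using sum_Re_logL_bounded_below[OF m] by blast
  obtain K1 where K1: "\<And>s. s > 1 \<Longrightarrow> norm (Lfun \<psi> s) \<le> K1 * (s - 1)"
    using nonprincipal_Lfun_Lipschitz[OF \<psi> m] z by auto
  obtain K2 where K2: "\<And>s. s > 1 \<Longrightarrow> norm (Lfun \<phi> s) \<le> K2 * (s - 1)"
    using nonprincipal_Lfun_Lipschitz[OF \<phi> m] z by auto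
  define A where "A = 2 * \<bar>K1\<bar> * \<bar>K2\<bar> * real m ^ card ?E"
  have main: "exp C \<le> A * (s - 1)" if s: "1 < s" "s < 2" for s
  proof -
    have "exp C \<le> exp (\<Sum>\<psi>\<in>?D. Re (logL \<psi> s))" using C[OF s(1)] by simp
    also have "\<dots> = (\<Prod>\<psi>\<in>?D. norm (Lfun \<psi> s))"
      unfolding exp_sum[OF fin]
      by (intro prod.cong) (auto simp: exp_logL[OF m _ s(1), symmetric])
    also have "\<dots> = norm (Lfun ?p s) * norm (Lfun \<psi> s) * norm (Lfun \<phi> s) * (\<Prod>\<psi>\<in>?E. norm (Lfun \<psi> s))"
    proof -
      have "?D = insert ?p (insert \<psi> (insert \<phi> ?E))" using \<psi> \<phi> by auto
      then have "(\<Prod>\<psi>\<in>?D. norm (Lfun \<psi> s)) = (\<Prod>\<psi>\<in>insert ?p (insert \<psi> (insert \<phi> ?E)). norm (Lfun \<psi> s))"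
        by simp
      also have "\<dots> = norm (Lfun ?p s) * norm (Lfun \<psi> s) * norm (Lfun \<phi> s) * (\<Prod>\<psi>\<in>?E. norm (Lfun \<psi> s))"
        using fin \<psi> \<phi> ne by (simp add: mult.assoc)
      finally show ?thesis .
    qed
    also have "\<dots> \<le> (2 / (s - 1)) * (\<bar>K1\<bar> * (s - 1)) * (\<bar>K2\<bar> * (s - 1)) * real m ^ card ?E"
    proof (intro mult_mono)
      have "norm (Lfun ?p s) \<le> s / (s - 1)" by (rule norm_Lfun_le[OF _ m s(1)]) simp
      also have "\<dots> \<le> 2 / (s - 1)" using s by (intro divide_right_mono) auto
      finally show "norm (Lfun ?p s) \<le> 2 / (s - 1)" .
      show "norm (Lfun \<psi> s) \<le> \<bar>K1\<bar> * (s - 1)"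
        using K1[OF s(1)] s mult_right_mono[of K1 "\<bar>K1\<bar>" "s - 1"] by linarith
      show "norm (Lfun \<phi> s) \<le> \<bar>K2\<bar> * (s - 1)"
        using K2[OF s(1)] s mult_right_mono[of K2 "\<bar>K2\<bar>" "s - 1"] by linarith
      have "(\<Prod>\<psi>\<in>?E. norm (Lfun \<psi> s)) \<le> (\<Prod>\<psi>\<in>?E. real m)"
        by (intro prod_mono) (use nonprincipal_Lfun_bound(2)[of _ m s] m s in auto)
      then show "(\<Prod>\<psi>\<in>?E. norm (Lfun \<psi> s)) \<le> real m ^ card ?E" by simp
    qed (use s in \<open>auto intro!: prod_nonneg\<close>)
    also have "\<dots> = A * (s - 1)" using s by (simp add: A_def field_simps)
    finally show ?thesis .
  qed
  define t where "t = min (1 / 2) (exp C / (2 * (A + 1)))"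
  have A: "A \<ge> 0" by (simp add: A_def)
  have t: "t > 0" "t < 1" using A by (auto simp: t_def)
  have "exp C \<le> A * t" using main[of "1 + t"] t by simp
  also have "\<dots> \<le> (A + 1) * (exp C / (2 * (A + 1)))" using A t by (intro mult_mono) (auto simp: t_def)
  also have "\<dots> = exp C / 2" using A by (simp add: field_simps)
  finally show False by simp
qed

section \<open>Primes in arithmetic progressions\<close>

lemma divisors_prime_power_mult:
  fixes p n :: nat
  assumes p: "prime p" and n: "\<not> p dvd n"
  shows "bij_betw (\<lambda>(i, d). p ^ i * d) ({..e} \<times> {d. d dvd n}) {d. d dvd p ^ e * n}"
  unfolding bij_betw_def
proof
  have nd: "\<not> p dvd d" if "d dvd n" for d using that n by auto
  have mult: "multiplicity p (p ^ i * d) = i" if "d dvd n" for i d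
  proof -
    have "d \<noteq> 0" using nd[OF that] by (metis dvd_0_right)
    then show ?thesis
      using nd[OF that] p by (simp add: multiplicity_times_same not_dvd_imp_multiplicity_0 prime_elem_multiplicity_mult_distrib)
  qed
  show "inj_on (\<lambda>(i, d). p ^ i * d) ({..e} \<times> {d. d dvd n})"
  proof (rule inj_onI, clarify)
    fix i d i' d' assume *: "d dvd n" "d' dvd n" "p ^ i * d = p ^ i' * d'"
    then have "i = i'" using mult by metis
    then show "i = i' \<and> d = d'" using * p by auto
  qed
  show "(\<lambda>(i, d). p ^ i * d) ` ({..e} \<times> {d. d dvd n}) = {d. d dvd p ^ e * n}"
  proof (intro equalityI subsetI)
    fix x assume "x \<in> {d. d dvd p ^ e * n}"
    then obtain b c where bc: "x = b * c" "b dvd p ^ e" "c dvd n"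
      using division_decomp by blast
    then obtain i where "i \<le> e" "b = p ^ i" using divides_primepow_nat[OF p] by blast
    then show "x \<in> (\<lambda>(i, d). p ^ i * d) ` ({..e} \<times> {d. d dvd n})" using bc by force
  qed (auto intro: mult_dvd_mono le_imp_power_dvd)
qed

lemma sum_divisors_prime_power_mult:
  fixes p n :: nat and h :: "nat \<Rightarrow> real"
  assumes p: "prime p" and n: "\<not> p dvd n" and h: "\<And>x y. h (x * y) = h x * h y" "h 1 = 1"
  shows "(\<Sum>d | d dvd p ^ e * n. h d) = (\<Sum>i\<le>e. h p ^ i) * (\<Sum>d | d dvd n. h d)"
proof -
  have pow: "h (p ^ i) = h p ^ i" for i by (induction i) (use h in auto)
  have "(\<Sum>d | d dvd p ^ e * n. h d) = (\<Sum>(i, d)\<in>{..e} \<times> {d. d dvd n}. h (p ^ i * d))"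
    using sum.reindex_bij_betw[OF divisors_prime_power_mult[OF p n], of h e] by (simp add: case_prod_beta')
  also have "\<dots> = (\<Sum>i\<le>e. \<Sum>d | d dvd n. h p ^ i * h d)"
    by (simp add: sum.cartesian_product h(1) pow)
  also have "\<dots> = (\<Sum>i\<le>e. h p ^ i) * (\<Sum>d | d dvd n. h d)"
    by (simp add: sum_product)
  finally show ?thesis .
qed

lemma split_off_prime:
  fixes n :: nat
  assumes "n > 1"
  obtains p e k where "prime p" "\<not> p dvd k" "n = p ^ e * k" "k < n" "k > 0"
proof -
  obtain p where p: "prime p" "p dvd n" using prime_factor_nat[of n] assms by auto
  define e where "e = multiplicity p n"
  obtain k where k: "n = p ^ e * k" "\<not> p dvd k"
    using multiplicity_decompose'[of n p] p assms unfolding e_def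
    by (metis not_prime_unit less_numeral_extra(4) not_one_less_zero)
  have "k > 0" using k assms by (cases k) auto
  moreover have "e \<noteq> 0" using k p by (cases e) auto
  then have "p ^ e > 1" using p prime_gt_1_nat[of p] by (intro one_less_power) auto
  then have "k < n" using k(1) \<open>k > 0\<close> by simp
  ultimately show thesis using that p k by blast
qed

lemma geometric_sign_sum:
  fixes z :: real
  assumes "z = 0 \<or> z = 1 \<or> z = - 1"
  shows "(\<Sum>i\<le>e. z ^ i) \<ge> 0" "even e \<Longrightarrow> (\<Sum>i\<le>e. z ^ i) \<ge> 1"
proof -
  have neg: "(\<Sum>i\<le>e. (- 1 :: real) ^ i) = (if even e then 1 else 0)" by (induction e) auto
  have zero: "(\<Sum>i\<le>e. (0 :: real) ^ i) = 1" by (induction e) auto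
  show "(\<Sum>i\<le>e. z ^ i) \<ge> 0" "even e \<Longrightarrow> (\<Sum>i\<le>e. z ^ i) \<ge> 1"
    using assms neg zero by auto
qed

lemma sum_divisors_sign:
  fixes h :: "nat \<Rightarrow> real"
  assumes h: "\<And>x y. h (x * y) = h x * h y" "h 1 = 1" "\<And>x. h x = 0 \<or> h x = 1 \<or> h x = - 1"
  shows "n > 0 \<Longrightarrow> 0 \<le> (\<Sum>d | d dvd n. h d) \<and> 1 \<le> (\<Sum>d | d dvd n\<^sup>2. h d)"
proof (induction n rule: less_induct)
  case (less n)
  show ?case
  proof (cases "n = 1")
    case False
    then have "n > 1" using less.prems by simp
    then obtain p e k where *: "prime p" "\<not> p dvd k" "n = p ^ e * k" "k < n" "k > 0"
      by (rule split_off_prime)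
    have n2: "n\<^sup>2 = p ^ (2 * e) * k\<^sup>2"
      unfolding *(3) power_mult_distrib by (simp add: mult.commute flip: power_mult)
    have "\<not> p dvd k\<^sup>2" using * prime_dvd_power by blast
    then have "(\<Sum>d | d dvd n\<^sup>2. h d) = (\<Sum>i\<le>2 * e. h p ^ i) * (\<Sum>d | d dvd k\<^sup>2. h d)"
      unfolding n2 by (intro sum_divisors_prime_power_mult[OF *(1) _ h(1,2)])
    moreover have "(\<Sum>d | d dvd n. h d) = (\<Sum>i\<le>e. h p ^ i) * (\<Sum>d | d dvd k. h d)"
      unfolding *(3) by (rule sum_divisors_prime_power_mult[OF *(1,2) h(1,2)])
    moreover have "(\<Sum>i\<le>2 * e. h p ^ i) \<ge> 1" by (rule geometric_sign_sum(2)[OF h(3)]) simp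
    moreover note less.IH[OF *(4,5)] geometric_sign_sum(1)[OF h(3), of p e]
    ultimately show ?thesis
      using mult_mono[of 1 "\<Sum>i\<le>2 * e. h p ^ i" 1 "\<Sum>d | d dvd k\<^sup>2. h d"] by simp
  qed (use h(2) in simp)
qed

lemma geometric_sum_ge:
  fixes u :: real
  assumes "u \<ge> 0"
  shows "n * u ^ (n - 1) \<le> (\<Sum>i<n. (u\<^sup>2) ^ i)"
proof -
  have "2 * (\<Sum>i<n. (u\<^sup>2) ^ i) = (\<Sum>i<n. (u\<^sup>2) ^ i) + (\<Sum>i<n. (u\<^sup>2) ^ (n - Suc i))"
    by (simp add: sum.nat_diff_reindex[of "\<lambda>i. (u\<^sup>2) ^ i" n])
  also have "\<dots> = (\<Sum>i<n. (u ^ i)\<^sup>2 + (u ^ (n - Suc i))\<^sup>2)"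
    by (simp add: sum.distrib mult.commute flip: power_mult)
  also have "\<dots> \<ge> (\<Sum>i<n. 2 * u ^ (n - 1))"
  proof (rule sum_mono)
    fix i assume "i \<in> {..<n}"
    then have "u ^ (n - 1) = u ^ i * u ^ (n - Suc i)" by (simp flip: power_add)
    then show "2 * u ^ (n - 1) \<le> (u ^ i)\<^sup>2 + (u ^ (n - Suc i))\<^sup>2"
      using sum_squares_bound[of "u ^ i" "u ^ (n - Suc i)"] by (simp add: mult.assoc)
  qed
  finally show ?thesis by simp
qed

text \<open>The weights in Monsky's argument. With \<open>G\<^sub>n = 1 + t + \<dots> + t\<^bsup>n-1\<^esup>\<close>, monotonicity amounts to
\<open>n (n + 1) t\<^sup>n \<le> G\<^sub>n G\<^sub>n\<^sub>+\<^sub>1\<close>, which follows from the inequality of the arithmetic and geometric means.\<close>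

lemma lambert_weight_decreasing:
  fixes t :: real
  assumes t: "0 < t" "t < 1" and n: "n \<ge> 1"
  defines "b \<equiv> \<lambda>n. 1 / (real n * (1 - t)) - t ^ n / (1 - t ^ n)"
  shows "b (Suc n) \<le> b n"
proof -
  define G where "G n = (\<Sum>i<n. t ^ i)" for n
  define u where "u = sqrt t"
  have u: "u > 0" "u < 1" "u\<^sup>2 = t" using t by (auto simp: u_def)
  have G: "1 - t ^ n = (1 - t) * G n" for n unfolding G_def by (rule one_diff_power_eq)
  have Gpos: "G n > 0" if "n \<ge> 1" for n using t that unfolding G_def by (intro sum_pos) (auto simp: lessThan_empty_iff)
  have "n * Suc n * t ^ n \<le> (n * u ^ (n - 1)) * (Suc n * u ^ n)"
  proof -
    have "t ^ n = u ^ (n + n)" using u(3) by (metis mult_2 power_mult)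
    also have "\<dots> \<le> u ^ ((n - 1) + n)" using u by (intro power_decreasing) auto
    finally have "t ^ n \<le> u ^ (n - 1) * u ^ n" by (simp add: power_add)
    then have "(n * Suc n) * t ^ n \<le> (n * Suc n) * (u ^ (n - 1) * u ^ n)" by (intro mult_left_mono) auto
    then show ?thesis by (simp add: algebra_simps)
  qed
  also have "\<dots> \<le> G n * G (Suc n)"
    using geometric_sum_ge[of u n] geometric_sum_ge[of u "Suc n"] u Gpos[OF n] unfolding G_def
    by (intro mult_mono) auto
  finally have key: "n * Suc n * t ^ n \<le> G n * G (Suc n)" .
  have "b n - b (Suc n) = (1 / (1 - t)) * (1 / (n * Suc n) - t ^ n / (G n * G (Suc n)))"
  proof -
    have 1: "1 / (real n * (1 - t)) - 1 / (real (Suc n) * (1 - t)) = (1 / (1 - t)) * (1 / (n * Suc n))"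
    proof -
      have "1 / (x * c) - 1 / (y * c) = (y - x) * ((1 / c) * (1 / (x * y)))"
        if "c \<noteq> 0" "x \<noteq> 0" "y \<noteq> 0" for x y c :: real
        using that by (simp add: field_simps)
      from this[of "1 - t" "real n" "real (Suc n)"] show ?thesis using t n by (simp add: distrib_left)
    qed
    have nz: "1 - t ^ n \<noteq> 0" "1 - t ^ Suc n \<noteq> 0" using G[of n] G[of "Suc n"] Gpos[of n] Gpos[of "Suc n"] n t by auto
    have "t ^ n / (1 - t ^ n) - t ^ Suc n / (1 - t ^ Suc n) = (t ^ n * (1 - t)) / ((1 - t ^ n) * (1 - t ^ Suc n))"
      using nz by (simp add: divide_simps) (simp add: algebra_simps)
    also have "\<dots> = (1 / (1 - t)) * (t ^ n / (G n * G (Suc n)))"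
    proof -
      have "(x * c) / ((c * y) * (c * z)) = (1 / c) * (x / (y * z))" if "c \<noteq> 0" for c x y z :: real
        using that by simp
      from this[of "1 - t"] show ?thesis unfolding G[of n] G[of "Suc n"] using t by simp
    qed
    finally have 2: "t ^ n / (1 - t ^ n) - t ^ Suc n / (1 - t ^ Suc n) = (1 / (1 - t)) * (t ^ n / (G n * G (Suc n)))" .
    show ?thesis unfolding b_def using 1 2 by (simp add: right_diff_distrib)
  qed
  also have "\<dots> \<ge> 0"
  proof -
    have frac: "x / y \<le> 1 / z" if "z * x \<le> y" "y > 0" "z > 0" for x y z :: real
      using that by (simp add: field_simps)
    have "real (n * Suc n) > 0" using n by (simp only: of_nat_0_less_iff) simp
    then have "t ^ n / (G n * G (Suc n)) \<le> 1 / (n * Suc n)"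
      by (rule frac[OF key mult_pos_pos[OF Gpos[OF n] Gpos[of "Suc n"]], rotated]) simp
    then show ?thesis using t by simp
  qed
  finally show ?thesis by simp
qed


text \<open>Suppose that \<open>L(1, \<psi>) = 0\<close>. Then the Lambert series \<open>\<Sum> \<psi>(n) t\<^sup>n / (1 - t\<^sup>n)\<close> is minus the sum of
\<open>\<psi>(n) (1 / (n (1 - t)) - t\<^sup>n / (1 - t\<^sup>n))\<close>, and is bounded for \<open>0 < t < 1\<close> because the weights decrease.
On the other hand the coefficient of \<open>t\<^sup>N\<close> in its power series is the sum of \<open>\<psi>\<close> over the divisors of \<open>N\<close>; it is
nonnegative, and at least \<open>1\<close> at squares, so the series is unbounded as \<open>t\<close> tends to \<open>1\<close>.\<close>

lemma real_character_Lfun_nonzero: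
  assumes \<psi>: "\<psi> \<in> dirichlet_characters m" "\<psi> \<noteq> principal_character m" "m > 0"
    and real: "\<And>x. cnj (\<psi> x) = \<psi> x"
  shows "Lfun \<psi> 1 \<noteq> 0"
proof
  assume L0: "Lfun \<psi> 1 = 0"
  define h where "h x = Re (\<psi> x)" for x
  have \<psi>h: "\<psi> x = of_real (h x)" for x
    using real[of x] by (simp add: h_def complex_eq_iff)
  have hm: "h (x * y) = h x * h y" for x y
    using dirichlet_characters_mult[OF \<psi>(1), of x y] unfolding \<psi>h by (simp flip: of_real_mult)
  have h1: "h 1 = 1" using dirichlet_characters_1[OF \<psi>(1)] unfolding \<psi>h by simp
  have hv: "h x = 0 \<or> h x = 1 \<or> h x = - 1" for x
    using norm_dirichlet_character[OF \<psi>(1,3), of x] unfolding \<psi>h norm_of_real by (auto split: if_splits)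
  have h0: "h 0 = 0" using nonprincipal_character_0[OF \<psi>(1,2)] by (simp add: h_def)
  have habs: "\<bar>h x\<bar> \<le> 1" for x using hv[of x] by auto
  let ?r = "\<lambda>N. \<Sum>d | d dvd N. h d"
  have upper: "(\<Sum>k=1..K. t ^ k\<^sup>2) \<le> m" if t: "0 < t" "t < 1" for t :: real and K
  proof -
    define b where "b n = 1 / (real n * (1 - t)) - t ^ n / (1 - t ^ n)" for n
    let ?l = "\<lambda>n. h n * (t ^ n / (1 - t ^ n))"
    have tn: "(\<lambda>n. t ^ n) \<longlonglongrightarrow> 0" by (rule LIMSEQ_power_zero) (use t in auto)
    have "b \<longlonglongrightarrow> 0 - 0 / (1 - 0)" unfolding b_def
      by (intro tendsto_intros tn) (use t in \<open>auto intro!: tendsto_divide_0[OF tendsto_const] filterlim_at_top_imp_at_infinity filterlim_tendsto_pos_mult_at_top[of _ "1 - t"] filterlim_real_sequentially filterlim_at_top_mult_tendsto_pos simp: mult.commute\<close>)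
    then have lim: "b \<longlonglongrightarrow> 0" by simp
    have dec: "b (Suc n) \<le> b n" if "n \<ge> 1" for n
      unfolding b_def by (rule lambert_weight_decreasing[OF t that])
    note A = nonprincipal_decreasing_sum[OF \<psi> lim dec]
    have b1: "b 1 = 1" using t by (simp add: b_def field_simps)
    have sb: "summable (\<lambda>n. h n * b n)"
      using A(1) summable_of_real_iff[of "\<lambda>n. h n * b n", where 'a = complex] by (simp add: \<psi>h)
    have sumb: "\<bar>\<Sum>n. h n * b n\<bar> \<le> m"
    proof -
      have "(\<Sum>n. \<psi> n * of_real (b n)) = of_real (\<Sum>n. h n * b n)"
        using suminf_of_real[OF sb, where 'a = complex] by (simp add: \<psi>h)
      then show ?thesis using A(2) b1 by simp
    qed
    have L: "(\<lambda>n. h n / real n) sums 0"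
    proof -
      have eq: "dterm \<psi> 1 = (\<lambda>n. of_real (h n / real n))"
        by (simp add: dterm_def \<psi>h powr_minus_divide fun_eq_iff)
      have "(\<lambda>n. of_real (h n / real n) :: complex) sums of_real 0"
        unfolding eq[symmetric]
        using nonprincipal_Lfun_bound(1)[OF \<psi>, of 1] L0 summable_sums[of "dterm \<psi> 1"] unfolding Lfun_def by simp
      then show ?thesis by (simp only: sums_of_real_iff)
    qed
    have "(\<lambda>n. (h n / real n) * (1 / (1 - t)) - h n * b n) sums (0 * (1 / (1 - t)) - (\<Sum>n. h n * b n))"
      by (intro sums_diff sums_mult2 L summable_sums sb)
    moreover have "(h n / real n) * (1 / (1 - t)) - h n * b n = ?l n" for n
      by (simp add: b_def algebra_simps)
    ultimately have l: "?l sums - (\<Sum>n. h n * b n)" by simp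
    let ?P = "{1::nat..} \<times> {1::nat..}"
    let ?S = "SIGMA N:{1::nat..}. {d. d dvd N}"
    let ?f = "\<lambda>(n, k). h n * t ^ (n * k)"
    have geo: "((\<lambda>k. t ^ (n * k)) has_sum (t ^ n / (1 - t ^ n))) {1..}" if "n \<ge> 1" for n
    proof -
      have tn1: "\<bar>t ^ n\<bar> < 1" using t that by (simp add: power_less_one_iff abs_of_pos)
      have "(\<lambda>k. (t ^ n) ^ k) sums (1 / (1 - t ^ n))" by (rule geometric_sums) (use tn1 in simp)
      then have "(\<lambda>k. t ^ n * (t ^ n) ^ k) sums (t ^ n * (1 / (1 - t ^ n)))" by (rule sums_mult)
      then have "((\<lambda>k. t ^ (n * Suc k)) has_sum (t ^ n / (1 - t ^ n))) UNIV"
        using t by (intro sums_nonneg_imp_has_sum) (auto simp: power_mult power_add)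
      moreover have "{1..} = range Suc" by (auto simp: image_def) (metis Suc_pred' less_eq_Suc_le)
      ultimately show ?thesis
        by (simp add: has_sum_reindex o_def)
    qed
    have geo_le: "t ^ n / (1 - t ^ n) \<le> t ^ n / (1 - t)" if "n \<ge> 1" for n
    proof -
      have "t ^ n \<le> t ^ 1" using t that by (intro power_decreasing) auto
      then show ?thesis using t by (intro divide_left_mono mult_pos_pos) auto
    qed
    have geo_summable: "(\<lambda>n. t ^ n / (1 - t)) summable_on UNIV"
      using t by (intro norm_summable_imp_summable_on) (simp add: summable_divide summable_geometric_iff abs_of_pos)
    have abs_sum: "(\<lambda>(n, k). t ^ (n * k)) summable_on ?P"
    proof (rule summable_on_SigmaI)
      show "((\<lambda>k. case (n, k) of (n, k) \<Rightarrow> t ^ (n * k)) has_sum (t ^ n / (1 - t ^ n))) {1..}" if "n \<in> {1..}" for n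
        using geo[of n] that by simp
      have 1: "(\<lambda>n. t ^ n / (1 - t)) summable_on {1..}" using geo_summable summable_on_subset_banach by blast
      show "(\<lambda>n. t ^ n / (1 - t ^ n)) summable_on {1..}"
      proof (rule summable_on_comparison_test[OF 1])
        fix n :: nat assume n: "n \<in> {1..}"
        then show "t ^ n / (1 - t ^ n) \<le> t ^ n / (1 - t)" using geo_le[of n] by simp
        show "0 \<le> t ^ n / (1 - t ^ n)" using t by (simp add: power_le_one)
      qed
    qed (use t in auto)
    have fs: "?f summable_on ?P"
    proof (rule abs_summable_summable, rule Infinite_Sum.abs_summable_on_comparison_test')
      show "(\<lambda>(n, k). t ^ (n * k)) summable_on ?P" by (rule abs_sum)
      show "norm (?f x) \<le> (case x of (n, k) \<Rightarrow> t ^ (n * k))" for x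
        using habs t by (auto simp: abs_mult mult_left_le_one_le split: prod.splits)
    qed
    have "infsum ?f ?P = infsum (\<lambda>n. infsum (\<lambda>k. h n * t ^ (n * k)) {1..}) {1..}"
      using infsum_Sigma'_banach[of "\<lambda>n k. h n * t ^ (n * k)" "{1..}" "\<lambda>_. {1..}"] fs by simp
    also have "\<dots> = infsum ?l {1..}"
    proof (rule infsum_cong)
      fix n :: nat assume n: "n \<in> {1..}"
      have "infsum (\<lambda>k. h n * t ^ (n * k)) {1..} = h n * infsum (\<lambda>k. t ^ (n * k)) {1..}"
        by (rule infsum_cmult_right')
      also have "infsum (\<lambda>k. t ^ (n * k)) {1..} = t ^ n / (1 - t ^ n)"
        by (rule infsumI[OF geo]) (use n in simp)
      finally show "infsum (\<lambda>k. h n * t ^ (n * k)) {1..} = ?l n" .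
    qed
    also have "\<dots> = infsum ?l UNIV"
      by (rule infsum_cong_neutral) (use h0 in \<open>auto simp: not_less_eq_eq\<close>)
    also have "\<dots> = suminf ?l"
    proof -
      have "(\<lambda>n. norm (?l n)) summable_on UNIV"
      proof (rule Infinite_Sum.abs_summable_on_comparison_test'[of "\<lambda>n. t ^ n / (1 - t)"])
        show "(\<lambda>n. t ^ n / (1 - t)) summable_on UNIV" by (rule geo_summable)
        show "norm (?l n) \<le> t ^ n / (1 - t)" for n
        proof (cases "n = 0")
          case False
          have "norm (?l n) \<le> 1 * (t ^ n / (1 - t ^ n))"
            unfolding norm_mult using habs t by (intro mult_mono) (auto simp: power_le_one)
          then show ?thesis using geo_le[of n] False by simp
        qed (use h0 t in simp)
      qed
      then have "?l summable_on UNIV" by (rule abs_summable_summable)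
      then have "?l sums infsum ?l UNIV" by (intro has_sum_imp_sums has_sum_infsum)
      then show ?thesis by (rule sums_unique)
    qed
    finally have F: "infsum ?f ?P = - (\<Sum>n. h n * b n)" using sums_unique[OF l] by simp
    have bij: "bij_betw (\<lambda>(N, d). (d, N div d)) ?S ?P"
      by (rule bij_betw_byWitness[where f' = "\<lambda>(n, k). (n * k, n)"])
        (auto simp: dvd_div_eq_0_iff Suc_le_eq intro: Nat.gr0I)
    have on_S: "?f ((\<lambda>(N, d). (d, N div d)) x) = (case x of (N, d) \<Rightarrow> h d * t ^ N)" if "x \<in> ?S" for x
      using that by auto
    have "(\<lambda>x. ?f ((\<lambda>(N, d). (d, N div d)) x)) summable_on ?S"
      using summable_on_reindex_bij_betw[OF bij, of ?f] fs by blast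
    then have S: "(\<lambda>(N, d). h d * t ^ N) summable_on ?S"
      using on_S summable_on_cong by (metis (no_types, lifting))
    have "infsum ?f ?P = infsum (\<lambda>x. ?f ((\<lambda>(N, d). (d, N div d)) x)) ?S"
      by (rule infsum_reindex_bij_betw[OF bij, symmetric])
    also have "\<dots> = infsum (\<lambda>(N, d). h d * t ^ N) ?S" by (rule infsum_cong[OF on_S])
    finally have eqS: "infsum ?f ?P = infsum (\<lambda>(N, d). h d * t ^ N) ?S" .
    have fin: "infsum (\<lambda>d. h d * t ^ N) {d. d dvd N} = ?r N * t ^ N" if "N \<in> {1..}" for N
      using that by (simp add: sum_distrib_right)
    have "(\<lambda>N. infsum (\<lambda>d. h d * t ^ N) {d. d dvd N}) summable_on {1..}"
      using summable_on_Sigma_banach[OF S] by simp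
    then have rs: "(\<lambda>N. ?r N * t ^ N) summable_on {1..}"
      by (rule iffD1[OF summable_on_cong[OF fin], rotated]) simp
    have "infsum ?f ?P = infsum (\<lambda>N. infsum (\<lambda>d. h d * t ^ N) {d. d dvd N}) {1..}"
      unfolding eqS by (rule infsum_Sigma'_banach[OF S, symmetric])
    also have "\<dots> = infsum (\<lambda>N. ?r N * t ^ N) {1..}" by (rule infsum_cong[OF fin])
    finally have eqr: "infsum ?f ?P = infsum (\<lambda>N. ?r N * t ^ N) {1..}" .
    have "(\<Sum>k=1..K. t ^ k\<^sup>2) \<le> (\<Sum>k=1..K. ?r (k\<^sup>2) * t ^ k\<^sup>2)"
      using sum_divisors_sign[OF hm h1 hv] t
      by (intro sum_mono) (simp add: mult_le_cancel_right1)
    also have "\<dots> = (\<Sum>N\<in>(\<lambda>k. k\<^sup>2) ` {1..K}. ?r N * t ^ N)"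
      by (subst sum.reindex) (auto simp: inj_on_def)
    also have "\<dots> \<le> infsum (\<lambda>N. ?r N * t ^ N) {1..}"
      by (rule finite_sum_le_infsum[OF rs])
        (use sum_divisors_sign[OF hm h1 hv] t in \<open>auto simp: Suc_le_eq\<close>)
    also have "\<dots> \<le> m" using F sumb eqr by linarith
    finally show ?thesis .
  qed
  define g where "g t = (\<Sum>k=1..m+1. t ^ k\<^sup>2)" for t :: real
  have "isCont g 1" unfolding g_def by (intro continuous_intros)
  then have "(g \<longlongrightarrow> g 1) (at_left 1)" by (simp add: continuous_within filterlim_at_split)
  moreover have "\<forall>\<^sub>F t in at_left 1. g t \<le> m"
    unfolding eventually_at_left_field g_def using upper[of _ "m + 1"] by (intro exI[of _ 0]) auto
  ultimately have "g 1 \<le> m" by (rule tendsto_upperbound) simp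
  then show False by (simp add: g_def)
qed


text \<open>The conjugate character has a zero at \<open>1\<close> whenever the character has one, so that a character with a
zero must be real.\<close>

lemma Lfun_at_1_nonzero:
  assumes \<psi>: "\<psi> \<in> dirichlet_characters m" "\<psi> \<noteq> principal_character m" "m > 0"
  shows "Lfun \<psi> 1 \<noteq> 0"
proof
  assume z: "Lfun \<psi> 1 = 0"
  define \<phi> where "\<phi> x = cnj (\<psi> x)" for x
  have \<phi>: "\<phi> \<in> dirichlet_characters m" using \<psi>(1) by (auto simp: dirichlet_characters_def \<phi>_def)
  have "\<phi> \<noteq> principal_character m"
  proof
    assume "\<phi> = principal_character m"
    then have "cnj (\<phi> x) = cnj (principal_character m x)" for x by simp
    then have "\<psi> = principal_character m" by (auto simp: \<phi>_def principal_character_def fun_eq_iff)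
    then show False using \<psi>(2) by simp
  qed
  moreover have "Lfun \<phi> 1 = cnj (Lfun \<psi> 1)"
  proof -
    have "(\<lambda>n. cnj (dterm \<psi> 1 n)) sums cnj (Lfun \<psi> 1)"
      using summable_sums[OF nonprincipal_Lfun_bound(1)[OF \<psi>, of 1]] by (simp add: Lfun_def sums_cnj)
    moreover have "cnj (dterm \<psi> 1 n) = dterm \<phi> 1 n" for n by (simp add: dterm_def \<phi>_def)
    ultimately show ?thesis by (simp add: Lfun_def sums_iff)
  qed
  ultimately have "\<phi> = \<psi>" using Lfun_at_most_one_zero[OF \<psi>(3) \<phi> _ \<psi>(1,2)] z by simp
  then have "cnj (\<psi> x) = \<psi> x" for x unfolding \<phi>_def by metis
  then show False using real_character_Lfun_nonzero[OF \<psi>] z by blast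
qed

lemma norm_Ln_near_1:
  fixes z :: complex
  assumes "norm (z - 1) \<le> 1 / 2"
  shows "norm (Ln z) \<le> 1"
proof -
  let ?x = "z - 1"
  have "norm (Ln (1 + ?x) - ?x) \<le> (norm ?x)\<^sup>2 / (1 - norm ?x)"
    by (rule Ln_approx_linear) (use assms in simp)
  also have "\<dots> \<le> (1 / 2)\<^sup>2 / (1 / 2)" using assms by (intro frac_le power_mono) auto
  finally have "norm (Ln (1 + ?x) - ?x) \<le> 1 / 2" by (simp add: power2_eq_square)
  then show ?thesis using assms norm_triangle_sub[of "Ln (1 + ?x)" ?x] by simp
qed

text \<open>Near \<open>s = 1\<close> the values of the \<open>L\<close>-function stay in a small disc around a nonzero number, where a branch
of the logarithm exists. The difference from that branch is continuous and takes values in a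
discrete set, hence is constant.\<close>

lemma logL_bounded:
  assumes \<psi>: "\<psi> \<in> dirichlet_characters m" "\<psi> \<noteq> principal_character m" "m > 0"
  shows "\<exists>B. \<forall>\<^sub>F s in at_right 1. norm (logL \<psi> s) \<le> B"
proof -
  define w where "w = Lfun \<psi> 1"
  have w: "w \<noteq> 0" using Lfun_at_1_nonzero[OF \<psi>] by (simp add: w_def)
  obtain C where C: "\<And>s. s > 1 \<Longrightarrow> norm (Lfun \<psi> s - w) \<le> C * (s - 1)"
    using nonprincipal_Lfun_Lipschitz[OF \<psi>] unfolding w_def by blast
  define d where "d = norm w / (2 * (\<bar>C\<bar> + 1))"
  have d: "d > 0" using w by (simp add: d_def)
  let ?I = "{1<..<1 + d}"
  have near: "norm (Lfun \<psi> s / w - 1) \<le> 1 / 2" if "s \<in> ?I" for s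
  proof -
    have "norm (Lfun \<psi> s - w) \<le> C * (s - 1)" using C that by simp
    also have "\<dots> \<le> (\<bar>C\<bar> + 1) * d" using that by (intro mult_mono) auto
    also have "\<dots> = norm w / 2" by (simp add: d_def field_simps)
    finally have "norm (Lfun \<psi> s - w) / norm w \<le> 1 / 2" using w by (simp add: field_simps)
    moreover have "Lfun \<psi> s / w - 1 = (Lfun \<psi> s - w) / w" using w by (simp add: field_simps)
    ultimately show ?thesis by (simp add: norm_divide)
  qed
  have pos: "Lfun \<psi> s / w \<notin> \<real>\<^sub>\<le>\<^sub>0" if "s \<in> ?I" for s
  proof
    assume "Lfun \<psi> s / w \<in> \<real>\<^sub>\<le>\<^sub>0"
    then have "Re (Lfun \<psi> s / w) \<le> 0" by (simp add: complex_nonpos_Reals_iff)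
    then show False using near[OF that] abs_Re_le_cmod[of "Lfun \<psi> s / w - 1"] by simp
  qed
  define h where "h s = logL \<psi> s - Ln (Lfun \<psi> s / w)" for s
  have cl: "continuous_on ?I (logL \<psi>)"
    by (rule continuous_on_subset[OF continuous_on_logL[OF \<psi>(3,1)]]) auto
  have "continuous_on ?I (\<lambda>s. exp (logL \<psi> s))" using cl by (intro continuous_intros)
  then have "continuous_on ?I (Lfun \<psi>)"
    by (rule continuous_on_eq) (simp add: exp_logL[OF \<psi>(3,1)])
  then have cont: "continuous_on ?I h" unfolding h_def
    by (intro continuous_on_diff cl continuous_on_Ln' continuous_on_divide continuous_on_const)
      (use w pos in auto)
  have exph: "exp (h s) = w" if "s \<in> ?I" for s
  proof -
    have "Lfun \<psi> s / w \<noteq> 0" using pos[OF that] by auto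
    then show ?thesis using that w by (simp add: h_def exp_diff exp_logL[OF \<psi>(3,1)])
  qed
  have "h constant_on ?I"
  proof (rule continuous_discrete_range_constant[OF _ cont])
    show "connected ?I" by simp
    fix s assume s: "s \<in> ?I"
    have "1 \<le> norm (h t - h s)" if t: "t \<in> ?I" "h t \<noteq> h s" for t
    proof -
      have "exp (h t) = exp (h s)" using exph s t by simp
      then obtain n :: int where n: "h t = h s + (of_int (2 * n) * pi) * \<i>" unfolding exp_eq by blast
      then have "n \<noteq> 0" using t(2) by auto
      then have "1 \<le> \<bar>real_of_int n\<bar>" by linarith
      then have "1 * 1 \<le> (2 * \<bar>real_of_int n\<bar>) * pi" using pi_ge_two by (intro mult_mono) auto
      moreover have "norm (h t - h s) = 2 * \<bar>real_of_int n\<bar> * pi" using n by (simp add: norm_mult)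
      ultimately show ?thesis by simp
    qed
    then show "\<exists>e>0. \<forall>y. y \<in> ?I \<and> h y \<noteq> h s \<longrightarrow> e \<le> norm (h y - h s)"
      by (intro exI[of _ 1]) auto
  qed
  then obtain c where c: "\<And>s. s \<in> ?I \<Longrightarrow> h s = c" unfolding constant_on_def by blast
  have "norm (logL \<psi> s) \<le> norm c + 1" if "s \<in> ?I" for s
  proof -
    have "logL \<psi> s = c + Ln (Lfun \<psi> s / w)" using c[OF that] by (simp add: h_def algebra_simps)
    then show ?thesis
      using norm_Ln_near_1[OF near[OF that]] norm_triangle_ineq[of c "Ln (Lfun \<psi> s / w)"] by simp
  qed
  then show ?thesis using d
    by (intro exI[of _ "norm c + 1"]) (auto simp: eventually_at_right_field intro!: exI[of _ "1 + d"])
qed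

text \<open>If there were only finitely many such primes, orthogonality would express the prime sum of the
principal character by bounded quantities, but that sum tends to infinity.\<close>

theorem dirichlet_primes_infinite:
  fixes a m :: nat
  assumes m: "m > 0" and a: "coprime a m"
  shows "infinite {p. prime p \<and> [p = a] (mod m)}"
proof
  assume fin: "finite {p. prime p \<and> [p = a] (mod m)}"
  let ?D = "dirichlet_characters m" and ?p = "principal_character m"
  let ?K = "\<Sum>n. 2 * real n powr - 2"
  obtain b where b: "[a * b = 1] (mod m)" using cong_solve_coprime_nat[OF a] by auto
  then have bm: "coprime b m" using cong_imp_coprime[OF cong_sym, of "a * b" 1 m] by simp
  have iff: "[b * p = 1] (mod m) \<longleftrightarrow> [p = a] (mod m)" for p
  proof
    assume "[b * p = 1] (mod m)"
    then have "[a * (b * p) = a * 1] (mod m)" by (rule cong_scalar_left)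
    moreover have "[a * b * p = 1 * p] (mod m)" using b by (rule cong_scalar_right)
    ultimately show "[p = a] (mod m)" by (metis cong_sym cong_trans mult.assoc mult_1 mult.right_neutral)
  next
    assume "[p = a] (mod m)"
    then have "[b * p = b * a] (mod m)" by (rule cong_scalar_left)
    then show "[b * p = 1] (mod m)" using b by (metis cong_trans mult.commute)
  qed
  let ?Q = "{p. prime p \<and> [b * p = 1] (mod m)}"
  have finQ: "finite ?Q" using fin by (simp only: iff)
  have "\<exists>B. \<forall>\<^sub>F s in at_right 1. norm (primesum \<psi> s) \<le> B" if "\<psi> \<in> ?D - {?p}" for \<psi>
  proof -
    have \<psi>: "\<psi> \<in> ?D" "\<psi> \<noteq> ?p" using that by auto
    obtain B where "\<forall>\<^sub>F s in at_right 1. norm (logL \<psi> s) \<le> B" using logL_bounded[OF \<psi> m] by blast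
    moreover have "\<forall>\<^sub>F s in at_right 1. norm (logL \<psi> s - primesum \<psi> s) \<le> ?K"
      using norm_logL_minus_primesum[OF m \<psi>(1)] by (auto simp: eventually_at_right_field intro: exI[of _ 2])
    ultimately have "\<forall>\<^sub>F s in at_right 1. norm (primesum \<psi> s) \<le> B + ?K"
    proof eventually_elim
      case (elim s)
      then show ?case using norm_triangle_ineq4[of "logL \<psi> s" "logL \<psi> s - primesum \<psi> s"] by simp
    qed
    then show ?thesis by blast
  qed
  then obtain B where "\<forall>\<psi>\<in>?D - {?p}. \<forall>\<^sub>F s in at_right 1. norm (primesum \<psi> s) \<le> B \<psi>" by metis
  then have B: "\<forall>\<^sub>F s in at_right 1. \<forall>\<psi>\<in>?D - {?p}. norm (primesum \<psi> s) \<le> B \<psi>"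
    using finite_dirichlet_characters[OF m] by (simp add: eventually_ball_finite)
  define T where "T = card ?D * real (card ?Q) + (\<Sum>\<psi>\<in>?D - {?p}. B \<psi>) + ?K"
  obtain d where d: "d > 0" "\<And>s. 1 < s \<Longrightarrow> s < 1 + d \<Longrightarrow> exp (T + 1) \<le> norm (Lfun ?p s)"
    using Lfun_principal_unbounded[OF m, of "exp (T + 1)"] by blast
  have "\<forall>\<^sub>F s in at_right 1. 1 < s \<and> s < 1 + d"
    using d(1) by (auto simp: eventually_at_right_field intro!: exI[of _ "1 + d"])
  with B have "\<forall>\<^sub>F s in at_right (1 :: real). False"
  proof eventually_elim
    case (elim s)
    then have s: "1 < s" "s < 1 + d" by auto
    have "T + 1 \<le> Re (logL ?p s)"
    proof -
      have "exp (T + 1) \<le> norm (exp (logL ?p s))" using d(2)[OF s] by (simp add: exp_logL[OF m _ s(1)])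
      then show ?thesis by simp
    qed
    moreover have "Re (logL ?p s) \<le> norm (primesum ?p s) + ?K"
      using norm_logL_minus_primesum[OF m principal_character_in s(1)]
        complex_Re_le_cmod[of "logL ?p s"] norm_triangle_sub[of "logL ?p s" "primesum ?p s"] by linarith
    moreover have "norm (primesum ?p s) \<le> card ?D * real (card ?Q) + (\<Sum>\<psi>\<in>?D - {?p}. B \<psi>)"
    proof -
      let ?u = "\<lambda>p. if prime p \<and> [b * p = 1] (mod m) then real p powr - s else 0"
      have "suminf ?u = (\<Sum>p\<in>?Q. ?u p)" by (rule suminf_finite[OF finQ]) auto
      also have "\<dots> \<le> (\<Sum>p\<in>?Q. 1)"
      proof (rule sum_mono)
        fix p assume "p \<in> ?Q"
        then have "real p powr - s \<le> real p powr 0" using s prime_ge_1_nat[of p] by (intro powr_mono) auto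
        then show "?u p \<le> 1" using \<open>p \<in> ?Q\<close> by (auto dest: prime_gt_0_nat)
      qed
      finally have u2: "suminf ?u \<le> card ?Q" by simp
      have "summable ?u" by (rule summable_finite[OF finQ]) auto
      then have u: "0 \<le> suminf ?u" "suminf ?u \<le> card ?Q"
        using u2 by (auto intro: suminf_nonneg)
      have "(\<Sum>\<psi>\<in>?D. \<psi> b * primesum \<psi> s) = ?p b * primesum ?p s + (\<Sum>\<psi>\<in>?D - {?p}. \<psi> b * primesum \<psi> s)"
        by (rule sum.remove[OF finite_dirichlet_characters[OF m]]) simp
      moreover have "?p b = 1" using bm by (simp add: principal_character_def)
      ultimately have "primesum ?p s =
          of_real (card ?D * suminf ?u) - (\<Sum>\<psi>\<in>?D - {?p}. \<psi> b * primesum \<psi> s)"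
        unfolding sum_character_primesum[OF m bm s(1)] by (simp add: algebra_simps)
      then have "norm (primesum ?p s) \<le> norm (of_real (card ?D * suminf ?u) :: complex) +
          norm (\<Sum>\<psi>\<in>?D - {?p}. \<psi> b * primesum \<psi> s)"
        by (simp only: norm_triangle_ineq4)
      also have "norm (of_real (card ?D * suminf ?u) :: complex) \<le> card ?D * real (card ?Q)"
        unfolding norm_of_real abs_mult using u by (intro mult_mono) auto
      also have "norm (\<Sum>\<psi>\<in>?D - {?p}. \<psi> b * primesum \<psi> s) \<le> (\<Sum>\<psi>\<in>?D - {?p}. B \<psi>)"
      proof (rule sum_norm_le)
        fix \<psi> assume \<psi>: "\<psi> \<in> ?D - {?p}"
        then have "norm (\<psi> b * primesum \<psi> s) \<le> 1 * B \<psi>"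
          unfolding norm_mult using elim norm_dirichlet_character_le[OF _ m] by (intro mult_mono) auto
        then show "norm (\<psi> b * primesum \<psi> s) \<le> B \<psi>" by simp
      qed
      finally show ?thesis by simp
    qed
    ultimately show False by (simp add: T_def)
  qed
  then show False by simp
qed

lemma infinite_primes_int:
  fixes a m :: int
  assumes "m \<noteq> 0" "coprime a m"
  shows "infinite {p :: nat. prime p \<and> [int p = a] (mod m)}"
proof -
  let ?m = "nat \<bar>m\<bar>" and ?r = "nat (a mod \<bar>m\<bar>)"
  have r: "int ?r = a mod \<bar>m\<bar>" using assms(1) by simp
  have "coprime (a mod \<bar>m\<bar>) \<bar>m\<bar>"
    by (rule iffD2[OF coprime_mod_left_iff]) (use assms in simp_all)
  then have "coprime (int ?r) (int ?m)" unfolding r by simp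
  then have "coprime ?r ?m" by (simp only: coprime_int_iff)
  then have "infinite {p. prime p \<and> [p = ?r] (mod ?m)}"
    using assms(1) by (intro dirichlet_primes_infinite) auto
  moreover have "[int p = a] (mod m)" if "[p = ?r] (mod ?m)" for p
  proof -
    have "[int p = int ?r] (mod int ?m)" using that by (simp only: cong_int_iff)
    then have "[int p = a mod \<bar>m\<bar>] (mod \<bar>m\<bar>)" unfolding r using assms(1) by simp
    then have "[int p = a] (mod \<bar>m\<bar>)" by (simp add: cong_def)
    then show ?thesis by (simp add: cong_iff_dvd_diff)
  qed
  then have "{p. prime p \<and> [p = ?r] (mod ?m)} \<subseteq> {p. prime p \<and> [int p = a] (mod m)}" by blast
  ultimately show ?thesis using infinite_super by blast
qed

lemma prime_in_class_gt:
  fixes a m :: int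
  assumes "m \<noteq> 0" "coprime a m"
  obtains p :: nat where "prime p" "p > N" "[int p = a] (mod m)"
proof -
  have "\<exists>p>N. p \<in> {p :: nat. prime p \<and> [int p = a] (mod m)}"
    using infinite_primes_int[OF assms] unfolding infinite_nat_iff_unbounded by blast
  then show thesis using that by blast
qed

lemma binary_crt_int:
  fixes m n u v :: int
  assumes "coprime m n"
  obtains x where "[x = u] (mod m)" "[x = v] (mod n)"
proof -
  obtain s t where st: "s * m + t * n = 1" using assms bezout_int[of m n] by auto
  have "u * (t * n) + v * (s * m) = u * (1 - s * m) + v * (s * m)"
    "u * (t * n) + v * (s * m) = u * (t * n) + v * (1 - t * n)"
    using st by (simp_all add: eq_diff_eq diff_eq_eq)
  then have "u * (t * n) + v * (s * m) - u = m * (s * (v - u))" "u * (t * n) + v * (s * m) - v = n * (t * (u - v))"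
    by (simp_all add: algebra_simps)
  then show thesis using that[of "u * (t * n) + v * (s * m)"] by (simp add: cong_iff_dvd_diff)
qed

lemma power_half_cong:
  fixes a p :: nat
  assumes p: "prime p" "\<not> p dvd a" "p - 1 = 2 * r"
  shows "\<exists>e\<in>{1, - 1}. int p dvd int a ^ r - e"
proof -
  have "[a ^ (p - 1) = 1] (mod p)" using p by (intro fermat_theorem) auto
  then have "[int a ^ (2 * r) = 1] (mod int p)"
    unfolding p(3) using cong_int_iff[of "a ^ (2 * r)" 1 p] by simp
  then have "int p dvd (int a ^ r) ^ 2 - 1"
    by (simp add: cong_iff_dvd_diff mult.commute flip: power_mult)
  also have "(int a ^ r) ^ 2 - 1 = (int a ^ r - 1) * (int a ^ r - (- 1))"
    by (simp add: power2_eq_square algebra_simps)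
  finally show ?thesis using p(1) prime_dvd_mult_iff[of "int p"] by auto
qed

text \<open>First \<open>A\<close> is chosen to be a prime so large that \<open>b\<close> is neither \<open>0\<close> nor \<open>1\<close> modulo \<open>A\<close>. Next \<open>p\<close> is
a prime congruent to \<open>3\<close> modulo \<open>4\<close>, so that \<open>r = (p - 1) / 2\<close> is odd, and \<open>A\<^sup>r\<close> is \<open>1\<close> or \<open>-1\<close> modulo
\<open>p\<close>. Since \<open>A\<close> does not divide \<open>r\<close>, a prime \<open>q\<close> can be congruent both to \<open>b\<close> modulo \<open>A\<close> and to \<open>-1\<close>
modulo \<open>r\<close>. Then \<open>r\<close> is coprime to \<open>q - 1\<close>, and the consecutive exponents are a multiple of \<open>q - 1\<close> and a
multiple of \<open>r\<close>.\<close>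

lemma coprime_exponents:
  fixes a b :: int
  assumes cop: "coprime a b" and b: "b \<noteq> 0" "b \<noteq> 1"
  obtains A p q :: nat and k :: nat and e :: int
  where "[int A = a] (mod b)" "[int p = b] (mod int A)" "[int q = b] (mod int A)"
    "e \<in> {1, - 1}" "int p dvd int A ^ Suc k - e" "int q dvd int A ^ k - 1"
proof -
  obtain A :: nat where A: "prime A" "A > nat \<bar>b\<bar> + 3" "[int A = a] (mod b)"
    using prime_in_class_gt[OF b(1) cop] by blast
  have Ab: "\<not> int A dvd b" "\<not> int A dvd b - 1"
    using A(2) b dvd_imp_le_int[of b "int A"] dvd_imp_le_int[of "b - 1" "int A"] by auto
  have "odd A" using A by (auto simp: prime_odd_nat)
  then have A4: "coprime (int A) 4"
    using coprime_power_right_iff[of "int A" 2 2] by (simp add: coprime_right_2_iff_odd)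
  obtain u where u: "[u = b] (mod int A)" "[u = 3] (mod 4)" using binary_crt_int[OF A4] by blast
  have prA: "prime (int A)" using A(1) by simp
  have copb: "coprime x (int A)" if "[x = b] (mod int A)" for x
  proof -
    have "\<not> int A dvd x" using that Ab(1) by (simp add: cong_dvd_iff)
    then show ?thesis using prime_imp_coprime[OF prA] coprime_commute by blast
  qed
  have "coprime u 4"
  proof -
    have "4 dvd u - 3" using u(2) by (simp add: cong_iff_dvd_diff)
    then have "odd u" by presburger
    then show ?thesis using coprime_power_right_iff[of u 2 2] by (simp add: coprime_right_2_iff_odd)
  qed
  then have "coprime u (int A * 4)" using copb[OF u(1)] by simp
  then obtain p :: nat where p: "prime p" "p > A" "[int p = u] (mod int A * 4)"
    using prime_in_class_gt[of "int A * 4" u A] A(2) by auto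
  have pb: "[int p = b] (mod int A)" using p(3) u(1) cong_modulus_mult cong_trans by blast
  have "[int p = u] (mod 4)" using p(3) cong_modulus_mult[of "int p" u 4 "int A"] by (simp add: mult.commute)
  then have "[int p = 3] (mod 4)" using u(2) by (rule cong_trans)
  then have p4: "p mod 4 = 3" by (simp add: cong_def) presburger
  define r where "r = (p - 1) div 2"
  have r: "p - 1 = 2 * r" "odd r" using p4 unfolding r_def by presburger+
  have "\<not> int A dvd int p - 1" using cong_dvd_iff[OF cong_diff[OF pb cong_refl, of 1]] Ab(2) by simp
  then have Ar: "\<not> int A dvd int r"
  proof -
    have "int p - 1 = 2 * int r" using r(1) prime_gt_0_nat[OF p(1)] by linarith
    then show ?thesis using \<open>\<not> int A dvd int p - 1\<close> by auto
  qed
  then have copAr: "coprime (int A) (int r)" using prA by (simp add: prime_imp_coprime)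
  obtain v where v: "[v = b] (mod int A)" "[v = - 1] (mod int r)" using binary_crt_int[OF copAr] by blast
  have "coprime v (int r)" using cong_imp_coprime[OF cong_sym[OF v(2)]] by simp
  then have cv: "coprime v (int A * int r)" using copb[OF v(1)] by simp
  have "int A * int r \<noteq> 0" using A(2) Ar by (cases "r = 0") auto
  then obtain q :: nat where q: "prime q" "q > A" "[int q = v] (mod int A * int r)"
    using prime_in_class_gt[OF _ cv] by blast
  have qb: "[int q = b] (mod int A)" using q(3) v(1) cong_modulus_mult cong_trans by blast
  have "[int q = v] (mod int r)"
    using q(3) cong_modulus_mult[of "int q" v "int r" "int A"] by (simp add: mult.commute)
  then have "[int q = - 1] (mod int r)" using v(2) by (rule cong_trans)
  then have rq: "int r dvd int q + 1" by (simp add: cong_iff_dvd_diff)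
  have "coprime r (q - 1)"
  proof (rule coprimeI)
    fix g assume g: "g dvd r" "g dvd q - 1"
    have "int g dvd int q + 1" using g(1) rq by (meson dvd_trans int_dvd_int_iff)
    moreover have "int g dvd int q - 1"
      using g(2) prime_gt_0_nat[OF q(1)] by (metis Suc_leI int_dvd_int_iff of_nat_1 of_nat_diff One_nat_def)
    ultimately have "int g dvd (int q + 1) - (int q - 1)" by (rule dvd_diff)
    then have "g dvd 2" using int_dvd_int_iff[of g 2] by simp
    moreover have "odd g" using g(1) r(2) by (meson dvd_trans)
    moreover have "coprime g 2" using \<open>odd g\<close> by simp
    ultimately show "is_unit g" by (metis coprime_absorb_left)
  qed
  then obtain w where w: "[r * w = 1] (mod (q - 1))" using cong_solve_coprime_nat by auto
  have q1: "q - 1 > 1" using q(2) A(2) by simp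
  have r0: "r > 0" using r(2) by (metis even_zero neq0_conv)
  have "w \<noteq> 0"
  proof
    assume "w = 0"
    then show False using w q1 by (simp add: cong_def)
  qed
  then have rw: "r * w > 0" using r0 by simp
  define k where "k = r * w - 1"
  have k: "Suc k = r * w" using rw by (simp add: k_def)
  have "(q - 1) dvd k" using cong_to_1_nat[OF w] by (simp only: k_def)
  then obtain l where l: "k = (q - 1) * l" ..
  obtain e where e: "e \<in> {1, - 1}" "int p dvd int A ^ r - e"
    using power_half_cong[OF p(1) _ r(1)] p(2) primes_dvd_imp_eq[OF p(1) A(1)] by blast
  have "[int A ^ r = e] (mod int p)" using e(2) by (simp add: cong_iff_dvd_diff)
  then have "[(int A ^ r) ^ w = e ^ w] (mod int p)" by (rule cong_pow)
  then have 1: "int p dvd int A ^ Suc k - e ^ w" unfolding k by (simp add: cong_iff_dvd_diff power_mult)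
  have e': "e ^ w \<in> {1, - 1}" using e(1) by (cases "even w") auto
  have "\<not> q dvd A" using q(2) primes_dvd_imp_eq[OF q(1) A(1)] by blast
  then have "[A ^ (q - 1) = 1] (mod q)" using q(1) by (intro fermat_theorem) auto
  then have "[(A ^ (q - 1)) ^ l = 1 ^ l] (mod q)" by (rule cong_pow)
  then have "[A ^ k = 1] (mod q)" by (simp add: l power_mult)
  then have 2: "int q dvd int A ^ k - 1"
    using cong_int_iff[of "A ^ k" 1 q] by (simp add: cong_iff_dvd_diff)
  show thesis using that[OF A(3) pb qb e' 1 2] .
qed

section \<open>Displacement and circumcentres in CAT(0) spaces\<close>

lemma dist_vector_2: "dist (vector [x, y] :: real^2) (vector [u, v]) = sqrt ((x - u)\<^sup>2 + (y - v)\<^sup>2)"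
  by (simp add: dist_vec_def L2_set_def sum_2 dist_real_def)

text \<open>The vertex \<open>p\<close> is placed by the law of cosines; the triangle inequalities say that its second
coordinate is real.\<close>

lemma comparison_triangle_exists:
  fixes a b c :: real
  assumes "a \<ge> 0" "b \<ge> 0" "c \<ge> 0" "a \<le> b + c" "b \<le> a + c" "c \<le> a + b"
  shows "\<exists>p q r :: real^2. dist q r = a \<and> dist p q = b \<and> dist r p = c"
proof (cases "a = 0")
  case True
  then have "b = c" using assms by simp
  then have "dist (vector [0, 0] :: real^2) (vector [0, 0]) = a" "dist (vector [b, 0] :: real^2) (vector [0, 0]) = b"
    "dist (vector [0, 0] :: real^2) (vector [b, 0]) = c"
    using True assms by (simp_all add: dist_vector_2)
  then show ?thesis by blast
next
  case False
  then have a: "a > 0" using assms by simp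
  define x where "x = (a\<^sup>2 + b\<^sup>2 - c\<^sup>2) / (2 * a)"
  have ax: "2 * a * x = a\<^sup>2 + b\<^sup>2 - c\<^sup>2" using a by (simp add: x_def)
  have "c\<^sup>2 \<le> (a + b)\<^sup>2" using assms by (intro power_mono) auto
  then have "2 * a * (- b) \<le> 2 * a * x" unfolding ax by (simp add: power2_sum)
  then have "- b \<le> x" by (rule mult_left_le_imp_le) (use a in simp)
  moreover have "(a - b)\<^sup>2 \<le> c\<^sup>2" using assms by (intro power2_le_iff_abs_le[THEN iffD2]) auto
  then have "2 * a * x \<le> 2 * a * b" unfolding ax by (simp add: power2_diff)
  then have "x \<le> b" by (rule mult_left_le_imp_le) (use a in simp)
  ultimately have "x\<^sup>2 \<le> b\<^sup>2" by (intro power2_le_iff_abs_le[THEN iffD2]) (use assms in auto)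
  then have y: "(sqrt (b\<^sup>2 - x\<^sup>2))\<^sup>2 = b\<^sup>2 - x\<^sup>2" by simp
  let ?y = "sqrt (b\<^sup>2 - x\<^sup>2)"
  have "dist (vector [0, 0] :: real^2) (vector [a, 0]) = a" using a by (simp add: dist_vector_2)
  moreover have "dist (vector [x, ?y] :: real^2) (vector [0, 0]) = b"
    using assms y by (simp add: dist_vector_2)
  moreover have "(a - x)\<^sup>2 + ?y\<^sup>2 = c\<^sup>2" unfolding y using ax by (simp add: power2_diff)
  then have "dist (vector [a, 0] :: real^2) (vector [x, ?y]) = c"
    using assms by (simp add: dist_vector_2)
  ultimately show ?thesis by blast
qed

locale CAT0 = Metric_space M d for M :: "'a set" and d :: "'a \<Rightarrow> 'a \<Rightarrow> real" +
  assumes CAT0: "CAT0_space M d"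
begin

lemma comparison_triangle_ex:
  assumes "p \<in> M" "q \<in> M" "r \<in> M"
  shows "\<exists>p' q' r'. comparison_triangle d p q r p' q' r'"
proof -
  have "\<exists>p' q' r' :: real^2. dist q' r' = d q r \<and> dist p' q' = d p q \<and> dist r' p' = d r p"
    using assms triangle[of q p r] triangle[of p r q] triangle[of r q p] commute[of p q] commute[of q r] commute[of r p]
    by (intro comparison_triangle_exists) auto
  then show ?thesis unfolding comparison_triangle_def by blast
qed

lemma geodesic_ends:
  assumes "geodesic_segment M d x y S"
  shows "x \<in> S" "y \<in> S"
  using assms unfolding geodesic_segment_def by force+

lemma segment_ex: "x \<in> M \<Longrightarrow> y \<in> M \<Longrightarrow> \<exists>S. geodesic_segment M d x y S"
  using CAT0 by (simp add: CAT0_space_def geodesic_space_def)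

lemma segment_midpoint:
  assumes "geodesic_segment M d x y S"
  shows "\<exists>m\<in>S. m \<in> M \<and> d x m = d x y / 2 \<and> d m y = d x y / 2"
proof -
  obtain c l where c: "0 \<le> l" "c \<in> {0..l} \<rightarrow> M" "c 0 = x" "c l = y"
    "\<forall>s\<in>{0..l}. \<forall>t\<in>{0..l}. d (c s) (c t) = \<bar>s - t\<bar>" "S = c ` {0..l}"
    using assms unfolding geodesic_segment_def by blast
  have "d x y = l" using c by force
  moreover have "d x (c (l / 2)) = l / 2" "d (c (l / 2)) y = l / 2" using c by force+
  moreover have "c (l / 2) \<in> S" "c (l / 2) \<in> M" using c by auto
  ultimately show ?thesis by blast
qed

lemma midpoint_comparison:
  fixes p' q' :: "real^2"
  assumes "m \<in> S" "d p m = d p q / 2" "dist p' q' = d p q"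
  shows "comparison_point d p S m p' q' (midpoint p' q')"
  using assms by (simp add: comparison_point_def dist_midpoint midpoint_in_closed_segment)

lemma CAT0_compare:
  assumes "p \<in> M" "q \<in> M" "r \<in> M" "geodesic_segment M d p q A" "geodesic_segment M d q r B"
    and "comparison_triangle d p q r p' q' r'"
    and "comparison_point d p A x p' q' x'" "comparison_point d q B y q' r' y'"
  shows "d x y \<le> dist x' y'"
proof -
  obtain C where "geodesic_segment M d r p C" using segment_ex assms by blast
  then have "CAT0_inequality d p q r A B C" using CAT0 assms unfolding CAT0_space_def by blast
  then show ?thesis using assms(6-8) unfolding CAT0_inequality_def Let_def by blast
qed

lemma midline_inequality:
  assumes "p \<in> M" "q \<in> M" "r \<in> M" "geodesic_segment M d p q A" "geodesic_segment M d q r B"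
    and "m \<in> A" "d p m = d p q / 2" "n \<in> B" "d q n = d q r / 2"
  shows "d m n \<le> d p r / 2"
proof -
  obtain p' q' r' where t: "comparison_triangle d p q r p' q' r'"
    using comparison_triangle_ex assms by blast
  then have "comparison_point d p A m p' q' (midpoint p' q')" "comparison_point d q B n q' r' (midpoint q' r')"
    using assms by (auto simp: comparison_triangle_def intro!: midpoint_comparison)
  then have "d m n \<le> dist (midpoint p' q') (midpoint q' r')"
    using CAT0_compare[OF assms(1-5) t] by blast
  also have "\<dots> = dist p' r' / 2"
  proof -
    have "midpoint p' q' - midpoint q' r' = (1 / 2) *\<^sub>R (p' - r')"
      by (simp add: midpoint_def algebra_simps)
    then show ?thesis by (simp add: dist_norm)
  qed
  finally show ?thesis using t assms(1,3) by (simp add: comparison_triangle_def dist_commute commute)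
qed

lemma CN_inequality:
  assumes q: "q \<in> M" and r: "r \<in> M"
  shows "\<exists>m\<in>M. \<forall>p\<in>M. (d p m)\<^sup>2 \<le> (d p q)\<^sup>2 / 2 + (d p r)\<^sup>2 / 2 - (d q r)\<^sup>2 / 4"
proof -
  obtain B where B: "geodesic_segment M d q r B" using segment_ex assms by blast
  obtain m where m: "m \<in> B" "m \<in> M" "d q m = d q r / 2" using segment_midpoint[OF B] by blast
  have "(d p m)\<^sup>2 \<le> (d p q)\<^sup>2 / 2 + (d p r)\<^sup>2 / 2 - (d q r)\<^sup>2 / 4" if p: "p \<in> M" for p
  proof -
    obtain A where A: "geodesic_segment M d p q A" using segment_ex assms p by blast
    obtain p' q' r' where t: "comparison_triangle d p q r p' q' r'"
      using comparison_triangle_ex assms p by blast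
    have "comparison_point d p A p p' q' p'"
      using geodesic_ends[OF A] p by (simp add: comparison_point_def)
    moreover have "comparison_point d q B m q' r' (midpoint q' r')"
      using m t by (auto simp: comparison_triangle_def intro!: midpoint_comparison)
    ultimately have "d p m \<le> dist p' (midpoint q' r')"
      using CAT0_compare[OF p q r A B t] by blast
    then have "(d p m)\<^sup>2 \<le> (dist p' (midpoint q' r'))\<^sup>2" by (intro power_mono) auto
    also have "\<dots> = (dist p' q')\<^sup>2 / 2 + (dist p' r')\<^sup>2 / 2 - (dist q' r')\<^sup>2 / 4"
    proof -
      define u v where "u = p' - q'" and "v = p' - r'"
      have "p' - midpoint q' r' = (1 / 2) *\<^sub>R (2 *\<^sub>R p' - (q' + r'))"
        by (simp add: midpoint_def scaleR_diff_right)
      then have 1: "p' - midpoint q' r' = (1 / 2) *\<^sub>R (u + v)" "q' - r' = v - u"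
        by (simp_all add: u_def v_def scaleR_2)
      have "(norm (p' - midpoint q' r'))\<^sup>2 = (norm u)\<^sup>2 / 2 + (norm v)\<^sup>2 / 2 - (norm (q' - r'))\<^sup>2 / 4"
        unfolding 1 by (simp add: power2_norm_eq_inner algebra_simps inner_commute) (simp add: field_simps)
      then show ?thesis by (simp add: dist_norm u_def v_def)
    qed
    finally show ?thesis using t p r by (simp add: comparison_triangle_def dist_commute commute)
  qed
  then show ?thesis using m(2) by blast
qed

definition isometric_self_map :: "('a \<Rightarrow> 'a) \<Rightarrow> bool" where
  "isometric_self_map f \<longleftrightarrow> f \<in> M \<rightarrow> M \<and> (\<forall>x\<in>M. \<forall>y\<in>M. d (f x) (f y) = d x y)"

lemma isometric_self_map_funpow: "isometric_self_map f \<Longrightarrow> isometric_self_map (f ^^ n)"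
  by (induction n) (auto simp: isometric_self_map_def Pi_iff)

lemma geodesic_segment_image:
  assumes "isometric_self_map f" "geodesic_segment M d x y S"
  shows "geodesic_segment M d (f x) (f y) (f ` S)"
proof -
  obtain c l where c: "0 \<le> l" "c \<in> {0..l} \<rightarrow> M" "c 0 = x" "c l = y"
    "\<forall>s\<in>{0..l}. \<forall>t\<in>{0..l}. d (c s) (c t) = \<bar>s - t\<bar>" "S = c ` {0..l}"
    using assms(2) unfolding geodesic_segment_def by blast
  show ?thesis unfolding geodesic_segment_def
  proof (intro exI conjI)
    show "f \<circ> c \<in> {0..l} \<rightarrow> M" using c assms(1) by (auto simp: isometric_self_map_def)
    show "\<forall>s\<in>{0..l}. \<forall>t\<in>{0..l}. d ((f \<circ> c) s) ((f \<circ> c) t) = \<bar>s - t\<bar>"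
      using c assms(1) by (auto simp: isometric_self_map_def Pi_iff)
  qed (use c in \<open>auto simp: image_comp\<close>)
qed

text \<open>If \<open>m\<close> is the midpoint of \<open>y\<close> and \<open>f y\<close>, then \<open>f m\<close> is the midpoint of \<open>f y\<close> and \<open>f (f y)\<close>, and the
segment from \<open>m\<close> to \<open>f m\<close> is a midline of the triangle \<open>y, f y, f (f y)\<close>.\<close>

lemma displacement_square:
  assumes f: "isometric_self_map f" and L: "\<And>y. y \<in> M \<Longrightarrow> L \<le> d (f y) y" and y: "y \<in> M"
  shows "2 * L \<le> d (f (f y)) y"
proof -
  have fM: "f x \<in> M" if "x \<in> M" for x using f that by (auto simp: isometric_self_map_def)
  obtain A where A: "geodesic_segment M d y (f y) A" using segment_ex y fM by blast
  obtain m where m: "m \<in> A" "m \<in> M" "d y m = d y (f y) / 2" using segment_midpoint[OF A] by blast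
  have "d m (f m) \<le> d y (f (f y)) / 2"
  proof (rule midline_inequality[OF _ _ _ A geodesic_segment_image[OF f A] m(1,3)])
    show "d (f y) (f m) = d (f y) (f (f y)) / 2" using f m y fM by (simp add: isometric_self_map_def)
  qed (use y fM m in auto)
  then show ?thesis using L[OF m(2)] by (simp add: commute)
qed

lemma displacement_power:
  assumes f: "isometric_self_map f" and L: "\<And>y. y \<in> M \<Longrightarrow> L \<le> d (f y) y"
  shows "y \<in> M \<Longrightarrow> 2 ^ k * L \<le> d ((f ^^ (2 ^ k)) y) y"
proof (induction k arbitrary: y)
  case (Suc k)
  have "2 * (2 ^ k * L) \<le> d ((f ^^ (2 ^ k)) ((f ^^ (2 ^ k)) y)) y"
    by (rule displacement_square[OF isometric_self_map_funpow[OF f]]) (use Suc in auto)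
  moreover have "(2 :: nat) ^ Suc k = 2 ^ k + 2 ^ k" by simp
  ultimately show ?case by (simp only: funpow_add o_apply power_Suc mult.assoc)
qed (use L in simp)

text \<open>The displacement of the power \<open>4\<^sup>k\<close> is at least \<open>4\<^sup>k\<close> times the infimum of the displacement of \<open>f\<close>, so
growth of order \<open>2\<^sup>k\<close> forces the infimum to be \<open>0\<close>.\<close>

lemma distorted_semisimple_fixes_point:
  assumes f: "semisimple M d f" and x: "x \<in> M" and C: "\<And>k. d ((f ^^ (4 ^ k)) x) x \<le> C * 2 ^ k"
  shows "\<exists>y\<in>M. f y = y"
proof -
  have fi: "isometric_self_map f"
    using f Bij_imp_funcset by (auto simp: semisimple_def Isom_def isometric_self_map_def)
  obtain x0 where x0: "x0 \<in> M" "d (f x0) x0 = (INF y\<in>M. d (f y) y)"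
    using f by (auto simp: semisimple_def)
  define L where "L = d (f x0) x0"
  have L: "L \<le> d (f y) y" if "y \<in> M" for y
    unfolding L_def x0(2) by (rule cINF_lower) (use that in \<open>auto intro!: bdd_belowI[of _ 0]\<close>)
  have "2 ^ k * L \<le> C" for k
  proof -
    have "2 ^ (2 * k) * L \<le> d ((f ^^ (2 ^ (2 * k))) x) x" by (rule displacement_power[OF fi L x])
    also have "(2 :: nat) ^ (2 * k) = 4 ^ k" by (simp add: power_mult)
    also have "d ((f ^^ (4 ^ k)) x) x \<le> C * 2 ^ k" by (rule C)
    finally have "2 ^ (2 * k) * L \<le> C * 2 ^ k" .
    then have "2 ^ k * (2 ^ k * L) \<le> 2 ^ k * C" unfolding mult_2 power_add by (simp only: mult_ac)
    then show ?thesis by (rule mult_left_le_imp_le) simp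
  qed
  moreover have "L \<ge> 0" by (simp add: L_def)
  moreover have "\<exists>k. C < 2 ^ k * L" if "L > 0"
  proof -
    obtain k where "C / L < 2 ^ k" using real_arch_pow[of 2 "C / L"] by auto
    then show ?thesis using that by (auto simp: field_simps)
  qed
  ultimately have "L = 0" by (metis less_eq_real_def not_le)
  moreover have "f x0 \<in> M" using fi x0(1) by (auto simp: isometric_self_map_def)
  ultimately show ?thesis using x0(1) by (auto simp: L_def)
qed

text \<open>By the CN inequality, points at which the radius function of \<open>S\<close> is nearly minimal are close to each
other. So by completeness the minimum is attained, at exactly one point, and a symmetry of \<open>S\<close> must
fix that point.\<close>

lemma circumcenter_fixed:
  assumes complete: "mcomplete" and S: "S \<subseteq> M" "S \<noteq> {}" and bdd: "\<And>x. x \<in> S \<Longrightarrow> d a x \<le> K" and a: "a \<in> M"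
    and G: "\<And>g. g \<in> G \<Longrightarrow> isometric_self_map g \<and> g ` S = S"
  shows "\<exists>x\<in>M. \<forall>g\<in>G. g x = x"
proof -
  define rad where "rad x = (SUP s\<in>S. d x s)" for x
  have bd: "bdd_above (d x ` S)" if "x \<in> M" for x
  proof (rule bdd_aboveI2)
    fix s assume "s \<in> S"
    then show "d x s \<le> d x a + K" using triangle[of x a s] bdd[of s] that a S by auto
  qed
  have le_rad: "d x s \<le> rad x" if "x \<in> M" "s \<in> S" for x s
    unfolding rad_def using bd that by (intro cSUP_upper)
  have rad_le: "rad x \<le> B" if "\<And>s. s \<in> S \<Longrightarrow> d x s \<le> B" for x B
    unfolding rad_def using S that by (intro cSUP_least)
  have rad0: "rad x \<ge> 0" if "x \<in> M" for x using le_rad[OF that] S nonneg[of x] by (meson ex_in_conv order_trans)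
  define R where "R = (INF x\<in>M. rad x)"
  have bR: "bdd_below (rad ` M)" by (rule bdd_belowI2) (rule rad0)
  have Rle: "R \<le> rad x" if "x \<in> M" for x unfolding R_def using bR that by (intro cINF_lower)
  have R0: "R \<ge> 0" unfolding R_def using a by (intro cINF_greatest) (auto intro: rad0)
  have near: "(d x y)\<^sup>2 \<le> 2 * (rad x)\<^sup>2 + 2 * (rad y)\<^sup>2 - 4 * R\<^sup>2" if xy: "x \<in> M" "y \<in> M" for x y
  proof -
    obtain m where m: "m \<in> M" "\<forall>p\<in>M. (d p m)\<^sup>2 \<le> (d p x)\<^sup>2 / 2 + (d p y)\<^sup>2 / 2 - (d x y)\<^sup>2 / 4"
      using CN_inequality[OF xy] by blast
    let ?B = "(rad x)\<^sup>2 / 2 + (rad y)\<^sup>2 / 2 - (d x y)\<^sup>2 / 4"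
    have sB: "(d m s)\<^sup>2 \<le> ?B" if "s \<in> S" for s
    proof -
      have "s \<in> M" using that S by auto
      then have "(d s m)\<^sup>2 \<le> (d s x)\<^sup>2 / 2 + (d s y)\<^sup>2 / 2 - (d x y)\<^sup>2 / 4" using m by blast
      moreover have "(d s x)\<^sup>2 \<le> (rad x)\<^sup>2" "(d s y)\<^sup>2 \<le> (rad y)\<^sup>2"
        using le_rad[OF xy(1) that] le_rad[OF xy(2) that] by (auto simp: commute intro!: power_mono)
      ultimately show ?thesis using m(1) \<open>s \<in> M\<close> by (simp add: commute)
    qed
    then have B0: "?B \<ge> 0" using S by (meson ex_in_conv order_trans zero_le_power2)
    have "rad m \<le> sqrt ?B" by (rule rad_le) (rule real_le_rsqrt[OF sB])
    then have "R \<le> sqrt ?B" using Rle[OF m(1)] by linarith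
    then have "R\<^sup>2 \<le> ?B" using R0 B0 by (metis power_mono real_sqrt_pow2)
    then show ?thesis by simp
  qed
  have "\<exists>x\<in>M. rad x < R + 1 / Suc n" for n
    using cInf_lessD[of "rad ` M" "R + 1 / Suc n"] a unfolding R_def by fastforce
  then obtain x where x: "\<And>n. x n \<in> M" "\<And>n. rad (x n) < R + 1 / Suc n" by metis
  have lim: "(\<lambda>n. (R + 1 / Suc n)\<^sup>2) \<longlonglongrightarrow> (R + 0)\<^sup>2"
    by (intro tendsto_intros LIMSEQ_Suc[OF lim_1_over_n])
  have "MCauchy x" unfolding MCauchy_def
  proof (intro conjI allI impI)
    fix e :: real assume e: "e > 0"
    have "\<forall>\<^sub>F n in sequentially. (R + 1 / Suc n)\<^sup>2 < R\<^sup>2 + e\<^sup>2 / 4"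
      by (rule order_tendstoD(2)[OF lim]) (use e in simp)
    then obtain N where N: "\<And>n. n \<ge> N \<Longrightarrow> (R + 1 / Suc n)\<^sup>2 < R\<^sup>2 + e\<^sup>2 / 4"
      unfolding eventually_sequentially by blast
    have sq: "(rad (x n))\<^sup>2 < R\<^sup>2 + e\<^sup>2 / 4" if "n \<ge> N" for n
    proof -
      have "(rad (x n))\<^sup>2 \<le> (R + 1 / Suc n)\<^sup>2"
        using x rad0 by (intro power_mono) (auto intro: less_imp_le)
      then show ?thesis using N[OF that] by simp
    qed
    show "\<exists>N. \<forall>n n'. N \<le> n \<longrightarrow> N \<le> n' \<longrightarrow> d (x n) (x n') < e"
    proof (intro exI allI impI)
      fix n n' assume "N \<le> n" "N \<le> n'"
      then have "(d (x n) (x n'))\<^sup>2 < e\<^sup>2" using sq[of n] sq[of n'] near[OF x(1) x(1), of n n'] by simp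
      then show "d (x n) (x n') < e" using e power_less_imp_less_base by fastforce
    qed
  qed (use x in auto)
  then obtain z where z: "limitin mtopology x z sequentially" using complete unfolding mcomplete_def by blast
  have zM: "z \<in> M" using z limitin_mspace by blast
  have "rad z \<le> R"
  proof (rule field_le_epsilon)
    fix e :: real assume e: "e > 0"
    obtain N where N: "\<And>n. n \<ge> N \<Longrightarrow> d (x n) z < e / 2"
      using z e unfolding limit_metric_sequentially by (meson half_gt_zero)
    obtain N' where N': "1 / Suc N' < e / 2" using nat_approx_posE[of "e / 2"] e by auto
    let ?n = "max N N'"
    have "1 / real (Suc ?n) \<le> 1 / Suc N'" by (intro divide_left_mono) auto
    then have r: "rad (x ?n) < R + e / 2" using x(2)[of ?n] N' by linarith
    show "rad z \<le> R + e"
    proof (rule rad_le)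
      fix s assume s: "s \<in> S"
      then have "d z s \<le> d z (x ?n) + d (x ?n) s" using S zM x by (intro triangle) auto
      also have "\<dots> \<le> e / 2 + rad (x ?n)"
        using N[of ?n] le_rad[OF x(1) s] zM x(1) by (intro add_mono) (auto simp: commute)
      finally show "d z s \<le> R + e" using r by linarith
    qed
  qed
  then have rz: "rad z = R" using Rle[OF zM] by simp
  have "g z = z" if "g \<in> G" for g
  proof -
    have g: "isometric_self_map g" "g ` S = S" using G[OF that] by auto
    have gM: "g z \<in> M" using g zM by (auto simp: isometric_self_map_def)
    have "rad (g z) \<le> R"
    proof (rule rad_le)
      fix s assume "s \<in> S"
      then obtain s' where s': "s' \<in> S" "s = g s'" using g(2) by blast
      then have "d (g z) s = d z s'" using g(1) zM S by (auto simp: isometric_self_map_def)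
      then show "d (g z) s \<le> R" using le_rad[OF zM s'(1)] rz by simp
    qed
    then have "rad (g z) = R" using Rle[OF gM] by simp
    then have "(d (g z) z)\<^sup>2 \<le> 0" using near[OF gM zM] rz by simp
    then show ?thesis using gM zM by simp
  qed
  then show ?thesis using zM by blast
qed

end

section \<open>Length functions on SL(3, Z)\<close>

definition M3 :: "int \<Rightarrow> int \<Rightarrow> int \<Rightarrow> int \<Rightarrow> int \<Rightarrow> int \<Rightarrow> int \<Rightarrow> int \<Rightarrow> int \<Rightarrow> int mat" where
  "M3 a b c d e f g h i = mat 3 3 (\<lambda>(r, s). [[a, b, c], [d, e, f], [g, h, i]] ! r ! s)"

lemma M3_carrier [simp]: "M3 a b c d e f g h i \<in> carrier_mat 3 3"
  by (simp add: M3_def)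

lemma M3_mult: "M3 a b c d e f g h i * M3 a' b' c' d' e' f' g' h' i' =
  M3 (a * a' + b * d' + c * g') (a * b' + b * e' + c * h') (a * c' + b * f' + c * i')
     (d * a' + e * d' + f * g') (d * b' + e * e' + f * h') (d * c' + e * f' + f * i')
     (g * a' + h * d' + i * g') (g * b' + h * e' + i * h') (g * c' + h * f' + i * i')"
  by (rule eq_matI) (auto simp: M3_def scalar_prod_def numeral_3_eq_3 less_Suc_eq)

lemma M3_one: "M3 1 0 0 0 1 0 0 0 1 = 1\<^sub>m 3"
  by (rule eq_matI) (auto simp: M3_def numeral_3_eq_3 less_Suc_eq)

lemma det_2: "A \<in> carrier_mat 2 2 \<Longrightarrow> Determinant.det A = A $$ (0, 0) * A $$ (1, 1) - A $$ (0, 1) * (A $$ (1, 0) :: int)"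
  using laplace_expansion_row[of A 2 0]
  by (auto simp: cofactor_def mat_delete_def numeral_2_eq_2 lessThan_Suc det_single)

lemma det_M3: "Determinant.det (M3 a b c d e f g h i) = a * (e * i - f * h) - b * (d * i - f * g) + c * (d * h - e * g)"
proof -
  have d2: "Determinant.det (mat 2 2 g) = g (0, 0) * g (1, 1) - g (0, 1) * g (1, 0)" for g :: "nat \<times> nat \<Rightarrow> int"
    by (subst det_2) auto
  have "Determinant.det (M3 a b c d e f g h i) = (\<Sum>j<3. M3 a b c d e f g h i $$ (0, j) * cofactor (M3 a b c d e f g h i) 0 j)"
    by (rule laplace_expansion_row) auto
  also have "{..<3 :: nat} = {0, 1, 2}" by auto
  finally show ?thesis by (simp add: cofactor_def mat_delete_def M3_def d2 algebra_simps)
qed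

lemma M3_in_SL: "a * (e * i - f * h) - b * (d * i - f * g) + c * (d * h - e * g) = 1 \<Longrightarrow>
    M3 a b c d e f g h i \<in> carrier (SL_int 3)"
  by (simp add: SL_int_def det_M3)

text \<open>If \<open>A\<close> is a \<open>2 \<times> 2\<close> matrix of determinant \<open>1\<close> and trace \<open>t\<close>, then \<open>A\<^sup>m = powX t m I + powY t m A\<close> by the
theorem of Cayley and Hamilton. Up to sign and index shift these are Chebyshev polynomials of the
second kind in \<open>t / 2\<close>.\<close>

fun powX :: "int \<Rightarrow> nat \<Rightarrow> int" and powY :: "int \<Rightarrow> nat \<Rightarrow> int" where
  "powX t 0 = 1" | "powY t 0 = 0"
| "powX t (Suc m) = - powY t m" | "powY t (Suc m) = powX t m + t * powY t m"

lemma pow_add: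
  "powX t (m + n) = powX t m * powX t n - powY t m * powY t n"
  "powY t (m + n) = powX t m * powY t n + powY t m * powX t n + t * powY t m * powY t n"
  by (induction n) (simp_all add: algebra_simps)

lemma pow_norm: "(powX t m)\<^sup>2 + t * powX t m * powY t m + (powY t m)\<^sup>2 = 1"
  by (induction m) (simp_all add: power2_eq_square algebra_simps)

text \<open>The doubling formulas factor \<open>powY t m\<close> into two numbers modulo which \<open>powX t m\<close> is \<open>1\<close> or \<open>-1\<close>. For
Mennicke symbols this means that the factor \<open>powY t m\<close> of the second entry of \<open>A\<^sup>m\<close> is invisible.\<close>

lemma powY_factors:
  "\<exists>y1 y2 e1 e2. powY t m = y1 * y2 \<and> e1 \<in> {1, - 1} \<and> e2 \<in> {1, - 1} \<and> y1 dvd powX t m - e1 \<and> y2 dvd powX t m - e2"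
proof -
  define k x y where "k = m div 2" and "x = powX t k" and "y = powY t k"
  have nrm: "x\<^sup>2 + t * x * y + y\<^sup>2 = 1" unfolding x_def y_def by (rule pow_norm)
  have X2: "powX t (k + k) = x\<^sup>2 - y\<^sup>2" and Y2: "powY t (k + k) = y * (2 * x + t * y)"
    unfolding pow_add x_def y_def by (simp_all add: power2_eq_square algebra_simps)
  show ?thesis
  proof (cases "even m")
    case True
    then have m: "m = k + k" by (auto simp: k_def)
    have "powX t m - 1 = y * (- t * x - 2 * y)"
      unfolding m X2 using nrm by (simp add: power2_eq_square algebra_simps)
    moreover have "powX t m - (- 1) = (2 * x + t * y) * x"
      unfolding m X2 using nrm by (simp add: power2_eq_square algebra_simps)
    ultimately have "powY t m = y * (2 * x + t * y) \<and> y dvd powX t m - 1 \<and> 2 * x + t * y dvd powX t m - (- 1)"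
      unfolding m Y2 by simp
    then show ?thesis by blast
  next
    case False
    then have m: "m = Suc (k + k)" unfolding k_def by presburger
    have "powX t m - (- 1) = (x + t * y - y) * (x - y)"
      unfolding m powX.simps Y2 using nrm by (simp add: power2_eq_square algebra_simps)
    moreover have "powX t m - 1 = (x + t * y + y) * (- x - y)"
      unfolding m powX.simps Y2 using nrm by (simp add: power2_eq_square algebra_simps)
    moreover have "powY t m = (x + t * y - y) * (x + t * y + y)"
      unfolding m powY.simps X2 Y2 by (simp add: power2_eq_square algebra_simps)
    ultimately have "powY t m = (x + t * y - y) * (x + t * y + y) \<and> x + t * y - y dvd powX t m - (- 1) \<and>
      x + t * y + y dvd powX t m - 1" by simp
    then show ?thesis by blast
  qed
qed

lemma pow_first_entry:
  assumes "a * d - b * c = 1"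
  shows "b dvd powX (a + d) m + powY (a + d) m * a - a ^ m"
proof (induction m)
  case (Suc m)
  let ?X = "powX (a + d) m" and ?Y = "powY (a + d) m"
  have "- ?Y + (?X + (a + d) * ?Y) * a - a ^ Suc m = a * (?X + ?Y * a - a ^ m) + ?Y * (a * d - 1)"
    by (simp add: algebra_simps)
  also have "a * d - 1 = b * c" using assms by simp
  finally show ?case using Suc by simp
qed simp

lemma addrow_mat_in_SL: "i \<noteq> j \<Longrightarrow> addrow_mat n t i j \<in> carrier (SL_int n)"
  by (simp add: SL_int_def det_addrow_mat)

lemma SL_carrier: "A \<in> carrier (SL_int n) \<Longrightarrow> A \<in> carrier_mat n n"
  by (simp add: SL_int_def)

lemma SL_mult: "A \<in> carrier (SL_int n) \<Longrightarrow> B \<in> carrier (SL_int n) \<Longrightarrow> A * B \<in> carrier (SL_int n)"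
  using Determinant.det_mult[of A n B] by (auto simp: SL_int_def)

lemma SL_inverse_ex:
  assumes "A \<in> carrier (SL_int n)"
  obtains B where "B \<in> carrier (SL_int n)" "A * B = 1\<^sub>m n" "B * A = 1\<^sub>m n"
proof -
  interpret group "SL_int n" by (rule group_SL_int)
  show thesis using that[of "inv\<^bsub>SL_int n\<^esub> A"] assms r_inv[OF assms] l_inv[OF assms] inv_closed[OF assms]
    by (simp add: SL_int_def)
qed

text \<open>The length functions to which the theorem of Carter and Keller is applied. All estimates below are
multiples of \<open>K\<close>, with factors that are convenient and not optimal.\<close>

locale SL_length =
  fixes n :: nat and L :: "int mat \<Rightarrow> real" and K :: real
  assumes L_mult: "\<And>A B. A \<in> carrier (SL_int n) \<Longrightarrow> B \<in> carrier (SL_int n) \<Longrightarrow> L (A * B) \<le> L A + L B"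
    and L_inv: "\<And>A B. A \<in> carrier (SL_int n) \<Longrightarrow> B \<in> carrier (SL_int n) \<Longrightarrow> A * B = 1\<^sub>m n \<Longrightarrow> L A = L B"
    and L_elem: "\<And>i j t. i < n \<Longrightarrow> j < n \<Longrightarrow> i \<noteq> j \<Longrightarrow> L (addrow_mat n t i j) \<le> K"
begin

lemma L_cancel:
  assumes A: "A \<in> carrier (SL_int n)" and B: "B \<in> carrier (SL_int n)"
  shows "L A \<le> L (A * B) + L B" "L B \<le> L A + L (A * B)"
proof -
  obtain B' where B': "B' \<in> carrier (SL_int n)" "B * B' = 1\<^sub>m n" using SL_inverse_ex[OF B] by blast
  have "A * B * B' = A * (B * B')"
    by (rule assoc_mult_mat) (use SL_carrier A B B' in blast)+
  then have "A * B * B' = A" using SL_carrier[OF A] by (simp add: B'(2))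
  then show "L A \<le> L (A * B) + L B"
    using L_mult[OF SL_mult[OF A B] B'(1)] L_inv[OF B B'] by simp
  obtain A' where A': "A' \<in> carrier (SL_int n)" "A' * A = 1\<^sub>m n" using SL_inverse_ex[OF A] by blast
  have "A' * (A * B) = A' * A * B"
    by (rule assoc_mult_mat[symmetric]) (use SL_carrier A B A' in blast)+
  then have "A' * (A * B) = B" using SL_carrier[OF B] by (simp add: A'(2))
  then show "L B \<le> L A + L (A * B)"
    using L_mult[OF A'(1) SL_mult[OF A B]] L_inv[OF A'(1) A A'(2)] by simp
qed

end

locale SL3_length = SL_length 3 L K for L :: "int mat \<Rightarrow> real" and K :: real
begin

lemma L_E:
  "L (M3 1 t 0 0 1 0 0 0 1) \<le> K" "L (M3 1 0 t 0 1 0 0 0 1) \<le> K" "L (M3 1 0 0 t 1 0 0 0 1) \<le> K"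
  "L (M3 1 0 0 0 1 t 0 0 1) \<le> K" "L (M3 1 0 0 0 1 0 t 0 1) \<le> K" "L (M3 1 0 0 0 1 0 0 t 1) \<le> K"
proof -
  have "M3 1 t 0 0 1 0 0 0 1 = addrow_mat 3 t 0 1" "M3 1 0 t 0 1 0 0 0 1 = addrow_mat 3 t 0 2"
    "M3 1 0 0 t 1 0 0 0 1 = addrow_mat 3 t 1 0" "M3 1 0 0 0 1 t 0 0 1 = addrow_mat 3 t 1 2"
    "M3 1 0 0 0 1 0 t 0 1 = addrow_mat 3 t 2 0" "M3 1 0 0 0 1 0 0 t 1 = addrow_mat 3 t 2 1"
    by (rule eq_matI; auto simp: M3_def addrow_mat_def numeral_3_eq_3 numeral_2_eq_2 less_Suc_eq)+
  then show "L (M3 1 t 0 0 1 0 0 0 1) \<le> K" "L (M3 1 0 t 0 1 0 0 0 1) \<le> K" "L (M3 1 0 0 t 1 0 0 0 1) \<le> K"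
    "L (M3 1 0 0 0 1 t 0 0 1) \<le> K" "L (M3 1 0 0 0 1 0 t 0 1) \<le> K" "L (M3 1 0 0 0 1 0 0 t 1) \<le> K"
    by (simp_all add: L_elem)
qed

lemma L_M3_mult:
  assumes "M3 a b c d e f g h i * M3 a' b' c' d' e' f' g' h' i' = C"
    and "a * (e * i - f * h) - b * (d * i - f * g) + c * (d * h - e * g) = 1"
    and "a' * (e' * i' - f' * h') - b' * (d' * i' - f' * g') + c' * (d' * h' - e' * g') = 1"
  shows "L C \<le> L (M3 a b c d e f g h i) + L (M3 a' b' c' d' e' f' g' h' i')"
  using L_mult[OF M3_in_SL[OF assms(2)] M3_in_SL[OF assms(3)]] assms(1) by simp

lemma L_M3_cancel:
  assumes "M3 a b c d e f g h i * M3 a' b' c' d' e' f' g' h' i' = C"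
    and "a * (e * i - f * h) - b * (d * i - f * g) + c * (d * h - e * g) = 1"
    and "a' * (e' * i' - f' * h') - b' * (d' * i' - f' * g') + c' * (d' * h' - e' * g') = 1"
  shows "L (M3 a b c d e f g h i) \<le> L C + L (M3 a' b' c' d' e' f' g' h' i')"
    and "L (M3 a' b' c' d' e' f' g' h' i') \<le> L (M3 a b c d e f g h i) + L C"
  using L_cancel[OF M3_in_SL[OF assms(2)] M3_in_SL[OF assms(3)]] unfolding assms(1) by simp_all

lemma K_nonneg: "K \<ge> 0"
proof -
  have "L (M3 1 1 0 0 1 0 0 0 1) \<le> L (M3 1 1 0 0 1 0 0 0 1) + L (M3 1 0 0 0 1 0 0 0 1)"
    by (rule L_M3_mult) (simp_all add: M3_mult)
  then show ?thesis using L_E(1)[of 0] by linarith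
qed

text \<open>The length of a \<open>2 \<times> 2\<close> matrix in the upper left corner of a \<open>3 \<times> 3\<close> matrix.\<close>

definition len2 :: "int \<Rightarrow> int \<Rightarrow> int \<Rightarrow> int \<Rightarrow> real" where
  "len2 a b c d = L (M3 a b 0 c d 0 0 0 1)"

lemma len2_col2: "a * d - b * c = 1 \<Longrightarrow> len2 a (b + t * a) c (d + t * c) \<le> len2 a b c d + K"
  using L_M3_mult[of a b 0 c d 0 0 0 1 1 t 0 0 1 0 0 0 1, OF M3_mult] L_E(1)[of t]
  by (simp add: len2_def algebra_simps)

lemma len2_col1: "a * d - b * c = 1 \<Longrightarrow> len2 (a + t * b) b (c + t * d) d \<le> len2 a b c d + K"
  using L_M3_mult[of a b 0 c d 0 0 0 1 1 0 0 t 1 0 0 0 1, OF M3_mult] L_E(3)[of t]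
  by (simp add: len2_def algebra_simps)

lemma len2_row2: "a * d - b * c = 1 \<Longrightarrow> len2 a b (c + t * a) (d + t * b) \<le> len2 a b c d + K"
  using L_M3_mult[of 1 0 0 t 1 0 0 0 1 a b 0 c d 0 0 0 1, OF M3_mult] L_E(3)[of t]
  by (simp add: len2_def algebra_simps)

lemma len2_row1: "a * d - b * c = 1 \<Longrightarrow> len2 (a + t * c) (b + t * d) c d \<le> len2 a b c d + K"
  using L_M3_mult[of 1 t 0 0 1 0 0 0 1 a b 0 c d 0 0 0 1, OF M3_mult] L_E(1)[of t]
  by (simp add: len2_def algebra_simps)

lemma len2_mult:
  assumes "a * d - b * c = 1" "a' * d' - b' * c' = 1"
  shows "len2 (a * a' + b * c') (a * b' + b * d') (c * a' + d * c') (c * b' + d * d') \<le> len2 a b c d + len2 a' b' c' d'"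
  using L_M3_mult[of a b 0 c d 0 0 0 1 a' b' 0 c' d' 0 0 0 1, OF M3_mult] assms by (simp add: len2_def)

lemma len2_inverse: "a * d - b * c = 1 \<Longrightarrow> len2 d (- b) (- c) a = len2 a b c d"
  unfolding len2_def
  by (rule L_inv) (simp_all add: M3_in_SL M3_mult M3_one[symmetric] algebra_simps)

lemma len2_one: "len2 1 0 0 1 \<le> K" using L_E(1)[of 0] by (simp add: len2_def)

lemma len2_J: "len2 0 1 (- 1) 0 \<le> 3 * K" "len2 0 (- 1) 1 0 \<le> 3 * K"
proof -
  have "len2 1 1 0 1 \<le> K" "len2 1 (- 1) 0 1 \<le> K" using L_E(1) by (simp_all add: len2_def)
  moreover have "len2 1 (- 1) 1 0 \<le> len2 1 (- 1) 0 1 + K" using len2_row2[of 1 1 "- 1" 0 1] by simp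
  moreover have "len2 1 1 (- 1) 0 \<le> len2 1 1 0 1 + K" using len2_row2[of 1 1 1 0 "- 1"] by simp
  moreover have "len2 0 1 (- 1) 0 \<le> len2 1 1 (- 1) 0 + K" using len2_row1[of 1 0 1 "- 1" 1] by simp
  moreover have "len2 0 (- 1) 1 0 \<le> len2 1 (- 1) 1 0 + K" using len2_row1[of 1 0 "- 1" 1 "- 1"] by simp
  ultimately show "len2 0 1 (- 1) 0 \<le> 3 * K" "len2 0 (- 1) 1 0 \<le> 3 * K" by linarith+
qed

text \<open>In \<open>SL(2, Z)\<close> the inverse of the transpose is the conjugate by the rotation \<open>[[0, 1], [-1, 0]]\<close>.\<close>

lemma len2_inverse_transpose:
  assumes det: "a * d - b * c = 1"
  shows "len2 d (- c) (- b) a \<le> len2 a b c d + 6 * K"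
proof -
  have "len2 c d (- a) (- b) \<le> len2 0 1 (- 1) 0 + len2 a b c d"
    using len2_mult[of 0 0 1 "- 1" a d b c] det by simp
  moreover have "len2 d (- c) (- b) a \<le> len2 c d (- a) (- b) + len2 0 (- 1) 1 0"
    using len2_mult[of c "- b" d "- a" 0 0 "- 1" 1] det by (simp add: algebra_simps)
  ultimately show ?thesis using len2_J by linarith
qed

lemma len2_transpose: "a * d - b * c = 1 \<Longrightarrow> len2 a c b d \<le> len2 a b c d + 6 * K"
  using len2_inverse_transpose[of d a "- b" "- c"] len2_inverse[of a d b c] by (simp add: mult.commute)

lemma len2_same_row:
  assumes "a * d - b * c = 1" "a * d' - b * c' = 1"
  shows "len2 a b c' d' \<le> len2 a b c d + K"
proof -
  \<comment> \<open>Two matrices of determinant \<open>1\<close> with the same first row differ by this multiple of it in the second row.\<close>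
  define t where "t = d * c' - c * d'"
  have "c + t * a = c + a * d * c' - c * (a * d')" by (simp add: t_def algebra_simps)
  also have "\<dots> = c'" using assms by (simp add: algebra_simps)
  finally have c: "c + t * a = c'" .
  have "d + t * b = d + d * (b * c') - (b * c) * d'" by (simp add: t_def algebra_simps)
  also have "b * c' = a * d' - 1" using assms by simp
  also have "b * c = a * d - 1" using assms by simp
  also have "d + d * (a * d' - 1) - (a * d - 1) * d' = d'" by (simp add: algebra_simps)
  finally have d: "d + t * b = d'" .
  show ?thesis using len2_row2[OF assms(1), of t] unfolding c d .
qed

lemma len2_congruent_row:
  assumes "a * d - b * c = 1" "a' * d' - b * c' = 1" "b dvd a' - a"
  shows "len2 a' b c' d' \<le> len2 a b c d + 2 * K"
proof -
  obtain t where t: "a' - a = b * t" using assms(3) ..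
  then have a': "a' = a + t * b" by (simp add: algebra_simps)
  have "a' * d - b * (c + t * d) = 1" using assms(1) by (simp add: a' algebra_simps)
  then have "len2 a' b c' d' \<le> len2 a' b (c + t * d) d + K" using assms(2) by (rule len2_same_row)
  then show ?thesis using len2_col1[OF assms(1), of t] unfolding a' by linarith
qed

lemma len2_trivial:
  assumes det: "a * d - b * c = 1" and e: "e \<in> {1, - 1}" and dvd: "b dvd a - e"
  shows "len2 a b c d \<le> 9 * K"
proof -
  have e2: "e * e = 1" using e by auto
  have "len2 a b c d \<le> len2 e b 0 e + 2 * K"
    by (rule len2_congruent_row) (use det dvd e2 in auto)
  also have "len2 e b 0 e \<le> len2 e 0 0 e + K"
    using len2_col2[of e e 0 0 "b * e"] e2 by (simp add: mult.assoc)
  also have "len2 e 0 0 e \<le> 6 * K"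
    using e len2_one len2_mult[of 0 0 1 "- 1" 0 0 1 "- 1"] len2_J K_nonneg by auto
  finally show ?thesis by simp
qed

lemma L_swap: "L (M3 1 0 0 0 0 1 0 (- 1) 0) \<le> 3 * K"
proof -
  have "L (M3 1 0 0 0 0 1 0 (- 1) 1) \<le> L (M3 1 0 0 0 1 1 0 0 1) + L (M3 1 0 0 0 1 0 0 (- 1) 1)"
    by (rule L_M3_mult) (simp_all add: M3_mult)
  moreover have "L (M3 1 0 0 0 0 1 0 (- 1) 0) \<le> L (M3 1 0 0 0 0 1 0 (- 1) 1) + L (M3 1 0 0 0 1 1 0 0 1)"
    by (rule L_M3_mult) (simp_all add: M3_mult)
  ultimately show ?thesis using L_E(4)[of 1] L_E(6)[of "- 1"] by linarith
qed

text \<open>Conjugation by the signed exchange of the last two coordinates.\<close>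

lemma L_block13:
  assumes "a * d - b * c = 1"
  shows "L (M3 a 0 b 0 1 0 c 0 d) \<le> len2 a b c d + 6 * K"
proof -
  have "L (M3 a 0 b c 0 d 0 (- 1) 0) \<le> len2 a b c d + L (M3 1 0 0 0 0 1 0 (- 1) 0)"
    unfolding len2_def by (rule L_M3_mult) (use assms in \<open>simp_all add: M3_mult\<close>)
  moreover have "L (M3 a 0 b 0 1 0 c 0 d) \<le> L (M3 1 0 0 0 0 1 0 (- 1) 0) + L (M3 a 0 b c 0 d 0 (- 1) 0)"
    by (rule L_M3_cancel(2)) (use assms in \<open>simp_all add: M3_mult algebra_simps\<close>)
  ultimately show ?thesis using L_swap by linarith
qed

text \<open>Conjugation by a signed cyclic permutation of the coordinates, in both directions.\<close>

lemma L_block23: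
  assumes "a * d - b * c = 1"
  shows "L (M3 1 0 0 0 a b 0 c d) \<le> len2 a b c d + 12 * K" "len2 a b c d \<le> L (M3 1 0 0 0 a b 0 c d) + 12 * K"
proof -
  let ?R = "M3 0 0 1 (- 1) 0 0 0 (- 1) 0" and ?Q = "M3 0 0 1 (- a) (- b) 0 (- c) (- d) 0"
  have "L ?R \<le> len2 0 1 (- 1) 0 + L (M3 1 0 0 0 0 1 0 (- 1) 0)"
    unfolding len2_def by (rule L_M3_mult) (simp_all add: M3_mult)
  then have R: "L ?R \<le> 6 * K" using L_swap len2_J by linarith
  have "L ?Q \<le> L ?R + len2 a b c d" "len2 a b c d \<le> L ?R + L ?Q"
    unfolding len2_def by (rule L_M3_mult L_M3_cancel(2); use assms in \<open>simp add: M3_mult\<close>)+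
  moreover have "L ?Q \<le> L (M3 1 0 0 0 a b 0 c d) + L ?R" "L (M3 1 0 0 0 a b 0 c d) \<le> L ?Q + L ?R"
    by (rule L_M3_mult L_M3_cancel(1); use assms in \<open>simp add: M3_mult\<close>)+
  ultimately show "L (M3 1 0 0 0 a b 0 c d) \<le> len2 a b c d + 12 * K" "len2 a b c d \<le> L (M3 1 0 0 0 a b 0 c d) + 12 * K"
    using R by linarith+
qed

text \<open>Three elementary column operations turn the first row \<open>(a, b\<^sub>1 b\<^sub>2, 0)\<close> into \<open>(a, 0, b\<^sub>1)\<close>: since
\<open>b\<^sub>1 = b\<^sub>1 (a d\<^sub>2 - b\<^sub>2 c\<^sub>2)\<close>, the entry \<open>b\<^sub>1\<close> can be created in the third column, and then it removes
\<open>b\<^sub>1 b\<^sub>2\<close> from the second. Splitting off the matrix with first row \<open>(a, b\<^sub>1)\<close>, placed in coordinates \<open>1\<close>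
and \<open>3\<close>, leaves a matrix whose block in coordinates \<open>2\<close> and \<open>3\<close> is the inverse transpose of the matrix with
first row \<open>(a, b\<^sub>2)\<close>.\<close>

lemma mennicke:
  assumes det: "a * y - b1 * b2 * x = 1" and det1: "a * d1 - b1 * c1 = 1" and det2: "a * d2 - b2 * c2 = 1"
  shows "len2 a (b1 * b2) x y \<le> len2 a b1 c1 d1 + len2 a b2 c2 d2 + 30 * K"
    and "len2 a b2 c2 d2 \<le> len2 a (b1 * b2) x y + len2 a b1 c1 d1 + 30 * K"
proof -
  define w where "w = b1 * d2 * x - c2 * y"
  define v where "v = x * d1 - w * c1"
  have "b1 * d2 * a - b1 * b2 * c2 = b1 * (a * d2 - b2 * c2)" by (simp add: algebra_simps)
  then have 1: "b1 * d2 * a - b1 * b2 * c2 = b1" unfolding det2 by simp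
  have "y - b2 * w = y * (1 + b2 * c2) - (b1 * b2 * x) * d2" by (simp add: w_def algebra_simps)
  also have "1 + b2 * c2 = a * d2" using det2 by simp
  also have "b1 * b2 * x = a * y - 1" using det by simp
  also have "y * (a * d2) - (a * y - 1) * d2 = d2" by (simp add: algebra_simps)
  finally have 2: "y - b2 * w = d2" .
  have "a * w - x * b1 = (a * d2) * (b1 * x) - c2 * (a * y) - x * b1" by (simp add: w_def algebra_simps)
  also have "a * d2 = 1 + b2 * c2" using det2 by simp
  also have "a * y = 1 + b1 * b2 * x" using det by simp
  also have "(1 + b2 * c2) * (b1 * x) - c2 * (1 + b1 * b2 * x) - x * b1 = - c2" by (simp add: algebra_simps)
  finally have 3: "a * w - x * b1 = - c2" .
  have detB: "d2 * a - (- c2) * (- b2) = 1" using det2 by (simp add: mult.commute)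
  let ?M0 = "M3 a (b1 * b2) 0 x y 0 0 0 1"
  let ?M1 = "M3 a (b1 * b2) b1 x y w 0 0 1"
  let ?M2 = "M3 a 0 b1 x d2 w 0 (- b2) 1"
  let ?Z = "M3 1 0 0 v d2 (- c2) (- c1) (- b2) a"
  let ?T = "M3 a 0 b1 0 1 0 c1 0 d1"
  let ?B = "M3 1 0 0 0 d2 (- c2) 0 (- b2) a"
  let ?N = "M3 1 0 0 v 1 0 (- c1) 0 1"
  let ?E1 = "M3 1 0 (b1 * d2) 0 1 (- c2) 0 0 1" and ?E2 = "M3 1 0 0 0 1 0 0 (- b2) 1"
  have "L ?N \<le> L (M3 1 0 0 v 1 0 0 0 1) + L (M3 1 0 0 0 1 0 (- c1) 0 1)"
    by (rule L_M3_mult) (simp_all add: M3_mult)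
  then have LN: "L ?N \<le> 2 * K" using L_E(3)[of v] L_E(5)[of "- c1"] by linarith
  have "L ?E1 \<le> L (M3 1 0 (b1 * d2) 0 1 0 0 0 1) + L (M3 1 0 0 0 1 (- c2) 0 0 1)"
    by (rule L_M3_mult) (simp_all add: M3_mult)
  then have LE1: "L ?E1 \<le> 2 * K" using L_E(2)[of "b1 * d2"] L_E(4)[of "- c2"] by linarith
  have dM1: "a * (y * 1 - w * 0) - b1 * b2 * (x * 1 - w * 0) + b1 * (x * 0 - y * 0) = 1" using det by simp
  have dZ: "1 * (d2 * a - (- c2) * (- b2)) - 0 * (v * a - (- c2) * (- c1)) + 0 * (v * (- b2) - d2 * (- c1)) = 1"
    using detB by simp
  have "v * a - c2 * c1 = x * (a * d1) - c1 * (a * w) - c2 * c1" by (simp add: v_def algebra_simps)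
  also have "a * d1 = 1 + b1 * c1" using det1 by simp
  also have "a * w = x * b1 - c2" using 3 by simp
  finally have 4: "v * a - c2 * c1 = x" by (simp add: algebra_simps)
  have "v * b1 - c2 * d1 = (x * b1 - c2) * d1 - w * (b1 * c1)" by (simp add: v_def algebra_simps)
  also have "x * b1 - c2 = a * w" using 3 by simp
  also have "b1 * c1 = a * d1 - 1" using det1 by simp
  finally have 5: "v * b1 - c2 * d1 = w" by (simp add: algebra_simps)
  have ME1: "?M0 * ?E1 = ?M1" using 1 by (simp add: M3_mult w_def algebra_simps)
  have ME2: "?M1 * ?E2 = ?M2" using 2 by (simp add: M3_mult algebra_simps)
  have ZT: "?Z * ?T = ?M2" using det1 4 5 by (simp add: M3_mult algebra_simps)
  have NB: "?N * ?B = ?Z" by (simp add: M3_mult)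
  have dT: "a * (1 * d1 - 0 * 0) - 0 * (0 * d1 - 0 * c1) + b1 * (0 * 0 - 1 * c1) = 1" using det1 by simp
  have "L ?M1 \<le> L ?M0 + L ?E1" "L ?M0 \<le> L ?M1 + L ?E1"
    by (rule L_M3_mult[OF ME1] L_M3_cancel(1)[OF ME1]; use det in simp)+
  moreover have "L ?M2 \<le> L ?M1 + L ?E2" "L ?M1 \<le> L ?M2 + L ?E2"
    by (rule L_M3_mult[OF ME2 dM1] L_M3_cancel(1)[OF ME2 dM1]; simp)+
  moreover have "L ?M2 \<le> L ?Z + L ?T" "L ?Z \<le> L ?M2 + L ?T"
    by (rule L_M3_mult[OF ZT dZ dT] L_M3_cancel(1)[OF ZT dZ dT])+
  moreover have "L ?Z \<le> L ?N + L ?B" "L ?B \<le> L ?N + L ?Z"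
    by (rule L_M3_mult[OF NB] L_M3_cancel(2)[OF NB]; use detB in simp)+
  moreover note L_block13[OF det1] L_block23[OF detB] len2_inverse_transpose[OF det2]
  moreover have "len2 a b2 c2 d2 \<le> len2 d2 (- c2) (- b2) a + 6 * K" using len2_inverse_transpose[OF detB] by simp
  ultimately show "len2 a (b1 * b2) x y \<le> len2 a b1 c1 d1 + len2 a b2 c2 d2 + 30 * K"
    and "len2 a b2 c2 d2 \<le> len2 a (b1 * b2) x y + len2 a b1 c1 d1 + 30 * K"
    using LN LE1 L_E(6)[of "- b2"] K_nonneg unfolding len2_def[of a "b1 * b2"] by linarith+
qed

text \<open>Factors of the second entry modulo which the first entry is \<open>1\<close> or \<open>-1\<close> may be dropped.\<close>

lemma len2_split:
  assumes det: "\<alpha> * \<delta> - y1 * (y2 * b) * \<gamma> = 1"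
    and e: "e1 \<in> {1, - 1}" "e2 \<in> {1, - 1}" and dvd: "y1 dvd \<alpha> - e1" "y2 dvd \<alpha> - e2"
  shows "len2 \<alpha> (y1 * (y2 * b)) \<gamma> \<delta> \<le> len2 \<alpha> b (y1 * y2 * \<gamma>) \<delta> + 78 * K"
    and "len2 \<alpha> b (y1 * y2 * \<gamma>) \<delta> \<le> len2 \<alpha> (y1 * (y2 * b)) \<gamma> \<delta> + 78 * K"
proof -
  have det1: "\<alpha> * \<delta> - y1 * (y2 * b * \<gamma>) = 1" and det2: "\<alpha> * \<delta> - (y2 * b) * (y1 * \<gamma>) = 1"
    and det3: "\<alpha> * \<delta> - y2 * (b * (y1 * \<gamma>)) = 1" and det4: "\<alpha> * \<delta> - b * (y1 * y2 * \<gamma>) = 1"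
    using det by (simp_all add: mult_ac)
  note M = mennicke[OF det det1 det2] mennicke[OF det2 det3 det4]
  have "len2 \<alpha> y1 (y2 * b * \<gamma>) \<delta> \<le> 9 * K" by (rule len2_trivial[OF det1 e(1) dvd(1)])
  moreover have "len2 \<alpha> y2 (b * (y1 * \<gamma>)) \<delta> \<le> 9 * K" by (rule len2_trivial[OF det3 e(2) dvd(2)])
  ultimately show "len2 \<alpha> (y1 * (y2 * b)) \<gamma> \<delta> \<le> len2 \<alpha> b (y1 * y2 * \<gamma>) \<delta> + 78 * K"
    and "len2 \<alpha> b (y1 * y2 * \<gamma>) \<delta> \<le> len2 \<alpha> (y1 * (y2 * b)) \<gamma> \<delta> + 78 * K"
    using M by linarith+
qed

text \<open>The length of the \<open>m\<close>-th power of the matrix \<open>[[a, b], [c, d]]\<close>.\<close>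

definition pow_len :: "int \<Rightarrow> int \<Rightarrow> int \<Rightarrow> int \<Rightarrow> nat \<Rightarrow> real" where
  "pow_len a b c d m = len2 (powX (a + d) m + powY (a + d) m * a) (powY (a + d) m * b)
     (powY (a + d) m * c) (powX (a + d) m + powY (a + d) m * d)"

lemma pow_det:
  assumes "a * d - b * c = 1"
  shows "(powX (a + d) m + powY (a + d) m * a) * (powX (a + d) m + powY (a + d) m * d)
    - (powY (a + d) m * b) * (powY (a + d) m * c) = 1"
proof -
  let ?X = "powX (a + d) m" and ?Y = "powY (a + d) m"
  have "(?X + ?Y * a) * (?X + ?Y * d) - (?Y * b) * (?Y * c) =
      ?X\<^sup>2 + (a + d) * ?X * ?Y + ?Y\<^sup>2 * (a * d - b * c)"
    by (simp add: power2_eq_square algebra_simps)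
  then show ?thesis using pow_norm[of "a + d" m] assms by simp
qed

text \<open>A matrix is the quotient of two consecutive powers of itself.\<close>

lemma pow_len_diff:
  assumes det: "a * d - b * c = 1"
  shows "len2 a b c d \<le> pow_len a b c d (Suc k) + pow_len a b c d k"
proof -
  have bc: "b * c = a * d - 1" using det by simp
  let ?X = "powX (a + d) k" and ?Y = "powY (a + d) k"
  have "a * (?X + ?Y * a) + b * (?Y * c) = a * ?X + ?Y * (a * a + b * c)"
    "c * (?Y * b) + d * (?X + ?Y * d) = d * ?X + ?Y * (b * c + d * d)"
    by (simp_all add: algebra_simps)
  then have 1: "a * (?X + ?Y * a) + b * (?Y * c) = powX (a + d) (Suc k) + powY (a + d) (Suc k) * a"
    and 2: "c * (?Y * b) + d * (?X + ?Y * d) = powX (a + d) (Suc k) + powY (a + d) (Suc k) * d"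
    unfolding bc by (simp_all add: algebra_simps)
  have 3: "a * (?Y * b) + b * (?X + ?Y * d) = powY (a + d) (Suc k) * b"
    and 4: "c * (?X + ?Y * a) + d * (?Y * c) = powY (a + d) (Suc k) * c"
    by (simp_all add: algebra_simps)
  show ?thesis unfolding pow_len_def len2_def
    by (rule L_M3_cancel(1))
      (use det pow_det[OF det, of k] in \<open>simp_all add: M3_mult 1 2 3 4 del: powX.simps powY.simps\<close>)
qed

lemma pow_len_row:
  fixes a b c d :: int and m :: nat
  assumes det: "a * d - b * c = 1"
  defines "\<alpha> \<equiv> powX (a + d) m + powY (a + d) m * a" and "\<delta> \<equiv> powX (a + d) m + powY (a + d) m * d"
  shows "pow_len a b c d m \<le> len2 \<alpha> b (powY (a + d) m * (powY (a + d) m * c)) \<delta> + 78 * K"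
    and "len2 \<alpha> b (powY (a + d) m * (powY (a + d) m * c)) \<delta> \<le> pow_len a b c d m + 78 * K"
proof -
  obtain y1 y2 e1 e2 where y: "powY (a + d) m = y1 * y2" and e: "e1 \<in> {1, - 1}" "e2 \<in> {1, - 1}"
    and dvd: "y1 dvd powX (a + d) m - e1" "y2 dvd powX (a + d) m - e2"
    using powY_factors by blast
  have "\<alpha> - e1 = (powX (a + d) m - e1) + y1 * (y2 * a)" "\<alpha> - e2 = (powX (a + d) m - e2) + y2 * (y1 * a)"
    by (simp_all add: \<alpha>_def y)
  then have dvd': "y1 dvd \<alpha> - e1" "y2 dvd \<alpha> - e2"
    using dvd by (simp_all only: dvd_add dvd_triv_left)
  have det': "\<alpha> * \<delta> - y1 * (y2 * b) * (powY (a + d) m * c) = 1"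
    using pow_det[OF det, of m] unfolding \<alpha>_def \<delta>_def y by (simp add: mult.assoc)
  have eq: "pow_len a b c d m = len2 \<alpha> (y1 * (y2 * b)) (powY (a + d) m * c) \<delta>"
    by (simp add: pow_len_def \<alpha>_def \<delta>_def y mult.assoc)
  show "pow_len a b c d m \<le> len2 \<alpha> b (powY (a + d) m * (powY (a + d) m * c)) \<delta> + 78 * K"
    and "len2 \<alpha> b (powY (a + d) m * (powY (a + d) m * c)) \<delta> \<le> pow_len a b c d m + 78 * K"
    using len2_split[OF det' e dvd'] unfolding eq by (simp_all add: y)
qed

lemma pow_len_bounded:
  assumes det: "a * d - b * c = 1" and e: "e \<in> {1, - 1}" and dvd: "b dvd a ^ m - e"
  shows "pow_len a b c d m \<le> 87 * K"
proof -
  let ?\<alpha> = "powX (a + d) m + powY (a + d) m * a" and ?\<delta> = "powX (a + d) m + powY (a + d) m * d"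
  have "?\<alpha> - e = (?\<alpha> - a ^ m) + (a ^ m - e)" by simp
  then have "b dvd ?\<alpha> - e" using pow_first_entry[OF det, of m] dvd by (metis dvd_add)
  moreover have "?\<alpha> * ?\<delta> - b * (powY (a + d) m * (powY (a + d) m * c)) = 1"
    using pow_det[OF det, of m] by (simp add: mult_ac)
  ultimately have "len2 ?\<alpha> b (powY (a + d) m * (powY (a + d) m * c)) ?\<delta> \<le> 9 * K"
    using len2_trivial e by blast
  then show ?thesis using pow_len_row(1)[OF det, of m] by linarith
qed

lemma pow_len_transpose:
  assumes det: "a * d - b * c = 1"
  shows "pow_len a b c d m \<le> pow_len a c b d m + 6 * K"
  using len2_transpose[OF pow_det[of a d c b m]] det unfolding pow_len_def by (simp add: mult.commute)

text \<open>Read from the first column, the lengths of powers depend only on \<open>a\<close> and \<open>c\<close>, up to a bounded error.\<close>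

lemma pow_len_same_column:
  assumes det: "a * d - b * c = 1" and det': "a * d' - b' * c = 1"
  shows "pow_len a b c d m \<le> pow_len a b' c d' m + 170 * K"
proof -
  let ?\<alpha> = "powX (a + d) m + powY (a + d) m * a" and ?\<delta> = "powX (a + d) m + powY (a + d) m * d"
  let ?\<alpha>' = "powX (a + d') m + powY (a + d') m * a" and ?\<delta>' = "powX (a + d') m + powY (a + d') m * d'"
  let ?\<gamma> = "powY (a + d) m * (powY (a + d) m * b)" and ?\<gamma>' = "powY (a + d') m * (powY (a + d') m * b')"
  have dt: "a * d - c * b = 1" "a * d' - c * b' = 1" using det det' by (simp_all add: mult.commute)
  have dets: "?\<alpha> * ?\<delta> - c * ?\<gamma> = 1" "?\<alpha>' * ?\<delta>' - c * ?\<gamma>' = 1"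
    using pow_det[OF dt(1), of m] pow_det[OF dt(2), of m] by (simp_all add: mult_ac)
  have "?\<alpha> - ?\<alpha>' = (?\<alpha> - a ^ m) - (?\<alpha>' - a ^ m)" by simp
  then have "c dvd ?\<alpha> - ?\<alpha>'"
    using pow_first_entry[OF dt(1), of m] pow_first_entry[OF dt(2), of m] by (metis dvd_diff)
  then have "len2 ?\<alpha> c ?\<gamma> ?\<delta> \<le> len2 ?\<alpha>' c ?\<gamma>' ?\<delta>' + 2 * K" by (rule len2_congruent_row[OF dets(2,1)])
  moreover note pow_len_transpose[OF det, of m] pow_len_transpose[OF dt(2), of m] pow_len_row(1)[OF dt(1), of m] pow_len_row(2)[OF dt(2), of m]
  ultimately show ?thesis by linarith
qed

end

context SL3_length
begin

text \<open>Up to bounded errors \<open>a\<close> may be changed modulo \<open>b\<close>, and then \<open>b\<close> modulo \<open>a\<close>, so that the primes of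
\<open>coprime_exponents\<close> apply. One exponent is good for the row \<open>(A, p)\<close>, the other for the row
\<open>(A, q)\<close>; the two matrices share their first column, so both consecutive powers of the first one are short.\<close>

lemma len2_bounded:
  assumes det: "a * d - b * c = 1"
  shows "len2 a b c d \<le> 350 * K"
proof (cases "b = 0 \<or> b = 1")
  case True
  have "\<exists>e\<in>{1, - 1}. b dvd a - e"
  proof (cases "b = 0")
    case True
    then have "a * d = 1" using det by simp
    then have "a = 1 \<or> a = - 1" by (auto simp: zmult_eq_1_iff)
    then show ?thesis using True by auto
  qed (use \<open>b = 0 \<or> b = 1\<close> in auto)
  then have "len2 a b c d \<le> 9 * K" using len2_trivial[OF det] by blast
  then show ?thesis using K_nonneg by linarith
next
  case False
  have cop: "coprime a b"
  proof (rule coprimeI)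
    fix g assume "g dvd a" "g dvd b"
    then have "g dvd a * d - b * c" by simp
    then show "is_unit g" using det by simp
  qed
  obtain A p q k e where A: "[int A = a] (mod b)" and p: "[int p = b] (mod int A)" and q: "[int q = b] (mod int A)"
    and e: "e \<in> {1, - 1}" "int p dvd int A ^ Suc k - e" "int q dvd int A ^ k - 1"
    by (rule coprime_exponents[OF cop]) (use False in auto)
  obtain t where t: "int A - a = b * t" using A by (auto simp: cong_iff_dvd_diff elim: dvdE)
  obtain t2 where t2: "int p - b = int A * t2" using p by (auto simp: cong_iff_dvd_diff elim: dvdE)
  obtain t3 where t3: "int q - b = int A * t3" using q by (auto simp: cong_iff_dvd_diff elim: dvdE)
  have A': "int A = a + b * t" and p': "int p = b + int A * t2" and q': "int q = b + int A * t3"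
    using t t2 t3 by simp_all
  let ?c = "c + t * d"
  have detA: "int A * d - b * ?c = 1" using det by (simp add: A' algebra_simps)
  have detp: "int A * (d + t2 * ?c) - int p * ?c = 1"
  proof -
    have "int A * (d + t2 * ?c) - int p * ?c = int A * d - b * ?c" by (simp add: p' distrib_left distrib_right)
    then show ?thesis using detA by simp
  qed
  have detq: "int A * (d + t3 * ?c) - int q * ?c = 1"
  proof -
    have "int A * (d + t3 * ?c) - int q * ?c = int A * d - b * ?c" by (simp add: q' distrib_left distrib_right)
    then show ?thesis using detA by simp
  qed
  have "len2 a b c d \<le> len2 (int A) b ?c d + 2 * K"
    by (rule len2_congruent_row[OF detA det]) (simp add: A')
  also have "len2 (int A) b ?c d \<le> len2 (int A) (int p) ?c (d + t2 * ?c) + K"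
    using len2_col2[OF detp, of "- t2"] by (simp add: p' mult.commute)
  also have "len2 (int A) (int p) ?c (d + t2 * ?c) \<le>
      pow_len (int A) (int p) ?c (d + t2 * ?c) (Suc k) + pow_len (int A) (int p) ?c (d + t2 * ?c) k"
    by (rule pow_len_diff[OF detp])
  also have "pow_len (int A) (int p) ?c (d + t2 * ?c) (Suc k) \<le> 87 * K" by (rule pow_len_bounded[OF detp e(1,2)])
  also have "pow_len (int A) (int p) ?c (d + t2 * ?c) k \<le> pow_len (int A) (int q) ?c (d + t3 * ?c) k + 170 * K"
    by (rule pow_len_same_column[OF detp detq])
  also have "pow_len (int A) (int q) ?c (d + t3 * ?c) k \<le> 87 * K"
    by (rule pow_len_bounded[OF detq _ e(3)]) simp
  finally show ?thesis using K_nonneg by simp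
qed

end

section \<open>Reduction from SL(n, Z) to SL(2, Z)\<close>

text \<open>If \<open>g \<noteq> 0\<close>, a suitable \<open>t\<close> is the product of the primes that divide \<open>g\<close> but not \<open>a\<close>.\<close>

lemma coprime_shift:
  fixes a b g :: int
  assumes 1: "\<And>p. p dvd a \<Longrightarrow> p dvd b \<Longrightarrow> p dvd g \<Longrightarrow> is_unit p" and 0: "g = 0 \<Longrightarrow> b = 0"
  shows "\<exists>t. coprime (a + t * b) g"
proof (cases "g = 0")
  case True
  then have "coprime (a + 0 * b) g" using 1 0 by (intro coprimeI) auto
  then show ?thesis by blast
next
  case False
  define P where "P = {p \<in> prime_factors g. \<not> p dvd a}"
  have fin: "finite P" by (simp add: P_def)
  let ?t = "\<Prod>P"
  have "coprime (a + ?t * b) g"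
  proof (rule ccontr)
    assume "\<not> coprime (a + ?t * b) g"
    then obtain c where c: "c dvd a + ?t * b" "c dvd g" "\<not> is_unit c" by (rule not_coprimeE)
    then have "c \<noteq> 0" using False by auto
    then obtain p where "prime p" "p dvd c" using prime_divisor_exists c(3) by blast
    then have p: "prime p" "p dvd a + ?t * b" "p dvd g" using c dvd_trans by blast+
    have pg: "p \<in> prime_factors g" using p False by (simp add: prime_factors_dvd)
    show False
    proof (cases "p dvd a")
      case True
      then have "p dvd ?t * b" using p(2) by (metis dvd_add_right_iff)
      moreover have "\<not> p dvd ?t"
      proof
        assume "p dvd ?t"
        then obtain r where r: "r \<in> P" "p dvd r" using p(1) fin by (auto simp: prime_dvd_prod_iff)
        then have "prime r" by (auto simp: P_def)
        then have "p = r" using p(1) r(2) by (simp add: primes_dvd_imp_eq)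
        then show False using r(1) True by (simp add: P_def)
      qed
      ultimately have "p dvd b" using p(1) by (simp add: prime_dvd_mult_iff)
      then have "is_unit p" using 1[OF True _ p(3)] by blast
      then show False using p(1) not_prime_unit by blast
    next
      case False
      then have "p \<in> P" using pg by (simp add: P_def)
      then have "p dvd ?t" using dvd_prodI[OF fin, of p "\<lambda>x. x"] by simp
      then have "p dvd a" using p(2) by (metis dvd_add_left_iff dvd_mult2)
      then show False using False by simp
    qed
  qed
  then show ?thesis by blast
qed

lemma common_divisor_combination:
  fixes b :: "nat \<Rightarrow> int"
  shows "\<exists>z. \<forall>i<m. (\<Sum>j<m. z j * b j) dvd b i"
proof (induction m)
  case (Suc m)
  then obtain z where z: "\<And>i. i < m \<Longrightarrow> (\<Sum>j<m. z j * b j) dvd b i" by blast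
  let ?g = "\<Sum>j<m. z j * b j"
  obtain u v where uv: "u * ?g + v * b m = gcd ?g (b m)" using bezout_int by blast
  \<comment> \<open>The combination is the greatest common divisor of the old one and the new entry.\<close>
  define z' where "z' j = (if j = m then v else u * z j)" for j
  have "(\<Sum>j<Suc m. z' j * b j) = (\<Sum>j<m. u * (z j * b j)) + v * b m"
    by (simp add: z'_def mult.assoc)
  also have "\<dots> = gcd ?g (b m)" using uv by (simp add: sum_distrib_left)
  finally have "\<forall>i<Suc m. (\<Sum>j<Suc m. z' j * b j) dvd b i"
    using z by (auto simp: less_Suc_eq intro: dvd_trans[OF gcd_dvd1])
  then show ?case by blast
qed simp

text \<open>The stable range condition for \<open>Z\<close>: the last entry of a unimodular row of length at least \<open>3\<close> can be
used to make the other entries unimodular. The multiple added to the first entry only serves to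
avoid that all entries except the \<open>(k - 1)\<close>-st vanish.\<close>

lemma unimodular_shift:
  fixes a x :: "nat \<Rightarrow> int"
  assumes k: "k \<ge> 2" and x: "(\<Sum>i<Suc k. a i * x i) = 1"
  shows "\<exists>s t y. (\<Sum>i<k. (a i + (if i = 0 then s * a k else 0) + (if i = k - 1 then t * a k else 0)) * y i) = 1"
proof -
  \<comment> \<open>If \<open>a\<^sub>0, \<dots>, a\<^bsub>k-2\<^esub>\<close> all vanish, then \<open>a\<^sub>k\<close> takes the place of \<open>a\<^sub>0\<close>.\<close>
  define s :: int where "s = (if \<forall>i<k - 1. a i = 0 then 1 else 0)"
  define b where "b i = a i + (if i = 0 then s * a k else 0)" for i
  obtain z where z: "\<And>i. i < k - 1 \<Longrightarrow> (\<Sum>j<k - 1. z j * b j) dvd b i"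
    using common_divisor_combination by blast
  let ?g = "\<Sum>j<k - 1. z j * b j"
  have bk: "b (k - 1) = a (k - 1)" using k by (simp add: b_def)
  have "\<exists>t. coprime (b (k - 1) + t * a k) ?g"
  proof (rule coprime_shift)
    fix p assume p: "p dvd b (k - 1)" "p dvd a k" "p dvd ?g"
    have "p dvd a i" if "i < Suc k" for i
    proof -
      consider "i < k - 1" | "i = k - 1" | "i = k" using \<open>i < Suc k\<close> by linarith
      then show ?thesis
      proof cases
        case 1
        then have "p dvd b i" using z p(3) dvd_trans by blast
        moreover have "a i = b i - (if i = 0 then s * a k else 0)" by (simp add: b_def)
        ultimately show ?thesis using p(2) by simp
      qed (use p bk in auto)
    qed
    then have "p dvd (\<Sum>i<Suc k. a i * x i)" by (intro dvd_sum) simp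
    then show "is_unit p" using x by simp
  next
    assume g0: "?g = 0"
    then have b0: "b i = 0" if "i < k - 1" for i using z[OF that] by simp
    show "a k = 0"
    proof (cases "\<forall>i<k - 1. a i = 0")
      case True
      then show ?thesis using b0[of 0] k by (simp add: b_def s_def)
    next
      case False
      then have "s = 0" unfolding s_def by (rule if_not_P)
      then have "b i = a i" for i by (simp add: b_def)
      then show ?thesis using False b0 by auto
    qed
  qed
  then obtain t where t: "coprime (b (k - 1) + t * a k) ?g" by blast
  then obtain u v where uv: "u * (b (k - 1) + t * a k) + v * ?g = 1"
    using bezout_int[of "b (k - 1) + t * a k" ?g] by auto
  define y where "y i = (if i = k - 1 then u else v * z i)" for i
  have "{..<k} = insert (k - 1) {..<k - 1}" using k by auto
  then have "(\<Sum>i<k. (b i + (if i = k - 1 then t * a k else 0)) * y i) =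
      (b (k - 1) + t * a k) * u + (\<Sum>i<k - 1. (b i + (if i = k - 1 then t * a k else 0)) * y i)"
    by (simp add: y_def)
  also have "(\<Sum>i<k - 1. (b i + (if i = k - 1 then t * a k else 0)) * y i) = (\<Sum>i<k - 1. v * (z i * b i))"
    by (intro sum.cong) (auto simp: y_def)
  also have "\<dots> = v * ?g" by (simp add: sum_distrib_left)
  finally have "(\<Sum>i<k. (b i + (if i = k - 1 then t * a k else 0)) * y i) = 1" using uv by (simp add: mult.commute)
  then show ?thesis unfolding b_def by blast
qed

lemma row_operation:
  assumes "A \<in> carrier_mat n n" "i < n" "j < n" "r < n" "s < n"
  shows "(addrow_mat n t i j * A) $$ (r, s) = A $$ (r, s) + (if r = i then t * A $$ (j, s) else (0 :: int))"
  using assms by (simp flip: addrow_mat[OF assms(1,3)])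

lemma column_operation:
  assumes A: "A \<in> carrier_mat n n" and ij: "i < n" "j < n" "i \<noteq> j" and rs: "r < n" "s < n"
  shows "(A * addrow_mat n t i j) $$ (r, s) = A $$ (r, s) + (if s = j then t * A $$ (r, i) else (0 :: int))"
proof -
  have "(A * addrow_mat n t i j) $$ (r, s) = (\<Sum>l = 0..<n. A $$ (r, l) * addrow_mat n t i j $$ (l, s))"
    using A rs by (simp add: scalar_prod_def)
  also have "\<dots> = (\<Sum>l = 0..<n. (if l = s then A $$ (r, l) else 0) + (if l = i then (if s = j then t * A $$ (r, l) else 0) else 0))"
    using rs ij by (intro sum.cong) auto
  also have "\<dots> = A $$ (r, s) + (if s = j then t * A $$ (r, i) else 0)"
    using rs ij by (simp add: sum.distrib)
  finally show ?thesis .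
qed

locale SLn_length = SL_length n L K for n :: nat and L :: "int mat \<Rightarrow> real" and K :: real +
  assumes n: "n \<ge> 3"
begin

definition embed :: "int mat \<Rightarrow> int mat" where
  "embed X = four_block_mat X (0\<^sub>m 3 (n - 3)) (0\<^sub>m (n - 3) 3) (1\<^sub>m (n - 3))"

lemma embed_carrier: "X \<in> carrier_mat 3 3 \<Longrightarrow> embed X \<in> carrier_mat n n"
  unfolding embed_def using n four_block_carrier_mat[of X 3 3 "1\<^sub>m (n - 3)" "n - 3" "n - 3"] by simp

lemma embed_index:
  "X \<in> carrier_mat 3 3 \<Longrightarrow> i < n \<Longrightarrow> j < n \<Longrightarrow>
    embed X $$ (i, j) = (if i < 3 \<and> j < 3 then X $$ (i, j) else if i = j then 1 else 0)"
  unfolding embed_def using n by auto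

lemma embed_mult: "X \<in> carrier_mat 3 3 \<Longrightarrow> Y \<in> carrier_mat 3 3 \<Longrightarrow> embed (X * Y) = embed X * embed Y"
  unfolding embed_def
  by (subst mult_four_block_mat[of _ 3 3 _ "n - 3" _ "n - 3"]) auto

lemma embed_one: "embed (1\<^sub>m 3) = 1\<^sub>m n"
  unfolding embed_def by (rule eq_matI) (use n in auto)

lemma det_embed: "X \<in> carrier_mat 3 3 \<Longrightarrow> Determinant.det (embed X) = Determinant.det X"
  unfolding embed_def by (subst det_four_block_mat_upper_right_zero[of _ 3 _ "n - 3"]) auto

lemma embed_in_SL: "X \<in> carrier (SL_int 3) \<Longrightarrow> embed X \<in> carrier (SL_int n)"
  by (simp add: SL_int_def det_embed embed_carrier)

lemma embed_addrow_mat: "i < 3 \<Longrightarrow> j < 3 \<Longrightarrow> embed (addrow_mat 3 t i j) = addrow_mat n t i j"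
  unfolding embed_def by (rule eq_matI) (use n in auto)

sublocale corner: SL3_length "\<lambda>X. L (embed X)" K
proof
  fix A B assume AB: "A \<in> carrier (SL_int 3)" "B \<in> carrier (SL_int 3)"
  then have c: "A \<in> carrier_mat 3 3" "B \<in> carrier_mat 3 3" by (auto simp: SL_int_def)
  show "L (embed (A * B)) \<le> L (embed A) + L (embed B)"
    unfolding embed_mult[OF c] by (intro L_mult embed_in_SL AB)
  show "L (embed A) = L (embed B)" if "A * B = 1\<^sub>m 3"
    by (intro L_inv embed_in_SL AB) (simp add: that embed_one flip: embed_mult[OF c])
next
  fix i j :: nat and t :: int assume "i < 3" "j < 3" "i \<noteq> j"
  then show "L (embed (addrow_mat 3 t i j)) \<le> K" using n L_elem[of i j t] by (simp add: embed_addrow_mat)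
qed

lemma K_nonneg: "K \<ge> 0" by (rule corner.K_nonneg)

text \<open>The relation is directed: \<open>A\<close> is at most \<open>c\<close> longer than \<open>B\<close>.\<close>

definition close :: "real \<Rightarrow> int mat \<Rightarrow> int mat \<Rightarrow> bool" where
  "close c A B \<longleftrightarrow> B \<in> carrier (SL_int n) \<and> L A \<le> L B + c"

lemma close_trans: "close c A B \<Longrightarrow> close c' B C \<Longrightarrow> close (c + c') A C"
  by (auto simp: close_def)

lemma close_column:
  assumes "A \<in> carrier (SL_int n)" "i < n" "j < n" "i \<noteq> j"
  shows "close K A (A * addrow_mat n t i j)"
  using L_cancel(1)[OF assms(1) addrow_mat_in_SL[OF assms(4), where t = t]] L_elem[OF assms(2-4), of t]
    SL_mult[OF assms(1) addrow_mat_in_SL[OF assms(4), where t = t]] by (simp add: close_def)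

lemma gather_columns:
  fixes m :: nat
  assumes A: "A \<in> carrier (SL_int n)" and k: "k < n"
  shows "m \<le> k \<Longrightarrow> \<exists>B. close (m * K) A B \<and>
    (\<forall>r<n. \<forall>s<n. B $$ (r, s) = A $$ (r, s) + (if s = k then \<Sum>i<m. y i * A $$ (r, i) else 0))"
proof (induction m)
  case 0
  then show ?case using A by (intro exI[of _ A]) (auto simp: close_def)
next
  case (Suc m)
  then obtain B where B: "close (m * K) A B"
    "\<And>r s. r < n \<Longrightarrow> s < n \<Longrightarrow> B $$ (r, s) = A $$ (r, s) + (if s = k then \<Sum>i<m. y i * A $$ (r, i) else 0)"
    by auto
  have BS: "B \<in> carrier (SL_int n)" using B(1) by (simp add: close_def)
  have mk: "m < n" "m \<noteq> k" using Suc.prems k by auto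
  have "close (m * K + K) A (B * addrow_mat n (y m) m k)"
    by (rule close_trans[OF B(1) close_column[OF BS mk(1) k mk(2)]])
  moreover have "(B * addrow_mat n (y m) m k) $$ (r, s) =
      A $$ (r, s) + (if s = k then \<Sum>i<Suc m. y i * A $$ (r, i) else 0)" if "r < n" "s < n" for r s
    using column_operation[OF SL_carrier[OF BS] mk(1) k mk(2) that] B(2) that mk by (simp add: algebra_simps)
  ultimately show ?case by (intro exI[of _ "B * addrow_mat n (y m) m k"]) (simp add: algebra_simps)
qed

lemma spread_column:
  fixes m :: nat
  assumes A: "A \<in> carrier (SL_int n)" and k: "k < n"
  shows "m \<le> k \<Longrightarrow> \<exists>B. close (m * K) A B \<and>
    (\<forall>r<n. \<forall>s<n. B $$ (r, s) = A $$ (r, s) + (if s < m then w s * A $$ (r, k) else 0))"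
proof (induction m)
  case 0
  then show ?case using A by (intro exI[of _ A]) (auto simp: close_def)
next
  case (Suc m)
  then obtain B where B: "close (m * K) A B"
    "\<And>r s. r < n \<Longrightarrow> s < n \<Longrightarrow> B $$ (r, s) = A $$ (r, s) + (if s < m then w s * A $$ (r, k) else 0)"
    by auto
  have BS: "B \<in> carrier (SL_int n)" using B(1) by (simp add: close_def)
  have mk: "m < n" "k \<noteq> m" using Suc.prems k by auto
  have "close (m * K + K) A (B * addrow_mat n (w m) k m)"
    by (rule close_trans[OF B(1) close_column[OF BS k mk]])
  moreover have "(B * addrow_mat n (w m) k m) $$ (r, s) =
      A $$ (r, s) + (if s < Suc m then w s * A $$ (r, k) else 0)" if "r < n" "s < n" for r s
    using column_operation[OF SL_carrier[OF BS] k mk that] B(2) that mk k Suc.prems by (auto simp: less_Suc_eq)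
  ultimately show ?case by (intro exI[of _ "B * addrow_mat n (w m) k m"]) (simp add: algebra_simps)
qed

definition in_block :: "nat \<Rightarrow> int mat \<Rightarrow> bool" where
  "in_block k A \<longleftrightarrow> (\<forall>i<n. \<forall>j<n. k \<le> i \<or> k \<le> j \<longrightarrow> A $$ (i, j) = (if i = j then 1 else 0))"

lemma column_of_inverse:
  assumes A: "A \<in> carrier (SL_int n)" and k: "k < n"
  shows "\<exists>x. \<forall>r<n. (\<Sum>i<n. A $$ (r, i) * x i) = (if r = k then 1 else 0)"
proof -
  obtain B where B: "B \<in> carrier (SL_int n)" "A * B = 1\<^sub>m n" using SL_inverse_ex[OF A] by blast
  have "(A * B) $$ (r, k) = (\<Sum>i<n. A $$ (r, i) * B $$ (i, k))" if "r < n" for r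
    using SL_carrier[OF A] SL_carrier[OF B(1)] k that by (simp add: scalar_prod_def atLeast0LessThan)
  then show ?thesis using B(2) k by (intro exI[of _ "\<lambda>i. B $$ (i, k)"]) auto
qed

text \<open>Row \<open>k\<close> is made unimodular without its last entry, the last entry is then turned into \<open>1\<close>, and used to
clear the rest of the row. After that, column \<open>k\<close> of the inverse matrix gives the combination of columns
that clears column \<open>k\<close>.\<close>

lemma reduce_block:
  assumes A: "A \<in> carrier (SL_int n)" and k: "2 \<le> k" "k < n" and blk: "in_block (Suc k) A"
  shows "\<exists>B. close ((2 + 3 * real k) * K) A B \<and> in_block k B"
proof -
  let ?a = "\<lambda>i. A $$ (k, i)"
  obtain x where x: "(\<Sum>i<n. ?a i * x i) = 1" using column_of_inverse[OF A k(2)] k(2) by (metis (full_types))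
  have "(\<Sum>i<n. ?a i * x i) = (\<Sum>i<Suc k. ?a i * x i)"
    by (rule sum.mono_neutral_right) (use k blk in \<open>auto simp: in_block_def\<close>)
  then have "(\<Sum>i<Suc k. ?a i * x i) = 1" using x by simp
  from unimodular_shift[OF k(1) this]
  obtain s t y where y: "(\<Sum>i<k. (?a i + (if i = 0 then s * ?a k else 0) + (if i = k - 1 then t * ?a k else 0)) * y i) = 1"
    by blast
  have k0: "k \<noteq> 0" "k \<noteq> k - 1" "0 < n" "k - 1 < n" using k by auto
  define A1 where "A1 = A * addrow_mat n s k 0"
  have A1c: "close K A A1" unfolding A1_def by (rule close_column[OF A k(2) k0(3,1)])
  then have A1S: "A1 \<in> carrier (SL_int n)" by (simp add: close_def)
  have A1: "A1 $$ (r, j) = A $$ (r, j) + (if j = 0 then s * A $$ (r, k) else 0)" if "r < n" "j < n" for r j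
    unfolding A1_def by (rule column_operation[OF SL_carrier[OF A] k(2) k0(3,1) that])
  define A2 where "A2 = A1 * addrow_mat n t k (k - 1)"
  have A2c: "close K A1 A2" unfolding A2_def by (rule close_column[OF A1S k(2) k0(4,2)])
  then have A2S: "A2 \<in> carrier (SL_int n)" by (simp add: close_def)
  have A2: "A2 $$ (r, j) = A $$ (r, j) + (if j = 0 then s * A $$ (r, k) else 0) + (if j = k - 1 then t * A $$ (r, k) else 0)"
    if "r < n" "j < n" for r j
    using column_operation[OF SL_carrier[OF A1S] k(2) k0(4,2) that] A1 that k k0 unfolding A2_def by simp
  obtain A3 where A3c: "close (k * K) A2 A3" and A3: "\<And>r j. r < n \<Longrightarrow> j < n \<Longrightarrow>
      A3 $$ (r, j) = A2 $$ (r, j) + (if j = k then \<Sum>i<k. (1 - ?a k) * y i * A2 $$ (r, i) else 0)"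
    using gather_columns[OF A2S k(2) order_refl, of "\<lambda>i. (1 - ?a k) * y i"] by blast
  have A3S: "A3 \<in> carrier (SL_int n)" using A3c by (simp add: close_def)
  have A3kk: "A3 $$ (k, k) = 1"
  proof -
    have "(\<Sum>i<k. (1 - ?a k) * y i * A2 $$ (k, i)) = (1 - ?a k) *
        (\<Sum>i<k. (?a i + (if i = 0 then s * ?a k else 0) + (if i = k - 1 then t * ?a k else 0)) * y i)"
      unfolding sum_distrib_left by (intro sum.cong) (use k A2[of k] in \<open>auto simp: mult_ac\<close>)
    then show ?thesis unfolding y using A3[of k k] A2[of k k] k k0 by simp
  qed
  obtain A4 where A4c: "close (k * K) A3 A4" and A4: "\<And>r j. r < n \<Longrightarrow> j < n \<Longrightarrow>
      A4 $$ (r, j) = A3 $$ (r, j) + (if j < k then - A3 $$ (k, j) * A3 $$ (r, k) else 0)"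
    using spread_column[OF A3S k(2) order_refl, of "\<lambda>j. - A3 $$ (k, j)"] by blast
  have A4S: "A4 \<in> carrier (SL_int n)" using A4c by (simp add: close_def)
  have out: "A $$ (i, j) = (if i = j then 1 else 0)" if "i < n" "j < n" "k < i \<or> k < j" for i j
    using blk that by (auto simp: in_block_def Suc_le_eq)
  have out2: "A2 $$ (i, j) = (if i = j then 1 else 0)" if "i < n" "j < n" "k < i \<or> k < j" for i j
    using A2[OF that(1,2)] out[OF that] out[OF that(1) k(2)] that k by auto
  have out3: "A3 $$ (i, j) = (if i = j then 1 else 0)" if "i < n" "j < n" "k < i \<or> k < j" for i j
  proof -
    have "(\<Sum>l<k. (1 - ?a k) * y l * A2 $$ (i, l)) = 0" if "k < i"
      by (rule sum.neutral) (use that \<open>i < n\<close> k in \<open>auto simp: out2\<close>)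
    then show ?thesis using A3[OF that(1,2)] out2[OF that] that(3) by auto
  qed
  have out4: "A4 $$ (i, j) = (if i = j then 1 else 0)" if "i < n" "j < n" "k < i \<or> k < j" for i j
    using A4[OF that(1,2)] out3[OF that] out3[OF that(1) k(2)] that(3) by auto
  have row4: "A4 $$ (k, j) = (if j = k then 1 else 0)" if "j < n" for j
    using A4[OF k(2) that] A3kk out4[OF k(2) that] by (cases "j < k"; cases "j = k") auto
  obtain z where z: "\<And>r. r < n \<Longrightarrow> (\<Sum>i<n. A4 $$ (r, i) * z i) = (if r = k then 1 else 0)"
    using column_of_inverse[OF A4S k(2)] by blast
  have z_sum: "(\<Sum>i<n. A4 $$ (r, i) * z i) = (\<Sum>i<k. z i * A4 $$ (r, i)) + A4 $$ (r, k) * z k" if "r \<le> k" for r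
  proof -
    have "(\<Sum>i<n. A4 $$ (r, i) * z i) = (\<Sum>i<Suc k. A4 $$ (r, i) * z i)"
      by (rule sum.mono_neutral_right) (use that k out4 in auto)
    then show ?thesis by (simp add: mult.commute)
  qed
  have "(\<Sum>i<k. z i * A4 $$ (k, i)) = 0" using row4 k by (intro sum.neutral) auto
  then have zk: "z k = 1" using z[OF k(2)] z_sum[of k] row4[OF k(2)] by simp
  obtain B where Bc: "close (k * K) A4 B" and B: "\<And>r j. r < n \<Longrightarrow> j < n \<Longrightarrow>
      B $$ (r, j) = A4 $$ (r, j) + (if j = k then \<Sum>i<k. z i * A4 $$ (r, i) else 0)"
    using gather_columns[OF A4S k(2) order_refl, of z] by blast
  have "in_block k B" unfolding in_block_def
  proof (intro allI impI)
    fix i j assume ij: "i < n" "j < n" "k \<le> i \<or> k \<le> j"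
    show "B $$ (i, j) = (if i = j then 1 else 0)"
    proof (cases "k < i")
      case True
      then have "(\<Sum>l<k. z l * A4 $$ (i, l)) = 0"
        by (intro sum.neutral) (use ij k in \<open>auto simp: out4\<close>)
      then show ?thesis using B[OF ij(1,2)] out4[OF ij(1,2)] True by simp
    next
      case False
      then have "A4 $$ (i, k) + (\<Sum>l<k. z l * A4 $$ (i, l)) = (if i = k then 1 else 0)"
        using z[OF ij(1)] z_sum[of i] zk by simp
      then show ?thesis using B[OF ij(1,2)] row4[OF ij(2)] out4[OF ij(1,2)] ij(3) False
        by (cases "j = k"; cases "i = k") auto
    qed
  qed
  moreover have "close (K + (K + (k * K + (k * K + k * K)))) A B"
    by (intro close_trans[OF A1c] close_trans[OF A2c] close_trans[OF A3c] close_trans[OF A4c] Bc)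
  ultimately show ?thesis by (intro exI[of _ B]) (simp add: algebra_simps)
qed

lemma reduce_to_block_2:
  assumes "A \<in> carrier (SL_int n)"
  shows "\<exists>B. close (n * ((2 + 3 * real n) * K)) A B \<and> in_block 2 B"
proof -
  have "\<exists>B. close (j * ((2 + 3 * real n) * K)) A B \<and> in_block (n - j) B" if "j \<le> n - 2" for j
    using that
  proof (induction j)
    case 0
    show ?case using assms by (intro exI[of _ A]) (auto simp: close_def in_block_def)
  next
    case (Suc j)
    then obtain B where B: "close (j * ((2 + 3 * real n) * K)) A B" "in_block (n - j) B" by auto
    let ?k = "n - Suc j"
    have k: "2 \<le> ?k" "?k < n" "Suc ?k = n - j" using Suc.prems n by auto
    have "B \<in> carrier (SL_int n)" using B(1) by (simp add: close_def)
    then obtain C where C: "close ((2 + 3 * real ?k) * K) B C" "in_block ?k C"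
      using reduce_block[OF _ k(1,2)] B(2) unfolding k(3) by blast
    have "(2 + 3 * real ?k) * K \<le> (2 + 3 * real n) * K" using K_nonneg by (intro mult_right_mono) auto
    then have "close ((2 + 3 * real n) * K) B C" using C(1) by (simp add: close_def)
    from close_trans[OF B(1) this] C(2) show ?case by (intro exI[of _ C]) (simp add: algebra_simps)
  qed
  from this[of "n - 2"] obtain B where B: "close (real (n - 2) * ((2 + 3 * real n) * K)) A B" "in_block 2 B"
    using n by auto
  have "real (n - 2) * ((2 + 3 * real n) * K) \<le> n * ((2 + 3 * real n) * K)"
    using K_nonneg by (intro mult_right_mono) auto
  then have "close (n * ((2 + 3 * real n) * K)) A B" using B(1) unfolding close_def by linarith
  then show ?thesis using B(2) by blast
qed

lemma block_2_bounded:
  assumes A: "A \<in> carrier (SL_int n)" and blk: "in_block 2 A"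
  shows "L A \<le> 350 * K"
proof -
  define a b c d where "a = A $$ (0, 0)" and "b = A $$ (0, 1)" and "c = A $$ (1, 0)" and "d = A $$ (1, 1)"
  let ?X = "M3 a b 0 c d 0 0 0 1"
  have "A = embed ?X"
  proof (rule eq_matI)
    fix i j assume "i < dim_row (embed ?X)" "j < dim_col (embed ?X)"
    then have ij: "i < n" "j < n" using embed_carrier[OF M3_carrier, of a b 0 c d 0 0 0 1] by auto
    have out: "A $$ (i, j) = (if i = j then 1 else 0)" if "2 \<le> i \<or> 2 \<le> j"
      using blk ij that unfolding in_block_def by blast
    show "A $$ (i, j) = embed ?X $$ (i, j)"
    proof (cases "i < 2 \<and> j < 2")
      case True
      then consider "i = 0 \<and> j = 0" | "i = 0 \<and> j = 1" | "i = 1 \<and> j = 0" | "i = 1 \<and> j = 1" by linarith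
      then show ?thesis using n by cases (auto simp: embed_def M3_def a_def b_def c_def d_def)
    next
      case False
      have "embed ?X $$ (i, j) = (if i = j then 1 else 0)"
      proof (cases "i < 3 \<and> j < 3")
        case True
        then show ?thesis using False unfolding embed_index[OF M3_carrier ij]
          by (auto simp: M3_def numeral_3_eq_3 numeral_2_eq_2 less_Suc_eq)
      qed (use embed_index[OF M3_carrier ij] in auto)
      then show ?thesis using out False by auto
    qed
  qed (use SL_carrier[OF A] embed_carrier[OF M3_carrier, of a b 0 c d 0 0 0 1] in auto)
  moreover have "a * d - b * c = 1"
  proof -
    have "Determinant.det (embed ?X) = 1" using A calculation by (simp add: SL_int_def)
    then show ?thesis by (simp add: det_embed det_M3)
  qed
  ultimately show ?thesis using corner.len2_bounded[of a d b c] by (simp add: corner.len2_def)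
qed

theorem length_bounded:
  "\<exists>C. \<forall>A\<in>carrier (SL_int n). L A \<le> C"
proof (intro exI ballI)
  fix A assume "A \<in> carrier (SL_int n)"
  then obtain B where B: "close (n * ((2 + 3 * real n) * K)) A B" "in_block 2 B" using reduce_to_block_2 by blast
  then show "L A \<le> 350 * K + n * ((2 + 3 * real n) * K)"
    using block_2_bounded[of B] by (simp add: close_def)
qed

end

section \<open>Actions of SL(n, Z) by semisimple isometries\<close>

lemma addrow_mat_add:
  assumes "i < n" "j < n" "i \<noteq> j"
  shows "addrow_mat n s i j * addrow_mat n t i j = addrow_mat n (s + t :: int) i j"
  by (rule eq_matI) (use assms in \<open>auto simp: row_operation[OF addrow_mat_carrier] simp del: index_mult_mat(1)\<close>)

lemma addrow_mat_commutator:
  assumes "i < n" "j < n" "l < n" "i \<noteq> j" "i \<noteq> l" "l \<noteq> j"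
  shows "addrow_mat n s i l * addrow_mat n t l j =
    addrow_mat n (s * t :: int) i j * (addrow_mat n t l j * addrow_mat n s i l)"
  by (rule eq_matI)
    (use assms in \<open>auto simp: row_operation[OF addrow_mat_carrier] row_operation[OF mult_carrier_mat[OF addrow_mat_carrier addrow_mat_carrier]]
      simp del: index_mult_mat(1)\<close>)

locale SL_action = CAT0 M d for M :: "'a set" and d :: "'a \<Rightarrow> 'a \<Rightarrow> real" +
  fixes n :: nat and \<rho> :: "int mat \<Rightarrow> 'a \<Rightarrow> 'a"
  assumes n: "n \<ge> 3" and hom: "\<rho> \<in> hom (SL_int n) (Isom M d)"
    and semisimple: "\<And>g. g \<in> carrier (SL_int n) \<Longrightarrow> semisimple M d (\<rho> g)"
begin

lemma action_isometric: "g \<in> carrier (SL_int n) \<Longrightarrow> isometric_self_map (\<rho> g)"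
  using hom_in_carrier[OF hom] Bij_imp_funcset[of "\<rho> g" M] by (auto simp: Isom_def isometric_self_map_def)

lemma action_in: "g \<in> carrier (SL_int n) \<Longrightarrow> x \<in> M \<Longrightarrow> \<rho> g x \<in> M"
  using action_isometric by (auto simp: isometric_self_map_def)

lemma action_dist: "g \<in> carrier (SL_int n) \<Longrightarrow> x \<in> M \<Longrightarrow> y \<in> M \<Longrightarrow> d (\<rho> g x) (\<rho> g y) = d x y"
  using action_isometric by (auto simp: isometric_self_map_def)

lemma action_mult:
  assumes g: "g \<in> carrier (SL_int n)" "h \<in> carrier (SL_int n)" and x: "x \<in> M"
  shows "\<rho> (g * h) x = \<rho> g (\<rho> h x)"
proof -
  have "\<rho> g \<in> Bij M" "\<rho> h \<in> Bij M" using hom_in_carrier[OF hom] g by (auto simp: Isom_def)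
  moreover have "\<rho> (g * h) = \<rho> g \<otimes>\<^bsub>Isom M d\<^esub> \<rho> h" using hom_mult[OF hom g] by (simp add: SL_int_def)
  ultimately show ?thesis using x by (simp add: Isom_def BijGroup_def compose_eq)
qed

lemma action_one: "x \<in> M \<Longrightarrow> \<rho> (1\<^sub>m n) x = x"
proof -
  assume x: "x \<in> M"
  have "\<rho> \<one>\<^bsub>SL_int n\<^esub> = \<one>\<^bsub>Isom M d\<^esub>"
    by (rule hom_one[OF hom group_SL_int group_Isom])
  then show ?thesis using x by (simp add: SL_int_def Isom_def BijGroup_def)
qed

definition len :: "'a \<Rightarrow> int mat \<Rightarrow> real" where
  "len x g = d (\<rho> g x) x"

lemma len_mult:
  assumes "g \<in> carrier (SL_int n)" "h \<in> carrier (SL_int n)" "x \<in> M"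
  shows "len x (g * h) \<le> len x g + len x h"
proof -
  have "d (\<rho> g (\<rho> h x)) x \<le> d (\<rho> g (\<rho> h x)) (\<rho> g x) + d (\<rho> g x) x"
    using assms by (intro triangle action_in)
  then show ?thesis using assms by (simp add: len_def action_mult action_dist action_in)
qed

lemma len_inv:
  assumes "g \<in> carrier (SL_int n)" "h \<in> carrier (SL_int n)" "x \<in> M" "g * h = 1\<^sub>m n"
  shows "len x g = len x h"
proof -
  have "\<rho> g (\<rho> h x) = x" using action_mult[OF assms(1-3)] action_one[OF assms(3)] assms(4) by simp
  then have "d (\<rho> g x) x = d (\<rho> g x) (\<rho> g (\<rho> h x))" by simp
  also have "\<dots> = d x (\<rho> h x)" using assms by (simp add: action_dist action_in)
  finally show ?thesis by (simp add: len_def commute)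
qed

lemma len_addrow_mat_le:
  assumes ij: "i < n" "j < n" "i \<noteq> j" and x: "x \<in> M"
  shows "len x (addrow_mat n (int m) i j) \<le> m * len x (addrow_mat n 1 i j)"
proof (induction m)
  case 0
  have "addrow_mat n 0 i j = (1\<^sub>m n :: int mat)" by (rule eq_matI) auto
  then show ?case using x by (simp add: len_def action_one)
next
  case (Suc m)
  have "addrow_mat n (int (Suc m)) i j = addrow_mat n 1 i j * addrow_mat n (int m) i j"
    using addrow_mat_add[OF ij, of 1 "int m"] by simp
  then have "len x (addrow_mat n (int (Suc m)) i j) \<le> len x (addrow_mat n 1 i j) + len x (addrow_mat n (int m) i j)"
    using len_mult[OF addrow_mat_in_SL[OF ij(3)] addrow_mat_in_SL[OF ij(3)] x] by simp
  then show ?case using Suc by (simp add: algebra_simps)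
qed

lemma len_minus_addrow_mat:
  assumes ij: "i < n" "j < n" "i \<noteq> j" and x: "x \<in> M"
  shows "len x (addrow_mat n (- t) i j) = len x (addrow_mat n t i j)"
  by (rule len_inv[symmetric]) (use ij x addrow_mat_inv in \<open>auto intro: addrow_mat_in_SL\<close>)

lemma len_addrow_mat_distorted:
  assumes ij: "i < n" "j < n" "i \<noteq> j" and l: "l < n" "l \<noteq> i" "l \<noteq> j" and x: "x \<in> M"
  shows "len x (addrow_mat n (int m * int m) i j) \<le> 2 * m * (len x (addrow_mat n 1 i l) + len x (addrow_mat n 1 l j))"
proof -
  let ?U = "addrow_mat n (int m) i l" and ?V = "addrow_mat n (int m) l j" and ?W = "addrow_mat n (int m * int m) i j"
  let ?U' = "addrow_mat n (- int m) i l" and ?V' = "addrow_mat n (- int m) l j"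
  have S: "?U \<in> carrier (SL_int n)" "?V \<in> carrier (SL_int n)" "?W \<in> carrier (SL_int n)"
    "?U' \<in> carrier (SL_int n)" "?V' \<in> carrier (SL_int n)"
    using ij l by (auto intro!: addrow_mat_in_SL)
  have C: "?U \<in> carrier_mat n n" "?V \<in> carrier_mat n n" "?W \<in> carrier_mat n n"
    "?U' \<in> carrier_mat n n" "?V' \<in> carrier_mat n n" by auto
  have "?U * ?V * (?U' * ?V') = ?W * (?V * ?U) * (?U' * ?V')"
    using addrow_mat_commutator[of i n j l "int m" "int m"] ij l by simp
  also have "\<dots> = ?W * (?V * ?U * (?U' * ?V'))"
    by (rule assoc_mult_mat[of _ n n _ n _ n]) (use C in auto)
  also have "?V * ?U * (?U' * ?V') = ?V * (?U * (?U' * ?V'))"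
    by (rule assoc_mult_mat[of _ n n _ n _ n]) (use C in auto)
  also have "?U * (?U' * ?V') = ?U * ?U' * ?V'"
    by (rule assoc_mult_mat[of _ n n _ n _ n, symmetric]) (use C in auto)
  also have "?W * (?V * (?U * ?U' * ?V')) = ?W"
    using ij l addrow_mat_inv[of i n l "int m"] addrow_mat_inv[of l n j "int m"] C
    by (simp add: right_mult_one_mat[of _ n n] left_mult_one_mat[of _ n n])
  finally have "len x ?W \<le> len x (?U * ?V) + len x (?U' * ?V')"
    using len_mult[OF SL_mult[OF S(1,2)] SL_mult[OF S(4,5)] x] by simp
  also have "\<dots> \<le> (len x ?U + len x ?V) + (len x ?U' + len x ?V')"
    by (intro add_mono len_mult S x)
  also have "\<dots> = 2 * (len x ?U + len x ?V)"
    using ij l x by (simp add: len_minus_addrow_mat)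
  also have "\<dots> \<le> 2 * (m * len x (addrow_mat n 1 i l) + m * len x (addrow_mat n 1 l j))"
    using ij l x by (intro mult_left_mono add_mono len_addrow_mat_le) auto
  finally show ?thesis by (simp add: algebra_simps)
qed

text \<open>The generator \<open>E\<^sub>i\<^sub>j(1)\<close> is quadratically distorted by the commutator formula, so it fixes a point; its
powers \<open>E\<^sub>i\<^sub>j(t)\<close> fix the same point.\<close>

lemma addrow_mat_fixes_point:
  assumes ij: "i < n" "j < n" "i \<noteq> j"
  shows "\<exists>y\<in>M. \<forall>t. \<rho> (addrow_mat n t i j) y = y"
proof -
  let ?E = "\<lambda>t. addrow_mat n t i j"
  have E: "?E t \<in> carrier (SL_int n)" for t by (rule addrow_mat_in_SL[OF ij(3)])
  have "card ({..<n} - {i, j}) \<ge> 1" using n ij by simp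
  then have "{..<n} - {i, j} \<noteq> {}" by force
  then obtain l where l: "l < n" "l \<noteq> i" "l \<noteq> j" by auto
  obtain x where x: "x \<in> M" using CAT0 by (auto simp: CAT0_space_def)
  have pow: "(\<rho> (?E 1) ^^ m) z = \<rho> (?E (int m)) z" if z: "z \<in> M" for m z
  proof (induction m)
    case 0
    have "addrow_mat n (0 :: int) i j = 1\<^sub>m n" by (rule eq_matI) auto
    then show ?case using z by (simp add: action_one)
  next
    case (Suc m)
    have "\<rho> (?E (int (Suc m))) z = \<rho> (?E 1 * ?E (int m)) z" using addrow_mat_add[OF ij, of 1 "int m"] by simp
    then show ?case using Suc z E by (simp add: action_mult)
  qed
  let ?C = "2 * (len x (addrow_mat n 1 i l) + len x (addrow_mat n 1 l j))"
  have "\<exists>y\<in>M. \<rho> (?E 1) y = y"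
  proof (rule distorted_semisimple_fixes_point[OF semisimple[OF E] x])
    fix k
    have "int (4 ^ k) = int (2 ^ k) * int (2 ^ k)" by (simp flip: power_mult_distrib)
    then have "d ((\<rho> (?E 1) ^^ (4 ^ k)) x) x = len x (?E (int (2 ^ k) * int (2 ^ k)))"
      unfolding pow[OF x] len_def by simp
    also have "\<dots> \<le> 2 * real (2 ^ k) * (len x (addrow_mat n 1 i l) + len x (addrow_mat n 1 l j))"
      by (rule len_addrow_mat_distorted[OF ij l x])
    finally show "d ((\<rho> (?E 1) ^^ (4 ^ k)) x) x \<le> ?C * 2 ^ k" by (simp add: algebra_simps)
  qed
  then obtain y where y: "y \<in> M" "\<rho> (?E 1) y = y" by blast
  have "(\<rho> (?E 1) ^^ m) y = y" for m using y(2) by (induction m) simp_all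
  then have pos: "\<rho> (?E (int m)) y = y" for m using pow[OF y(1)] by simp
  have neg: "\<rho> (?E (- int m)) y = y" for m
  proof -
    have "?E (- int m) * ?E (int m) = 1\<^sub>m n" using addrow_mat_inv[of i n j "- int m"] ij by simp
    then have "\<rho> (?E (- int m)) (\<rho> (?E (int m)) y) = y"
      using action_mult[OF E E y(1), of "- int m" "int m"] action_one[OF y(1)] by simp
    then show ?thesis using pos by simp
  qed
  have "\<rho> (?E t) y = y" for t using pos neg by (cases t rule: int_cases2) auto
  then show ?thesis using y(1) by blast
qed

lemma len_addrow_mat_bounded:
  assumes x: "x \<in> M"
  shows "\<exists>K. \<forall>i<n. \<forall>j<n. \<forall>t. i \<noteq> j \<longrightarrow> len x (addrow_mat n t i j) \<le> K"
proof -
  have "\<exists>B. \<forall>t. len x (addrow_mat n t i j) \<le> B" if ij: "i < n" "j < n" "i \<noteq> j" for i j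
  proof -
    obtain y where y: "y \<in> M" "\<And>t. \<rho> (addrow_mat n t i j) y = y" using addrow_mat_fixes_point[OF ij] by blast
    have "len x (addrow_mat n t i j) \<le> 2 * d x y" for t
    proof -
      have E: "addrow_mat n t i j \<in> carrier (SL_int n)" by (rule addrow_mat_in_SL[OF ij(3)])
      have "d (\<rho> (addrow_mat n t i j) x) x \<le> d (\<rho> (addrow_mat n t i j) x) (\<rho> (addrow_mat n t i j) y) + d y x"
        unfolding y(2) using x y(1) E by (intro triangle action_in)
      then show ?thesis using action_dist[OF E x y(1)] by (simp add: len_def commute)
    qed
    then show ?thesis by blast
  qed
  then obtain B where B: "\<And>i j t. i < n \<Longrightarrow> j < n \<Longrightarrow> i \<noteq> j \<Longrightarrow> len x (addrow_mat n t i j) \<le> B i j" by metis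
  let ?S = "(\<lambda>(i, j). B i j) ` ({..<n} \<times> {..<n})"
  have "B i j \<le> Max ?S" if "i < n" "j < n" for i j using that by (intro Max_ge) auto
  then show ?thesis using B order_trans by blast
qed

lemma fixed_point:
  assumes complete: "mcomplete"
  shows "\<exists>x\<in>M. \<forall>g\<in>carrier (SL_int n). \<rho> g x = x"
proof -
  obtain a where a: "a \<in> M" using CAT0 by (auto simp: CAT0_space_def)
  obtain K where K: "\<And>i j t. i < n \<Longrightarrow> j < n \<Longrightarrow> i \<noteq> j \<Longrightarrow> len a (addrow_mat n t i j) \<le> K"
    using len_addrow_mat_bounded[OF a] by blast
  interpret SLn_length n "len a" K
    by standard (use n K a len_mult len_inv in auto)
  obtain C where C: "\<And>g. g \<in> carrier (SL_int n) \<Longrightarrow> len a g \<le> C" using length_bounded by blast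
  let ?G = "carrier (SL_int n)"
  let ?S = "(\<lambda>g. \<rho> g a) ` ?G"
  have one: "1\<^sub>m n \<in> ?G" by (simp add: SL_int_def)
  have "\<exists>x\<in>M. \<forall>f\<in>\<rho> ` ?G. f x = x"
  proof (rule circumcenter_fixed[OF complete, of ?S a C])
    show "?S \<subseteq> M" using action_in a by blast
    show "?S \<noteq> {}" using one by blast
    show "d a x \<le> C" if "x \<in> ?S" for x using that C by (auto simp: len_def commute)
    show "isometric_self_map f \<and> f ` ?S = ?S" if f: "f \<in> \<rho> ` ?G" for f
    proof -
      obtain g where g: "g \<in> ?G" "f = \<rho> g" using f by blast
      obtain g' where g': "g' \<in> ?G" "g * g' = 1\<^sub>m n"
        using SL_inverse_ex[OF g(1)] by blast
      have "f ` ?S \<subseteq> ?S"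
      proof clarify
        fix h assume h: "h \<in> ?G"
        then have "f (\<rho> h a) = \<rho> (g * h) a" using action_mult[OF g(1) h a] g(2) by simp
        then show "f (\<rho> h a) \<in> ?S" using SL_mult[OF g(1) h] by blast
      qed
      moreover have "?S \<subseteq> f ` ?S"
      proof clarify
        fix h assume h: "h \<in> ?G"
        have "\<rho> h a = \<rho> (g * g' * h) a" using SL_carrier[OF h] by (simp add: g'(2) left_mult_one_mat)
        also have "g * g' * h = g * (g' * h)"
          by (rule assoc_mult_mat) (use SL_carrier g(1) g'(1) h in blast)+
        also have "\<rho> (g * (g' * h)) a = f (\<rho> (g' * h) a)"
          using action_mult[OF g(1) SL_mult[OF g'(1) h] a] g(2) by simp
        finally show "\<rho> h a \<in> f ` ?S" using SL_mult[OF g'(1) h] by blast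
      qed
      ultimately show ?thesis using action_isometric[OF g(1)] g(2) by auto
    qed
  qed (rule a)
  then show ?thesis by blast
qed

end

theorem proposition9p2:
  fixes n :: nat
    and M :: "'a set"
    and d :: "'a \<Rightarrow> 'a \<Rightarrow> real"
    and \<rho> :: "int mat \<Rightarrow> 'a \<Rightarrow> 'a"
  assumes "n \<ge> 3"
    and "CAT0_space M d"
    and "Metric_space.mcomplete M d"
    and "\<rho> \<in> hom (SL_int n) (Isom M d)"
    and "\<forall>g\<in>carrier (SL_int n). semisimple M d (\<rho> g)"
  shows "\<exists>x\<in>M. \<forall>g\<in>carrier (SL_int n). \<rho> g x = x"
proof -
  interpret Metric_space M d using assms(2) by (simp add: CAT0_space_def)
  interpret SL_action M d n \<rho> by unfold_locales (use assms in auto)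
  show ?thesis by (rule fixed_point[OF assms(3)])
qed

end
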